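(* Let $\mu\in\mathbb{R}$. (i) The process $\xi^{(\mu)}=\{\xi_t^{(\mu)}\}_{t\ge0}$ is a diffusion process with respect to the natural filtration $\{\mathcal{B}_t^{(\mu)}\}$ of $B^{(\mu)}$, and its infinitesimal generator is given by $$2x^2\frac{d^2}{dx^2}+\big((2-2\mu)x+1\big)\frac{d}{dx}.$$ (ii) For every fixed $t>0$, the following three random variables have the same law: $$\xi_t^{(\mu)},\qquad \int_0^t\exp(-2B_s^{(\mu)})\,ds,\qquad \int_0^t\exp(2B_s^{(-\mu)})\,ds.$$
   Context: $B=\{B_t,t\ge0\}$ is a one-dimensional Brownian motion with $B_0=0$. For $\mu\in\mathbb{R}$, $B_t^{(\mu)}=B_t+\mu t$, $\mathcal{B}_t^{(\mu)}=\sigma\{B_s^{(\mu)},s\le t\}$, and $\xi_t^{(\mu)}=\exp(-2B_t^{(\mu)})\int_0^t\exp(2B_s^{(\mu)})\,ds$. *)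

theory Defs
  imports "HOL-Probability.Probability"
begin

text \<open>All paths (not just almost all) are continuous and start at 0; the natural filtration below
  is not completed, so this is what makes pathwise functionals of \<open>B\<close> adapted to it.\<close>

definition brownian_motion :: "'a measure \<Rightarrow> (real \<Rightarrow> 'a \<Rightarrow> real) \<Rightarrow> bool" where
  "brownian_motion M B \<longleftrightarrow>
     prob_space M \<and>
     (\<forall>t\<ge>0. B t \<in> borel_measurable M) \<and>
     (\<forall>\<omega>\<in>space M. B 0 \<omega> = 0) \<and>
     (\<forall>\<omega>\<in>space M. continuous_on {0..} (\<lambda>t. B t \<omega>)) \<and>
     (\<forall>s t. 0 \<le> s \<longrightarrow> s < t \<longrightarrow>
        distributed M lborel (\<lambda>\<omega>. B t \<omega> - B s \<omega>) (normal_density 0 (sqrt (t - s)))) \<and>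
     (\<forall>(n::nat) ts. 0 \<le> ts 0 \<longrightarrow> (\<forall>i<n. ts i < ts (Suc i)) \<longrightarrow>
        prob_space.indep_vars M (\<lambda>_. borel) (\<lambda>i \<omega>. B (ts (Suc i)) \<omega> - B (ts i) \<omega>) {..<n})"

definition with_drift :: "(real \<Rightarrow> 'a \<Rightarrow> real) \<Rightarrow> real \<Rightarrow> real \<Rightarrow> 'a \<Rightarrow> real" where
  "with_drift B \<mu> t \<omega> = B t \<omega> + \<mu> * t"

text \<open>Processes are indexed by real times \<open>t \<ge> 0\<close>; filtrations are indexed by \<^typ>\<open>ennreal\<close>, so that
  the library's stopping times may take the value \<open>\<infinity>\<close>, the \<open>\<sigma>\<close>-algebra at \<open>\<infinity>\<close> being the one
  generated by the whole process.\<close>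

definition natural_filtration ::
    "'a measure \<Rightarrow> (real \<Rightarrow> 'a \<Rightarrow> real) \<Rightarrow> ennreal \<Rightarrow> 'a measure" where
  "natural_filtration M X t =
     sigma (space M)
       (\<Union>s\<in>{s. 0 \<le> s \<and> ennreal s \<le> t}. {X s -` A \<inter> space M | A. A \<in> sets borel})"

text \<open>Continuous functions on \<open>S\<close> vanishing at infinity, in the sense of the locally compact
  space \<open>S\<close> (so also at endpoints of the interval that do not belong to it).\<close>

definition C0 :: "real set \<Rightarrow> (real \<Rightarrow> real) set" where
  "C0 S = {f. continuous_on S f \<and>
              (\<forall>e>0. \<exists>K. compact K \<and> K \<subseteq> S \<and> (\<forall>x\<in>S - K. \<bar>f x\<bar> < e))}"

text \<open>\<open>Cc2 S f f' f''\<close>: \<open>f\<close> is twice continuously differentiable with compact support in \<open>S\<close>, with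
  derivatives \<open>f'\<close>, \<open>f''\<close>. At an endpoint belonging to \<open>S\<close> the derivatives are one-sided, and
  no boundary condition is imposed there.\<close>

definition Cc2 ::
    "real set \<Rightarrow> (real \<Rightarrow> real) \<Rightarrow> (real \<Rightarrow> real) \<Rightarrow> (real \<Rightarrow> real) \<Rightarrow> bool" where
  "Cc2 S f f' f'' \<longleftrightarrow>
     (\<forall>x\<in>S. (f has_real_derivative f' x) (at x within S)) \<and>
     (\<forall>x\<in>S. (f' has_real_derivative f'' x) (at x within S)) \<and>
     continuous_on S f'' \<and>
     (\<exists>K. compact K \<and> K \<subseteq> S \<and> (\<forall>x\<in>S - K. f x = 0))"

definition feller_semigroup :: "real set \<Rightarrow> (real \<Rightarrow> real \<Rightarrow> real measure) \<Rightarrow> bool" where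
  "feller_semigroup S P \<longleftrightarrow>
     (\<forall>t\<ge>0. P t \<in> restrict_space borel S \<rightarrow>\<^sub>M prob_algebra (restrict_space borel S)) \<and>
     (\<forall>x\<in>S. P 0 x = return (restrict_space borel S) x) \<and>
     (\<forall>s\<ge>0. \<forall>t\<ge>0. \<forall>x\<in>S. P (s + t) x = P s x \<bind> P t) \<and>
     (\<forall>f\<in>C0 S. \<forall>t\<ge>0. (\<lambda>x. \<integral>y. f y \<partial>P t x) \<in> C0 S) \<and>
     (\<forall>f\<in>C0 S. uniform_limit S (\<lambda>t x. \<integral>y. f y \<partial>P t x) f (at_right 0))"

text \<open>The graph of the infinitesimal generator: \<open>f\<close> is in the domain, with image \<open>g\<close>.\<close>

definition in_generator ::
    "real set \<Rightarrow> (real \<Rightarrow> real \<Rightarrow> real measure) \<Rightarrow> (real \<Rightarrow> real) \<Rightarrow> (real \<Rightarrow> real) \<Rightarrow> bool" where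
  "in_generator S P f g \<longleftrightarrow>
     f \<in> C0 S \<and> g \<in> C0 S \<and>
     uniform_limit S (\<lambda>t x. ((\<integral>y. f y \<partial>P t x) - f x) / t) g (at_right 0)"

text \<open>Strong Markov property of \<open>X\<close> with respect to \<open>F\<close>:
  \<open>E[f(X\<^bsub>T+s\<^esub>) | F\<^bsub>T\<^esub>] = (P\<^bsub>s\<^esub> f)(X\<^bsub>T\<^esub>)\<close> almost surely on \<open>{T < \<infinity>}\<close>. Constant \<open>T\<close> give the
  ordinary Markov property.\<close>

definition strong_markov ::
    "'a measure \<Rightarrow> (ennreal \<Rightarrow> 'a measure) \<Rightarrow> real set \<Rightarrow> (real \<Rightarrow> real \<Rightarrow> real measure) \<Rightarrow>
     (real \<Rightarrow> 'a \<Rightarrow> real) \<Rightarrow> bool" where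
  "strong_markov M F S P X \<longleftrightarrow>
     (\<forall>T s f. stopping_time F T \<longrightarrow> 0 \<le> s \<longrightarrow>
        f \<in> borel_measurable (restrict_space borel S) \<longrightarrow> bounded (f ` S) \<longrightarrow>
        (AE \<omega> in M.
           real_cond_exp M (filtration.pre_sigma (space M) F T)
             (\<lambda>\<omega>. indicator {\<omega>. T \<omega> < \<infinity>} \<omega> * f (X (enn2real (T \<omega>) + s) \<omega>)) \<omega>
           = indicator {\<omega>. T \<omega> < \<infinity>} \<omega> * (\<integral>y. f y \<partial>P s (X (enn2real (T \<omega>)) \<omega>))))"

text \<open>\<open>X\<close> is a diffusion with respect to the filtration \<open>F\<close>, with state space the interval \<open>S\<close> and
  generator \<open>a d\<^sup>2/dx\<^sup>2 + b d/dx\<close>: an adapted process with continuous paths in \<open>S\<close>, strong Markov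
  with a (Feller) transition semigroup whose generator acts on the functions in \<open>C\<^sub>c\<^sup>2(S)\<close> as this
  differential operator.\<close>

definition diffusion_with_generator ::
    "'a measure \<Rightarrow> (ennreal \<Rightarrow> 'a measure) \<Rightarrow> real set \<Rightarrow> (real \<Rightarrow> 'a \<Rightarrow> real) \<Rightarrow>
     (real \<Rightarrow> real) \<Rightarrow> (real \<Rightarrow> real) \<Rightarrow> bool" where
  "diffusion_with_generator M F S X a b \<longleftrightarrow>
     is_interval S \<and>
     filtration (space M) F \<and> (\<forall>t. subalgebra M (F t)) \<and>
     (\<forall>t\<ge>0. X t \<in> borel_measurable (F (ennreal t))) \<and>
     (\<forall>\<omega>\<in>space M. (\<forall>t\<ge>0. X t \<omega> \<in> S) \<and> continuous_on {0..} (\<lambda>t. X t \<omega>)) \<and>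
     (\<exists>P. feller_semigroup S P \<and> strong_markov M F S P X \<and>
        (\<forall>f f' f''. Cc2 S f f' f'' \<longrightarrow>
           in_generator S P f (\<lambda>x. a x * f'' x + b x * f' x)))"

definition xi :: "(real \<Rightarrow> 'a \<Rightarrow> real) \<Rightarrow> real \<Rightarrow> real \<Rightarrow> 'a \<Rightarrow> real" where
  "xi B \<mu> t \<omega> =
     exp (- 2 * with_drift B \<mu> t \<omega>) * (LBINT s:{0..t}. exp (2 * with_drift B \<mu> s \<omega>))"

end

theory Submission
  imports Defs
begin

text \<open>
  Write \<open>W\<^sub>t = B\<^sub>t + \<mu> t\<close>. Splitting the integral at \<open>r\<close> gives
  \<open>\<xi>\<^sub>r\<^sub>+\<^sub>s = exp (- 2 W'\<^sub>s) \<xi>\<^sub>r + \<xi>'\<^sub>s\<close>, where \<open>W'\<close> and \<open>\<xi>'\<close> are built from the increments of \<open>B\<close> after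
  time \<open>r\<close>. Hence \<open>\<xi>\<close> is Markov, and its semigroup \<open>P\<^sub>t(x)\<close> is the law of the random affine map
  \<open>exp (- 2 W\<^sub>t) x + \<xi>\<^sub>t\<close>. All laws and independences are read off Riemann sums, i.e. functions of
  the increments of \<open>B\<close> over a regular grid. No stochastic integration is needed for the generator:
  for small \<open>t\<close>, Taylor's formula applied to the affine map, together with the exact moments of
  \<open>exp (- 2 W\<^sub>t)\<close> and \<open>\<xi>\<^sub>t / t \<longlonglongrightarrow> 1\<close> in \<open>L\<^sup>2\<close>, gives the limit uniformly in \<open>x\<close>. The strong Markov
  property follows by approximating a stopping time from above by discrete times, using the Feller
  property. The identities in law express that \<open>u \<mapsto> B\<^sub>t - B\<^sub>t\<^sub>-\<^sub>u\<close> and \<open>- B\<close> are again Brownian motions.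
\<close>

section \<open>Riemann sums and equality of laws\<close>

text \<open>The kernel must start from every point of the half-line, whereas \<xi> itself starts at
  0: the affine map realises all starting points on one probability space, and over a time interval
  it is determined by two real random variables, slope and intercept, whose independence of the past
  is what the Markov property rests on. The map sends the half-line into itself, so Taylor's formula
  is used with one-sided derivatives at 0 and no boundary condition arises there. The coefficients
  come from Z = exp (- 2 W_t) and \<zeta> = \<xi>_t / t: x f'(x) is multiplied by E[Z - 1] / t,
  which tends to 2 - 2 \<mu>; x^2 f''(x) / 2 by E[(Z - 1)^2] / t, which tends to 4; and f'(x) by
  \<zeta>, which is close to 1. The obstacle is uniformity on an unbounded set where the noise is
  proportional to x. If f vanishes beyond k, a starting point beyond 2 k can matter only when Z <= 1
  / 2; then (Z - 1)^4 >= 1 / 16, and the fourth moment of Z - 1 is o(t).\<close>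

lemma integral_grid_sum_bound:
  fixes g :: "real \<Rightarrow> real"
  assumes "continuous_on {0..t} g" "0 \<le> h" "real n * h \<le> t"
    and "\<And>i s. i < n \<Longrightarrow> real i * h \<le> s \<Longrightarrow> s \<le> real (Suc i) * h \<Longrightarrow> \<bar>g s - g (real i * h)\<bar> \<le> e"
  shows "\<bar>integral {0..real n * h} g - (\<Sum>i<n. g (real i * h)) * h\<bar> \<le> real n * h * e"
  using assms(3,4)
\<comment> \<open>The right end \<open>n * h\<close> may be any point up to \<open>t\<close>, so the
  induction on the number of cells stays inside the interval of continuity.\<close>
proof (induction n)
  case 0
  then show ?case by simp
next
  case (Suc n)
  have le: "real n * h \<le> real (Suc n) * h" and nh: "real n * h \<le> t"
    using Suc.prems(1) assms(2) by (auto simp: algebra_simps)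
  have int: "g integrable_on {0..real (Suc n) * h}"
    by (rule integrable_continuous_interval, rule continuous_on_subset[OF assms(1)])
      (use Suc.prems(1) in auto)
  have "integral {0..real n * h} g + integral {real n * h..real (Suc n) * h} g
      = integral {0..real (Suc n) * h} g"
    by (rule Henstock_Kurzweil_Integration.integral_combine) (use le assms(2) int in auto)
  moreover have "\<bar>integral {real n * h..real (Suc n) * h} g - g (real n * h) * h\<bar> \<le> h * e"
  proof -
    have i1: "g integrable_on {real n * h..real (Suc n) * h}"
      by (rule integrable_subinterval_real[OF int]) (use assms(2) in auto)
    have "integral {real n * h..real (Suc n) * h} (\<lambda>s. g s - g (real n * h))
        = integral {real n * h..real (Suc n) * h} g - g (real n * h) * h"
      using i1 le by (subst Henstock_Kurzweil_Integration.integral_diff) (auto simp: algebra_simps)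
    moreover have "norm (integral (cbox (real n * h) (real (Suc n) * h)) (\<lambda>s. g s - g (real n * h)))
        \<le> e * measure lborel (cbox (real n * h) (real (Suc n) * h))"
    proof (rule Henstock_Kurzweil_Integration.integrable_bound)
      show "0 \<le> e" using Suc.prems(2)[of n "real n * h"] le by auto
      show "(\<lambda>s. g s - g (real n * h)) integrable_on cbox (real n * h) (real (Suc n) * h)"
        using i1 by (auto intro!: integrable_diff)
    qed (use Suc.prems(2)[of n] in auto)
    ultimately show ?thesis using le by (auto simp: algebra_simps)
  qed
  moreover have "\<bar>integral {0..real n * h} g - (\<Sum>i<n. g (real i * h)) * h\<bar> \<le> real n * h * e"
    using Suc.IH nh Suc.prems(2) by simp
  ultimately show ?case by (simp add: algebra_simps abs_le_iff)
qed

lemma riemann_sums_tendsto: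
  fixes g :: "real \<Rightarrow> real"
  assumes g: "continuous_on {0..t} g" and t: "0 \<le> t"
  shows "(\<lambda>n. (\<Sum>i<n. g (real i * t / real n)) * (t / real n)) \<longlonglongrightarrow> integral {0..t} g"
proof (cases "t = 0")
  case False
  with t have t0: "t > 0" by simp
  have "uniformly_continuous_on {0..t} g"
    using g by (intro compact_uniformly_continuous) auto
  show ?thesis
  proof (rule LIMSEQ_I)
    fix r :: real assume r: "0 < r"
    \<comment> \<open>An oscillation of at most \<open>r / (2 * t)\<close> on every cell adds up to
      at most \<open>r / 2\<close> over an interval of length \<open>t\<close>.\<close>
    obtain d where d: "d > 0"
      and du: "\<And>x y. x \<in> {0..t} \<Longrightarrow> y \<in> {0..t} \<Longrightarrow> dist y x < d \<Longrightarrow> dist (g y) (g x) < r / (2 * t)"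
      using \<open>uniformly_continuous_on {0..t} g\<close> r t0
      unfolding uniformly_continuous_on_def by (metis divide_pos_pos mult_pos_pos zero_less_numeral)
    obtain N :: nat where N: "t / d < real N" using reals_Archimedean2 by blast
    have "norm ((\<Sum>i<n. g (real i * t / real n)) * (t / real n) - integral {0..t} g) < r"
      if n: "n \<ge> Suc N" for n
    proof -
      have n0: "real n > 0" and nd: "t / real n < d"
      proof -
        show "real n > 0" using n by simp
        have "t / d < real n" using N n by linarith
        then show "t / real n < d" using d \<open>real n > 0\<close> by (simp add: field_simps)
      qed
      have "\<bar>integral {0..real n * (t / n)} g - (\<Sum>i<n. g (real i * (t / n))) * (t / n)\<bar>
          \<le> real n * (t / n) * (r / (2 * t))"
      proof (rule integral_grid_sum_bound[OF g])
        fix i s assume i: "i < n" "real i * (t / real n) \<le> s" "s \<le> real (Suc i) * (t / real n)"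
        have "real (Suc i) * (t / real n) \<le> real n * (t / real n)"
          using i t0 by (intro mult_right_mono) auto
        then have "real (Suc i) * (t / real n) \<le> t" using n0 by simp
        moreover have "0 \<le> real i * (t / real n)" using t0 by simp
        moreover have "s - real i * (t / real n) < d"
          using i(3) nd by (simp add: algebra_simps add_divide_distrib)
        ultimately show "\<bar>g s - g (real i * (t / real n))\<bar> \<le> r / (2 * t)"
          using i du[of "real i * (t / real n)" s] by (auto simp: dist_real_def)
      qed (use t0 n0 in auto)
      moreover have "real n * (t / n) * (r / (2 * t)) < r" "real n * (t / n) = t"
        using n0 t0 r by simp_all
      ultimately show ?thesis by (simp add: abs_minus_commute mult.commute)
    qed
    then show "\<exists>no. \<forall>n\<ge>no. norm ((\<Sum>i<n. g (real i * t / real n)) * (t / real n) - integral {0..t} g) < r"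
      by blast
  qed
qed simp

text \<open>The indicator of an open ray is a pointwise limit of continuous functions with values in
  [0, 1], and rays determine a finite measure. This leads back from limit arguments, which only see
  continuous test functions, to Borel sets.\<close>

lemma measure_eqI_continuous:
  fixes M N :: "real measure"
  assumes sets: "sets M = sets borel" "sets N = sets borel"
    and fin: "finite_measure M" "finite_measure N"
    and eq: "\<And>\<phi>. continuous_on UNIV \<phi> \<Longrightarrow> (\<And>x. 0 \<le> \<phi> x \<and> \<phi> x \<le> 1) \<Longrightarrow>
        (\<integral>\<^sup>+x. ennreal (\<phi> x) \<partial>M) = (\<integral>\<^sup>+x. ennreal (\<phi> x) \<partial>N)"
  shows "M = N"
proof (rule measure_eqI_lessThan[OF sets])
  interpret M: finite_measure M by fact
  interpret N: finite_measure N by fact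
  show "emeasure M {x<..} < \<infinity>" for x
    by (simp add: less_top[symmetric])
  fix a :: real
  \<comment> \<open>Ramps of slope \<open>n\<close> starting at \<open>a\<close> and capped at 1.
    They vanish at \<open>a\<close> itself, so the limit is the indicator of the open ray.\<close>
  define \<phi> where "\<phi> n x = min 1 (max 0 (real n * (x - a)))" for n :: nat and x
  have cont: "continuous_on UNIV (\<phi> n)" for n
    unfolding \<phi>_def by (intro continuous_intros)
  have lim: "(\<lambda>n. ennreal (\<phi> n x)) \<longlonglongrightarrow> indicator {a<..} x" for x
  proof (cases "x > a")
    case True
    obtain m :: nat where m: "1 / (x - a) < real m" using reals_Archimedean2 by blast
    have "\<phi> n x = 1" if "n \<ge> m" for n
    proof -
      have "1 / (x - a) < real n" using m that by linarith
      then have "1 < real n * (x - a)" using True by (simp add: field_simps)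
      then show ?thesis unfolding \<phi>_def by simp
    qed
    then have "\<forall>\<^sub>F n in sequentially. ennreal (\<phi> n x) = indicator {a<..} x"
      using True by (auto simp: eventually_sequentially)
    then show ?thesis by (rule tendsto_eventually)
  next
    case False
    then have "real n * (x - a) \<le> 0" for n
      by (simp add: mult_nonneg_nonpos)
    then have "\<phi> n x = 0" for n
      unfolding \<phi>_def by simp
    then show ?thesis using False by simp
  qed
  have conv: "(\<lambda>n. \<integral>\<^sup>+x. ennreal (\<phi> n x) \<partial>K) \<longlonglongrightarrow> emeasure K {a<..}"
    if K: "sets K = sets borel" "finite_measure K" for K :: "real measure"
  proof -
    interpret K: finite_measure K by fact
    note K(1)[measurable_cong]
    have [measurable]: "\<phi> n \<in> borel_measurable borel" for n
      using cont borel_measurable_continuous_onI by blast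
    have "(\<lambda>n. \<integral>\<^sup>+x. ennreal (\<phi> n x) \<partial>K) \<longlonglongrightarrow> (\<integral>\<^sup>+x. indicator {a<..} x \<partial>K)"
    proof (rule nn_integral_dominated_convergence[where w="\<lambda>_. 1"])
      show "(\<integral>\<^sup>+x. 1 \<partial>K) < \<infinity>" by (simp add: less_top[symmetric])
      show "AE x in K. ennreal (\<phi> j x) \<le> 1" for j
        by (auto simp: \<phi>_def)
    qed (use lim in auto)
    then show ?thesis using K(1) by simp
  qed
  have "(\<integral>\<^sup>+x. ennreal (\<phi> n x) \<partial>M) = (\<integral>\<^sup>+x. ennreal (\<phi> n x) \<partial>N)" for n
    by (rule eq[OF cont]) (auto simp: \<phi>_def)
  then show "emeasure M {a<..} = emeasure N {a<..}"
    using conv[OF sets(1) fin(1)] conv[OF sets(2) fin(2)] LIMSEQ_unique by simp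
qed

text \<open>Expectations of bounded continuous functions pass to pointwise limits, so equality of
  laws does too. It transfers identities between discretized functionals to the integrals that they
  approximate.\<close>

lemma distr_eq_of_limits:
  fixes X X' :: "'a \<Rightarrow> real"
  assumes "prob_space M"
    and [measurable]: "\<And>n. Xn n \<in> borel_measurable M" "\<And>n. Xn' n \<in> borel_measurable M"
    and lim: "\<And>\<omega>. \<omega> \<in> space M \<Longrightarrow> (\<lambda>n. Xn n \<omega>) \<longlonglongrightarrow> X \<omega>"
      "\<And>\<omega>. \<omega> \<in> space M \<Longrightarrow> (\<lambda>n. Xn' n \<omega>) \<longlonglongrightarrow> X' \<omega>"
    and eq: "\<And>n::nat. distr M borel (Xn n) = distr M borel (Xn' n)"
  shows "distr M borel X = distr M borel X'"
proof -
  interpret prob_space M by fact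
  have [measurable]: "X \<in> borel_measurable M" "X' \<in> borel_measurable M"
    using borel_measurable_LIMSEQ_metric[of Xn M X] borel_measurable_LIMSEQ_metric[of Xn' M X'] lim
    by auto
  show ?thesis
  proof (rule measure_eqI_continuous)
    show "finite_measure (distr M borel X)" "finite_measure (distr M borel X')"
      by (auto intro!: prob_space.finite_measure prob_space_distr)
    fix \<phi> :: "real \<Rightarrow> real" assume \<phi>: "continuous_on UNIV \<phi>" "\<And>x. 0 \<le> \<phi> x \<and> \<phi> x \<le> 1"
    have [measurable]: "\<phi> \<in> borel_measurable borel"
      using \<phi>(1) by (rule borel_measurable_continuous_onI)
    have conv: "(\<lambda>n. \<integral>\<^sup>+x. ennreal (\<phi> x) \<partial>distr M borel (Y n)) \<longlonglongrightarrow> (\<integral>\<^sup>+x. ennreal (\<phi> x) \<partial>distr M borel Z)"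
      if [measurable]: "\<And>n. Y n \<in> borel_measurable M" "Z \<in> borel_measurable M"
        and l: "\<And>\<omega>. \<omega> \<in> space M \<Longrightarrow> (\<lambda>n. Y n \<omega>) \<longlonglongrightarrow> Z \<omega>" for Y Z
    proof -
      have "(\<lambda>n. \<integral>\<^sup>+\<omega>. ennreal (\<phi> (Y n \<omega>)) \<partial>M) \<longlonglongrightarrow> (\<integral>\<^sup>+\<omega>. ennreal (\<phi> (Z \<omega>)) \<partial>M)"
      proof (rule nn_integral_dominated_convergence[where w="\<lambda>_. 1"])
        show "AE x in M. (\<lambda>i. ennreal (\<phi> (Y i x))) \<longlonglongrightarrow> ennreal (\<phi> (Z x))"
          using l \<phi>(1) by (intro AE_I2 tendsto_ennrealI) (auto intro: continuous_on_tendsto_compose)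
        show "AE x in M. ennreal (\<phi> (Y j x)) \<le> 1" for j
          using \<phi>(2) by (auto intro!: AE_I2)
      qed (auto simp: emeasure_space_1)
      then show ?thesis by (simp add: nn_integral_distr)
    qed
    show "(\<integral>\<^sup>+x. ennreal (\<phi> x) \<partial>distr M borel X) = (\<integral>\<^sup>+x. ennreal (\<phi> x) \<partial>distr M borel X')"
      using conv[of Xn X] conv[of Xn' X'] lim eq LIMSEQ_unique by simp
  qed auto
qed

text \<open>By continuity the random index can be rounded down to a multiple of
  \<open>1 / Suc n\<close>, which leaves countably many indices. The sigma-algebra \<open>N\<close>
  is arbitrary, so the lemma also serves inside the filtration.\<close>

lemma borel_measurable_process_at_random_time:
  fixes X :: "real \<Rightarrow> 'a \<Rightarrow> real" and \<tau> :: "'a \<Rightarrow> real"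
  assumes [measurable]: "\<tau> \<in> borel_measurable N" "\<And>s. 0 \<le> s \<Longrightarrow> X s \<in> borel_measurable N"
    and \<tau>: "\<And>\<omega>. \<omega> \<in> space N \<Longrightarrow> 0 \<le> \<tau> \<omega>"
    and cont: "\<And>\<omega>. \<omega> \<in> space N \<Longrightarrow> continuous_on {0..} (\<lambda>s. X s \<omega>)"
  shows "(\<lambda>\<omega>. X (\<tau> \<omega>) \<omega>) \<in> borel_measurable N"
proof (rule borel_measurable_LIMSEQ_metric)
  fix n :: nat
  \<comment> \<open>The countable family is indexed by all integers. The absolute value keeps each
    member at a time where \<open>X\<close> is known to be measurable, and changes nothing when the
    floor is nonnegative.\<close>
  have "(\<lambda>\<omega>. X (\<bar>real_of_int \<lfloor>real (Suc n) * \<tau> \<omega>\<rfloor>\<bar> / real (Suc n)) \<omega>) \<in> borel_measurable N"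
    by (rule measurable_compose_countable[where g="\<lambda>\<omega>. \<lfloor>real (Suc n) * \<tau> \<omega>\<rfloor>"
          and f="\<lambda>i \<omega>. X (\<bar>real_of_int i\<bar> / real (Suc n)) \<omega>"]) auto
  then show "(\<lambda>\<omega>. X (\<bar>real_of_int \<lfloor>real (Suc n) * \<tau> \<omega>\<rfloor>\<bar> / real (Suc n)) \<omega>) \<in> borel_measurable N" .
next
  fix \<omega> assume \<omega>: "\<omega> \<in> space N"
  have "(\<lambda>n. \<bar>real_of_int \<lfloor>real (Suc n) * \<tau> \<omega>\<rfloor>\<bar> / real (Suc n)) \<longlonglongrightarrow> \<tau> \<omega>"
  proof (rule tendsto_sandwich[of "\<lambda>n. \<tau> \<omega> - 1 / real (Suc n)" _ _ "\<lambda>n. \<tau> \<omega>"])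
    show "(\<lambda>n. \<tau> \<omega> - 1 / real (Suc n)) \<longlonglongrightarrow> \<tau> \<omega>"
      using tendsto_diff[OF tendsto_const LIMSEQ_inverse_real_of_nat] by (simp add: inverse_eq_divide)
    have "\<tau> \<omega> - 1 / real (Suc n) \<le> \<bar>real_of_int \<lfloor>real (Suc n) * \<tau> \<omega>\<rfloor>\<bar> / real (Suc n)
        \<and> \<bar>real_of_int \<lfloor>real (Suc n) * \<tau> \<omega>\<rfloor>\<bar> / real (Suc n) \<le> \<tau> \<omega>" for n
    proof -
      have 0: "0 \<le> real (Suc n) * \<tau> \<omega>" using \<tau>[OF \<omega>] by simp
      then have "\<bar>real_of_int \<lfloor>real (Suc n) * \<tau> \<omega>\<rfloor>\<bar> = real_of_int \<lfloor>real (Suc n) * \<tau> \<omega>\<rfloor>" by simp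
      moreover have "real (Suc n) * (\<tau> \<omega> - 1 / real (Suc n)) = real (Suc n) * \<tau> \<omega> - 1"
        by (simp add: field_simps)
      moreover have "real_of_int \<lfloor>real (Suc n) * \<tau> \<omega>\<rfloor> \<le> real (Suc n) * \<tau> \<omega>"
        "real (Suc n) * \<tau> \<omega> - 1 \<le> real_of_int \<lfloor>real (Suc n) * \<tau> \<omega>\<rfloor>"
        by linarith+
      ultimately show ?thesis
        by (simp del: of_nat_Suc add: pos_le_divide_eq pos_divide_le_eq mult.commute)
    qed
    then show "\<forall>\<^sub>F n in sequentially. \<tau> \<omega> - 1 / real (Suc n) \<le> \<bar>real_of_int \<lfloor>real (Suc n) * \<tau> \<omega>\<rfloor>\<bar> / real (Suc n)"
      "\<forall>\<^sub>F n in sequentially. \<bar>real_of_int \<lfloor>real (Suc n) * \<tau> \<omega>\<rfloor>\<bar> / real (Suc n) \<le> \<tau> \<omega>"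
      by auto
  qed auto
  then show "(\<lambda>n. X (\<bar>real_of_int \<lfloor>real (Suc n) * \<tau> \<omega>\<rfloor>\<bar> / real (Suc n)) \<omega>) \<longlonglongrightarrow> X (\<tau> \<omega>) \<omega>"
    using \<tau>[OF \<omega>] by (intro continuous_on_tendsto_compose[OF cont[OF \<omega>]]) auto
qed

section \<open>Brownian increments over a grid\<close>

abbreviation gauss :: "real \<Rightarrow> real measure" where
  "gauss v \<equiv> density lborel (\<lambda>x. ennreal (normal_density 0 (sqrt v) x))"

abbreviation borel_grid :: "nat \<Rightarrow> (nat \<Rightarrow> real) measure" where
  "borel_grid n \<equiv> PiM {..<n} (\<lambda>_. borel)"

text \<open>The restriction to \<open>{..<n}\<close> makes the vector a point of the product space
  \<open>borel_grid n\<close>.\<close>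

definition grid_increments :: "(real \<Rightarrow> 'a \<Rightarrow> real) \<Rightarrow> real \<Rightarrow> nat \<Rightarrow> 'a \<Rightarrow> nat \<Rightarrow> real" where
  "grid_increments Y t n \<omega> =
     (\<lambda>i\<in>{..<n}. Y (real (Suc i) * t / real n) \<omega> - Y (real i * t / real n) \<omega>)"

text \<open>Brownian motion on the interval up to \<open>t\<close>, as far as laws of path
  functionals need it: only increments over regular grids are described. It is the common interface
  of \<open>B\<close>, of its shifts and of the reversed path, which is meaningful only up to time
  \<open>t\<close>.\<close>

definition wiener_on :: "'a measure \<Rightarrow> (real \<Rightarrow> 'a \<Rightarrow> real) \<Rightarrow> real \<Rightarrow> bool" where
  "wiener_on M Y t \<longleftrightarrow>
     (\<forall>\<omega>\<in>space M. Y 0 \<omega> = 0 \<and> continuous_on {0..t} (\<lambda>s. Y s \<omega>)) \<and>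
     (\<forall>s\<in>{0..t}. Y s \<in> borel_measurable M) \<and>
     (\<forall>n>0. distr M (borel_grid n) (grid_increments Y t n)
        = PiM {..<n} (\<lambda>_. gauss (t / real n)))"

definition shifted :: "(real \<Rightarrow> 'a \<Rightarrow> real) \<Rightarrow> real \<Rightarrow> real \<Rightarrow> 'a \<Rightarrow> real" where
  "shifted B r u \<omega> = B (r + u) \<omega> - B r \<omega>"

definition time_reversal :: "(real \<Rightarrow> 'a \<Rightarrow> real) \<Rightarrow> real \<Rightarrow> real \<Rightarrow> 'a \<Rightarrow> real" where
  "time_reversal B t u \<omega> = B t \<omega> - B (t - u) \<omega>"

text \<open>This is the explicit solution, started at \<open>x\<close>, of the linear equation dX =
  - 2 X dB + ((2 - 2 \<mu>) X + 1) dt.\<close>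

definition flow :: "(real \<Rightarrow> 'a \<Rightarrow> real) \<Rightarrow> real \<Rightarrow> real \<Rightarrow> real \<Rightarrow> 'a \<Rightarrow> real" where
  "flow B \<mu> t x \<omega> = exp (- 2 * with_drift B \<mu> t \<omega>) * x + xi B \<mu> t \<omega>"

lemma brownian_motionD:
  assumes "brownian_motion M B"
  shows "prob_space M" "\<And>t. 0 \<le> t \<Longrightarrow> B t \<in> borel_measurable M"
    "\<And>\<omega>. \<omega> \<in> space M \<Longrightarrow> B 0 \<omega> = 0"
    "\<And>\<omega>. \<omega> \<in> space M \<Longrightarrow> continuous_on {0..} (\<lambda>t. B t \<omega>)"
    "\<And>s t. 0 \<le> s \<Longrightarrow> s < t \<Longrightarrow>
       distributed M lborel (\<lambda>\<omega>. B t \<omega> - B s \<omega>) (normal_density 0 (sqrt (t - s)))"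
    "\<And>(n::nat) ts. 0 \<le> ts 0 \<Longrightarrow> (\<And>i. i < n \<Longrightarrow> ts i < ts (Suc i)) \<Longrightarrow>
       prob_space.indep_vars M (\<lambda>_. borel) (\<lambda>i \<omega>. B (ts (Suc i)) \<omega> - B (ts i) \<omega>) {..<n}"
  using assms unfolding brownian_motion_def by auto

lemma brownian_motion_uminus:
  assumes "brownian_motion M B"
  shows "brownian_motion M (\<lambda>t \<omega>. - B t \<omega>)"
proof -
  note B = brownian_motionD[OF assms]
  interpret prob_space M by (rule B(1))
  show ?thesis
    unfolding brownian_motion_def
  proof (intro conjI allI impI ballI)
    fix s t :: real assume st: "0 \<le> s" "s < t"
    have "distributed M lborel (\<lambda>\<omega>. 0 + - 1 * (B t \<omega> - B s \<omega>))
        (normal_density (0 + - 1 * 0) (\<bar>- 1\<bar> * sqrt (t - s)))"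
      using st by (intro normal_density_affine B(5)) auto
    then show "distributed M lborel (\<lambda>\<omega>. - B t \<omega> - - B s \<omega>) (normal_density 0 (sqrt (t - s)))"
      by (simp add: algebra_simps)
  next
    fix n :: nat and ts :: "nat \<Rightarrow> real"
    assume "0 \<le> ts 0" "\<forall>i<n. ts i < ts (Suc i)"
    then have "indep_vars (\<lambda>_. borel) (\<lambda>i \<omega>. - (B (ts (Suc i)) \<omega> - B (ts i) \<omega>)) {..<n}"
      by (intro indep_vars_compose2[OF B(6)]) auto
    then show "indep_vars (\<lambda>_. borel) (\<lambda>i \<omega>. - B (ts (Suc i)) \<omega> - - B (ts i) \<omega>) {..<n}"
      by (simp add: algebra_simps)
  qed (use B in \<open>auto intro!: continuous_intros\<close>)
qed

lemma distr_grid_increments_shift: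
  assumes "brownian_motion M B" "0 \<le> r" "0 < t" "0 < n"
  shows "distr M (borel_grid n) (grid_increments (shifted B r) t n)
    = PiM {..<n} (\<lambda>_. gauss (t / real n))"
proof -
  note B = brownian_motionD[OF assms(1)]
  interpret prob_space M by (rule B(1))
  define X where "X i \<omega> = B (r + real (Suc i) * t / real n) \<omega> - B (r + real i * t / real n) \<omega>" for i \<omega>
  have lt: "r + real i * t / real n < r + real (Suc i) * t / real n" for i
    using assms by (simp add: field_simps)
  have le: "0 \<le> r + real i * t / real n" for i
    using assms by simp
  have ind: "indep_vars (\<lambda>_. borel) X {..<n}"
    unfolding X_def using assms lt
    by (intro B(6)[where ts="\<lambda>i. r + real i * t / real n"]) auto
  have rv: "X i \<in> borel_measurable M" for i
    unfolding X_def using le by (intro borel_measurable_diff B(2))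
  have "distr M (borel_grid n) (\<lambda>\<omega>. \<lambda>i\<in>{..<n}. X i \<omega>) = PiM {..<n} (\<lambda>i. distr M borel (X i))"
    using indep_vars_iff_distr_eq_PiM[where I="{..<n}" and X=X and M'="\<lambda>_. borel"] ind rv assms(4)
    by auto
  also have "\<dots> = PiM {..<n} (\<lambda>_. gauss (t / real n))"
  proof (intro PiM_cong refl)
    fix i
    have "distributed M lborel (X i)
        (normal_density 0 (sqrt ((r + real (Suc i) * t / real n) - (r + real i * t / real n))))"
      unfolding X_def using lt le by (intro B(5))
    also have "(r + real (Suc i) * t / real n) - (r + real i * t / real n) = t / real n"
      by (simp add: algebra_simps add_divide_distrib)
    finally show "distr M borel (X i) = gauss (t / real n)"
      using distributed_distr_eq_density distr_cong[of M M borel lborel "X i" "X i"] by simp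
  qed
  also have "(\<lambda>\<omega>. \<lambda>i\<in>{..<n}. X i \<omega>) = grid_increments (shifted B r) t n"
    by (auto simp: fun_eq_iff grid_increments_def shifted_def X_def)
  finally show ?thesis .
qed

lemma wiener_on_shift:
  assumes "brownian_motion M B" "0 \<le> r" "0 < t"
  shows "wiener_on M (shifted B r) t"
  unfolding wiener_on_def
proof (intro conjI ballI allI impI)
  note B = brownian_motionD[OF assms(1)]
  show "shifted B r 0 \<omega> = 0" for \<omega> by (simp add: shifted_def)
  show "continuous_on {0..t} (\<lambda>s. shifted B r s \<omega>)" if "\<omega> \<in> space M" for \<omega>
    unfolding shifted_def
    by (intro continuous_intros continuous_on_compose2[OF B(4)[OF that]]) (use assms in auto)
  show "shifted B r s \<in> borel_measurable M" if "s \<in> {0..t}" for s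
    unfolding shifted_def using that assms by (auto intro!: borel_measurable_diff B(2))
qed (use distr_grid_increments_shift[OF assms] in auto)

lemma wiener_on_brownian_motion:
  assumes "brownian_motion M B" "0 < t"
  shows "wiener_on M B t"
proof -
  note B = brownian_motionD[OF assms(1)]
  have w: "wiener_on M (shifted B 0) t"
    using assms by (intro wiener_on_shift) auto
  have eq: "shifted B 0 s \<omega> = B s \<omega>" if "\<omega> \<in> space M" for s \<omega>
    using B(3)[OF that] by (simp add: shifted_def)
  have "distr M N (grid_increments (shifted B 0) t n) = distr M N (grid_increments B t n)" for n N
    by (intro distr_cong) (auto simp: grid_increments_def eq cong: restrict_cong)
  with w show ?thesis
    unfolding wiener_on_def using B
    by (auto intro: continuous_on_subset[of "{0..}"])
qed

text \<open>The increments of the reversed path over a regular grid are those of \<open>B\<close> in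
  the opposite order. On a regular grid they are independent with identical laws, and such a product
  law is invariant under permutations.\<close>

lemma wiener_on_time_reversal:
  assumes "brownian_motion M B" "0 < t"
  shows "wiener_on M (time_reversal B t) t"
  unfolding wiener_on_def
proof (intro conjI ballI allI impI)
  note B = brownian_motionD[OF assms(1)]
  show "time_reversal B t 0 \<omega> = 0" for \<omega> by (simp add: time_reversal_def)
  show "continuous_on {0..t} (\<lambda>s. time_reversal B t s \<omega>)" if "\<omega> \<in> space M" for \<omega>
    unfolding time_reversal_def
    by (intro continuous_intros continuous_on_compose2[OF B(4)[OF that]]) (use assms in auto)
  show "time_reversal B t s \<in> borel_measurable M" if "s \<in> {0..t}" for s
    unfolding time_reversal_def using that assms by (auto intro!: borel_measurable_diff B(2))
  fix n :: nat assume n: "0 < n"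
  let ?P = "PiM {..<n} (\<lambda>_. borel :: real measure)"
  let ?G = "PiM {..<n} (\<lambda>_. gauss (t / real n))"
  have w: "distr M ?P (grid_increments B t n) = ?G" and m: "grid_increments B t n \<in> measurable M ?P"
  proof -
    show "distr M ?P (grid_increments B t n) = ?G"
      using wiener_on_brownian_motion[OF assms] n unfolding wiener_on_def by auto
    show "grid_increments B t n \<in> measurable M ?P"
      unfolding grid_increments_def using assms
      by (intro measurable_restrict borel_measurable_diff B(2)) auto
  qed
  have sP: "sets ?G = sets ?P"
    by (intro sets_PiM_cong) auto
  have pg: "prob_space (gauss (t / real n))"
    using assms n by (intro prob_space_normal_density) auto
  let ?\<rho> = "\<lambda>d. \<lambda>i\<in>{..<n}. d (n - Suc i) :: real"
  have "?G = distr ?G ?G ?\<rho>"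
    using distr_PiM_reindex[of "{..<n}" "\<lambda>_. gauss (t / real n)" "\<lambda>i. n - Suc i" "{..<n}"] pg n
    by (fastforce simp: inj_on_def)
  also have "\<dots> = distr (distr M ?P (grid_increments B t n)) ?P ?\<rho>"
    unfolding w by (intro distr_cong) (auto simp: sP)
  also have "\<dots> = distr M ?P (?\<rho> \<circ> grid_increments B t n)"
  proof (intro distr_distr m measurable_restrict)
    show "(\<lambda>d. d (n - Suc i)) \<in> measurable ?P borel" if "i \<in> {..<n}" for i
      using n by (intro measurable_component_singleton) auto
  qed
  \<comment> \<open>Cell \<open>i\<close> of the reversed path is cell \<open>n - Suc i\<close> of
    \<open>B\<close>; reversing time and subtracting from \<open>B t\<close> leave the sign of the
    increment unchanged.\<close>
  also have "?\<rho> \<circ> grid_increments B t n = grid_increments (time_reversal B t) t n"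
  proof -
    have "t - real (Suc i) * t / real n = real (n - Suc i) * t / real n"
      "t - real i * t / real n = real (Suc (n - Suc i)) * t / real n" if "i < n" for i
      using that n by (auto simp: field_simps of_nat_diff)
    then show ?thesis
      using n by (auto simp: fun_eq_iff grid_increments_def time_reversal_def)
  qed
  finally show "distr M ?P (grid_increments (time_reversal B t) t n) = ?G" by simp
qed

section \<open>Riemann-sum approximation of the flow and its law\<close>

lemma continuous_on_with_drift:
  "continuous_on S (\<lambda>s. B s \<omega>) \<Longrightarrow> continuous_on S (\<lambda>s. with_drift B \<mu> s \<omega>)"
  unfolding with_drift_def by (intro continuous_intros)

lemma set_lebesgue_integral_eq_integral:
  fixes g :: "real \<Rightarrow> real"
  assumes "continuous_on {a..b} g"
  shows "(LBINT s:{a..b}. g s) = integral {a..b} g"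
  using assms by (intro set_borel_integral_eq_integral(2) borel_integrable_atLeastAtMost')

lemma xi_eq_integral:
  assumes "continuous_on {0..t} (\<lambda>s. B s \<omega>)"
  shows "xi B \<mu> t \<omega> =
    exp (- 2 * with_drift B \<mu> t \<omega>) * integral {0..t} (\<lambda>s. exp (2 * with_drift B \<mu> s \<omega>))"
  unfolding xi_def
  by (subst set_lebesgue_integral_eq_integral)
    (auto intro!: continuous_intros continuous_on_with_drift assms)

text \<open>This is \<open>flow\<close> with the integral replaced by a left Riemann sum and the
  path by partial sums of its increments. Being a function of the increment vector alone, its law is
  fixed by \<open>wiener_on\<close>.\<close>

definition grid_flow :: "real \<Rightarrow> real \<Rightarrow> real \<Rightarrow> nat \<Rightarrow> (nat \<Rightarrow> real) \<Rightarrow> real" where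
  "grid_flow \<mu> t x n d =
     exp (- 2 * ((\<Sum>i<n. d i) + \<mu> * t)) *
       (x + (\<Sum>k<n. exp (2 * ((\<Sum>i<k. d i) + \<mu> * (real k * t / real n)))) * (t / real n))"

lemma sum_grid_increments:
  assumes "Y 0 \<omega> = 0" "k \<le> n"
  shows "(\<Sum>i<k. grid_increments Y t n \<omega> i) = Y (real k * t / real n) \<omega>"
proof -
  have "(\<Sum>i<k. grid_increments Y t n \<omega> i)
      = (\<Sum>i<k. Y (real (Suc i) * t / real n) \<omega> - Y (real i * t / real n) \<omega>)"
    using assms(2) by (intro sum.cong) (auto simp: grid_increments_def)
  also have "\<dots> = Y (real k * t / real n) \<omega>"
    using assms(1) by (subst sum_lessThan_telescope) simp
  finally show ?thesis .
qed

text \<open>The grid size is \<open>Suc n\<close> because an empty grid would not see the endpoint: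
  its sum of increments is 0 instead of \<open>Y t\<close>.\<close>

lemma grid_flow_tendsto:
  assumes "Y 0 \<omega> = 0" "continuous_on {0..t} (\<lambda>s. Y s \<omega>)" "0 \<le> t"
  shows "(\<lambda>n. grid_flow \<mu> t x (Suc n) (grid_increments Y t (Suc n) \<omega>)) \<longlonglongrightarrow> flow Y \<mu> t x \<omega>"
proof -
  let ?g = "\<lambda>s. exp (2 * with_drift Y \<mu> s \<omega>)"
  have "grid_flow \<mu> t x (Suc n) (grid_increments Y t (Suc n) \<omega>) =
      exp (- 2 * with_drift Y \<mu> t \<omega>) *
        (x + (\<Sum>i<Suc n. ?g (real i * t / real (Suc n))) * (t / real (Suc n)))" for n
    unfolding grid_flow_def with_drift_def
    by (simp add: sum_grid_increments[of Y \<omega>, OF assms(1)] del: sum.lessThan_Suc of_nat_Suc)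
  moreover have "(\<lambda>n. (\<Sum>i<Suc n. ?g (real i * t / real (Suc n))) * (t / real (Suc n)))
      \<longlonglongrightarrow> integral {0..t} ?g"
    by (rule LIMSEQ_Suc[OF riemann_sums_tendsto])
      (auto intro!: continuous_intros continuous_on_with_drift assms)
  ultimately show ?thesis
    unfolding flow_def xi_eq_integral[of t Y \<omega> \<mu>, OF assms(2)] distrib_left[symmetric]
    by (auto intro!: tendsto_intros simp del: sum.lessThan_Suc of_nat_Suc)
qed

lemma measurable_grid_flow:
  "grid_flow \<mu> t x n \<in> borel_measurable (borel_grid n)"
proof -
  have "(\<lambda>d. \<Sum>i<k. d i) \<in> borel_measurable (PiM {..<n} (\<lambda>_. borel :: real measure))" if "k \<le> n" for k
    using that by (intro borel_measurable_sum measurable_component_singleton) auto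
  then show ?thesis
    unfolding grid_flow_def
    by (intro borel_measurable_times borel_measurable_add borel_measurable_sum borel_measurable_const
        borel_measurable_exp[THEN measurable_compose[rotated]]) auto
qed

lemma measurable_grid_increments:
  assumes "\<And>s. 0 \<le> s \<Longrightarrow> s \<le> t \<Longrightarrow> Y s \<in> borel_measurable N" "0 \<le> t"
  shows "grid_increments Y t n \<in> measurable N (borel_grid n)"
proof -
  have "real k * t / real n \<le> t" if "k \<le> n" for k
    using that assms(2) by (cases "n = 0") (auto simp: pos_divide_le_eq mult.commute[of _ t] intro!: mult_left_mono)
  then show ?thesis
    unfolding grid_increments_def using assms
    by (intro measurable_restrict borel_measurable_diff assms(1)) (auto simp del: of_nat_Suc)
qed

text \<open>Both discretized flows are images of the same Gaussian product measure under the same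
  function. This one comparison yields the time homogeneity of the transitions, the reversal
  identity and the identity for the reflected path.\<close>

lemma distr_flow_eq:
  assumes M: "prob_space M" and t: "0 \<le> t" and Y: "wiener_on M Y t" and Y': "wiener_on M Y' t"
  shows "distr M borel (flow Y \<mu> t x) = distr M borel (flow Y' \<mu> t x)"
proof (rule distr_eq_of_limits[OF M])
  have m: "grid_increments Z t n \<in> measurable M (borel_grid n)" if "wiener_on M Z t" for Z n
    using that t by (intro measurable_grid_increments) (auto simp: wiener_on_def)
  note mm = measurable_compose[OF m measurable_grid_flow]
  show "(\<lambda>\<omega>. grid_flow \<mu> t x (Suc n) (grid_increments Y t (Suc n) \<omega>)) \<in> borel_measurable M"
    "(\<lambda>\<omega>. grid_flow \<mu> t x (Suc n) (grid_increments Y' t (Suc n) \<omega>)) \<in> borel_measurable M" for n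
    using mm[OF Y] mm[OF Y'] by auto
  have d: "distr M borel (\<lambda>\<omega>. grid_flow \<mu> t x (Suc n) (grid_increments Z t (Suc n) \<omega>))
      = distr (PiM {..<Suc n} (\<lambda>_. gauss (t / real (Suc n)))) borel (grid_flow \<mu> t x (Suc n))"
    if Z: "wiener_on M Z t" for Z n
  proof -
    have "distr M (borel_grid (Suc n)) (grid_increments Z t (Suc n))
        = PiM {..<Suc n} (\<lambda>_. gauss (t / real (Suc n)))"
      using Z unfolding wiener_on_def by blast
    then show ?thesis
      using distr_distr[OF measurable_grid_flow[of \<mu> t x "Suc n"] m[OF Z, of "Suc n"]]
      by (simp add: comp_def)
  qed
  show "distr M borel (\<lambda>\<omega>. grid_flow \<mu> t x (Suc n) (grid_increments Y t (Suc n) \<omega>))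
      = distr M borel (\<lambda>\<omega>. grid_flow \<mu> t x (Suc n) (grid_increments Y' t (Suc n) \<omega>))" for n
    unfolding d[OF Y] d[OF Y'] ..
qed (use Y Y' t in \<open>auto intro!: grid_flow_tendsto simp: wiener_on_def\<close>)

section \<open>Independence of past and future\<close>

text \<open>Dyadic grids are nested, so two such events can be rewritten over a common grid. The
  family is therefore closed under intersection and can serve as a generating pi-system.\<close>

definition grid_sets :: "'a measure \<Rightarrow> (real \<Rightarrow> 'a \<Rightarrow> real) \<Rightarrow> real \<Rightarrow> 'a set set" where
  "grid_sets M Y t =
     (\<Union>n. {grid_increments Y t (2 ^ n) -` C \<inter> space M | C. C \<in> sets (borel_grid (2 ^ n))})"

definition coarsen :: "nat \<Rightarrow> (nat \<Rightarrow> real) \<Rightarrow> nat \<Rightarrow> real" where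
  "coarsen n d = (\<lambda>i\<in>{..<2 ^ n}. d (2 * i) + d (2 * i + 1))"

lemma coarsen_grid_increments:
  "coarsen n (grid_increments Y t (2 ^ Suc n) \<omega>) = grid_increments Y t (2 ^ n) \<omega>"
proof (rule ext)
  fix i
  define z where "z k = Y (real k * t / real (2 ^ Suc n)) \<omega>" for k
  have z: "z (2 * k) = Y (real k * t / real (2 ^ n)) \<omega>" for k
    by (simp add: z_def)
  have "grid_increments Y t (2 ^ Suc n) \<omega> = (\<lambda>i\<in>{..<2 ^ Suc n}. z (Suc i) - z i)"
    unfolding grid_increments_def z_def ..
  moreover have "grid_increments Y t (2 ^ n) \<omega> = (\<lambda>i\<in>{..<2 ^ n}. z (2 * Suc i) - z (2 * i))"
    unfolding grid_increments_def z ..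
  ultimately show "coarsen n (grid_increments Y t (2 ^ Suc n) \<omega>) i = grid_increments Y t (2 ^ n) \<omega> i"
    by (simp add: coarsen_def)
qed

lemma measurable_coarsen:
  "coarsen n \<in> measurable (borel_grid (2 ^ Suc n)) (borel_grid (2 ^ n))"
  unfolding coarsen_def
  by (intro measurable_restrict borel_measurable_add measurable_component_singleton) auto

text \<open>Passing to the next dyadic level only splits each increment into two, so a coarse event
  is the preimage under \<open>coarsen\<close> of a condition on the finer vector.\<close>

lemma grid_sets_lift:
  assumes "n \<le> m" "C \<in> sets (borel_grid (2 ^ n))"
  shows "\<exists>C'\<in>sets (borel_grid (2 ^ m)).
    grid_increments Y t (2 ^ n) -` C \<inter> space M = grid_increments Y t (2 ^ m) -` C' \<inter> space M"
  using assms(1)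
proof (induction m rule: dec_induct)
  case base
  then show ?case using assms(2) by blast
next
  case (step m)
  then obtain C' where C': "C' \<in> sets (borel_grid (2 ^ m))"
    "grid_increments Y t (2 ^ n) -` C \<inter> space M = grid_increments Y t (2 ^ m) -` C' \<inter> space M"
    by blast
  let ?C = "coarsen m -` C' \<inter> space (borel_grid (2 ^ Suc m))"
  have "?C \<in> sets (borel_grid (2 ^ Suc m))"
    using measurable_sets[OF measurable_coarsen C'(1)] .
  moreover have "grid_increments Y t (2 ^ m) -` C' \<inter> space M
      = grid_increments Y t (2 ^ Suc m) -` ?C \<inter> space M"
  proof (rule set_eqI)
    fix \<omega>
    have "grid_increments Y t (2 ^ Suc m) \<omega> \<in> space (borel_grid (2 ^ Suc m))"
      unfolding grid_increments_def by (simp only: space_PiM space_borel restrict_PiE_iff) simp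
    then show "\<omega> \<in> grid_increments Y t (2 ^ m) -` C' \<inter> space M
        \<longleftrightarrow> \<omega> \<in> grid_increments Y t (2 ^ Suc m) -` ?C \<inter> space M"
      by (simp only: vimage_eq Int_iff coarsen_grid_increments simp_thms)
  qed
  ultimately show ?case
    unfolding C'(2) by (rule bexI[rotated])
qed

lemma grid_setsI:
  "C \<in> sets (borel_grid (2 ^ n)) \<Longrightarrow> grid_increments Y t (2 ^ n) -` C \<inter> space M \<in> grid_sets M Y t"
  unfolding grid_sets_def by blast

lemma grid_sets_common_level:
  assumes "a \<in> grid_sets M Y t" "b \<in> grid_sets M' Y' t'"
  obtains n C D where
    "C \<in> sets (borel_grid (2 ^ n))" "a = grid_increments Y t (2 ^ n) -` C \<inter> space M"
    "D \<in> sets (borel_grid (2 ^ n))" "b = grid_increments Y' t' (2 ^ n) -` D \<inter> space M'"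
proof -
  obtain n C where C: "C \<in> sets (borel_grid (2 ^ n))"
    "a = grid_increments Y t (2 ^ n) -` C \<inter> space M"
    using assms(1) unfolding grid_sets_def by blast
  obtain m D where D: "D \<in> sets (borel_grid (2 ^ m))"
    "b = grid_increments Y' t' (2 ^ m) -` D \<inter> space M'"
    using assms(2) unfolding grid_sets_def by blast
  obtain C' D' where
    "C' \<in> sets (borel_grid (2 ^ max n m))" "a = grid_increments Y t (2 ^ max n m) -` C' \<inter> space M"
    "D' \<in> sets (borel_grid (2 ^ max n m))" "b = grid_increments Y' t' (2 ^ max n m) -` D' \<inter> space M'"
    using grid_sets_lift[OF max.cobounded1[of n m] C(1), of Y t M]
      grid_sets_lift[OF max.cobounded2[of m n] D(1), of Y' t' M']
    unfolding C(2)[symmetric] D(2)[symmetric] by (elim bexE)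
  then show ?thesis by (rule that)
qed

lemma Int_stable_grid_sets: "Int_stable (grid_sets M Y t)"
proof (rule Int_stableI)
  fix a b assume "a \<in> grid_sets M Y t" "b \<in> grid_sets M Y t"
  then obtain n C D where *:
    "C \<in> sets (borel_grid (2 ^ n))" "a = grid_increments Y t (2 ^ n) -` C \<inter> space M"
    "D \<in> sets (borel_grid (2 ^ n))" "b = grid_increments Y t (2 ^ n) -` D \<inter> space M"
    by (rule grid_sets_common_level)
  have "a \<inter> b = grid_increments Y t (2 ^ n) -` (C \<inter> D) \<inter> space M"
    unfolding * by (simp add: Int_assoc Int_left_commute)
  then show "a \<inter> b \<in> grid_sets M Y t"
    using grid_setsI[OF sets.Int[OF *(1,3)], of Y t M] by simp
qed

lemma grid_sets_subset_Pow: "grid_sets M Y t \<subseteq> Pow (space M)"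
  by (auto simp: grid_sets_def)

text \<open>The value at \<open>s\<close> is the limit of the values at dyadic multiples of
  \<open>t\<close> below \<open>s\<close>. Hence the countably many dyadic grids generate everything
  that the path reveals up to time \<open>t\<close>.\<close>

lemma borel_measurable_grid_sets:
  assumes "\<And>\<omega>. \<omega> \<in> space M \<Longrightarrow> Y 0 \<omega> = 0"
    and cont: "\<And>\<omega>. \<omega> \<in> space M \<Longrightarrow> continuous_on {0..t} (\<lambda>s. Y s \<omega>)"
    and t: "0 < t" and s: "0 \<le> s" "s \<le> t"
  shows "Y s \<in> borel_measurable (sigma (space M) (grid_sets M Y t))" (is "_ \<in> borel_measurable ?N")
proof (rule borel_measurable_LIMSEQ_metric)
  fix n
  \<comment> \<open>\<open>q\<close> is the position of \<open>s\<close> measured in cells, and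
    \<open>k\<close> is the index of the last grid point not after \<open>s\<close>.\<close>
  define q where "q = s * 2 ^ n / t"
  define k where "k = nat \<lfloor>q\<rfloor>"
  have q: "0 \<le> q" "q \<le> real (2 ^ n)" using s t by (simp_all add: q_def field_simps)
  have "real k \<le> q" unfolding k_def using q(1) by linarith
  then have k: "k \<le> 2 ^ n"
    unfolding of_nat_le_iff[where 'a=real, symmetric] using q(2) by (rule order_trans)
  have m: "grid_increments Y t (2 ^ n) \<in> measurable ?N (borel_grid (2 ^ n))"
  proof (rule measurableI)
    fix C :: "(nat \<Rightarrow> real) set" assume "C \<in> sets (borel_grid (2 ^ n))"
    then have "grid_increments Y t (2 ^ n) -` C \<inter> space M \<in> grid_sets M Y t"
      by (rule grid_setsI)
    then show "grid_increments Y t (2 ^ n) -` C \<inter> space ?N \<in> sets ?N"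
      using grid_sets_subset_Pow[of M Y t] by (simp add: space_measure_of_conv)
  qed (auto simp: grid_increments_def space_PiM)
  have "(\<lambda>d. \<Sum>i<k. d i) \<in> borel_measurable (PiM {..<2 ^ n} (\<lambda>_. borel :: real measure))"
    using k by (intro borel_measurable_sum measurable_component_singleton) auto
  from measurable_compose[OF m this]
  have "(\<lambda>\<omega>. \<Sum>i<k. grid_increments Y t (2 ^ n) \<omega> i) \<in> borel_measurable ?N" .
  also have "?this \<longleftrightarrow> Y (real k * t / real (2 ^ n)) \<in> borel_measurable ?N"
    using assms(1) k
    by (intro measurable_cong sum_grid_increments) (auto simp: space_measure_of_conv)
  finally show "Y (real (nat \<lfloor>s * 2 ^ n / t\<rfloor>) * t / real (2 ^ n)) \<in> borel_measurable ?N"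
    unfolding k_def q_def .
next
  fix \<omega> assume "\<omega> \<in> space ?N"
  then have \<omega>: "\<omega> \<in> space M" by (simp add: space_measure_of_conv)
  have b: "s - t / 2 ^ n \<le> real (nat \<lfloor>s * 2 ^ n / t\<rfloor>) * t / real (2 ^ n)"
    "real (nat \<lfloor>s * 2 ^ n / t\<rfloor>) * t / real (2 ^ n) \<le> s" for n
  proof -
    define q where "q = s * 2 ^ n / t"
    have "0 \<le> q" using s t by (simp add: q_def)
    then have r: "real (nat \<lfloor>q\<rfloor>) \<le> q" "q - 1 \<le> real (nat \<lfloor>q\<rfloor>)" by linarith+
    have "s = q * t / 2 ^ n" using t by (simp add: q_def)
    moreover have "q * t / 2 ^ n - t / 2 ^ n = (q - 1) * t / 2 ^ n"
      by (simp add: algebra_simps diff_divide_distrib)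
    ultimately show "s - t / 2 ^ n \<le> real (nat \<lfloor>s * 2 ^ n / t\<rfloor>) * t / real (2 ^ n)"
      "real (nat \<lfloor>s * 2 ^ n / t\<rfloor>) * t / real (2 ^ n) \<le> s"
      using r t unfolding q_def[symmetric] by (auto intro!: divide_right_mono mult_right_mono)
  qed
  have "(\<lambda>n. real (nat \<lfloor>s * 2 ^ n / t\<rfloor>) * t / real (2 ^ n)) \<longlonglongrightarrow> s"
  proof (rule tendsto_sandwich[of "\<lambda>n. s - t / 2 ^ n" _ _ "\<lambda>n. s"])
    have "(\<lambda>n. s - t * (1 / 2) ^ n) \<longlonglongrightarrow> s - t * 0"
      by (intro tendsto_intros LIMSEQ_realpow_zero) auto
    then show "(\<lambda>n. s - t / 2 ^ n) \<longlonglongrightarrow> s" by (simp add: power_divide)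
  qed (use b in auto)
  then show "(\<lambda>n. Y (real (nat \<lfloor>s * 2 ^ n / t\<rfloor>) * t / real (2 ^ n)) \<omega>) \<longlonglongrightarrow> Y s \<omega>"
  proof (rule continuous_on_tendsto_compose[OF cont[OF \<omega>]])
    show "s \<in> {0..t}" using s by simp
    show "\<forall>\<^sub>F n in sequentially. real (nat \<lfloor>s * 2 ^ n / t\<rfloor>) * t / real (2 ^ n) \<in> {0..t}"
      using order_trans[OF b(2) s(2)] t by simp
  qed
qed

text \<open>At a common level the grid before \<open>r\<close> and the grid after \<open>r\<close>
  join to a single partition, whose increments are independent. The pi-system property then extends
  the product formula to the generated sigma-algebras.\<close>

lemma indep_set_grid_sets:
  assumes "brownian_motion M B" "0 < r" "0 < s"
  shows "prob_space.indep_set M (sigma_sets (space M) (grid_sets M B r))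
    (sigma_sets (space M) (grid_sets M (shifted B r) s))"
proof -
  note B = brownian_motionD[OF assms(1)]
  interpret prob_space M by (rule B(1))
  let ?P = "\<lambda>n. PiM {..<2 ^ n} (\<lambda>_::nat. borel :: real measure)"
  have m1: "grid_increments B r (2 ^ n) \<in> measurable M (?P n)" for n
    using assms B(2) by (intro measurable_grid_increments) auto
  have m2: "grid_increments (shifted B r) s (2 ^ n) \<in> measurable M (?P n)" for n
    using wiener_on_shift[OF assms(1) _ assms(3), of r] assms
    by (intro measurable_grid_increments) (auto simp: wiener_on_def)
  show ?thesis
  proof (rule indep_set_sigma_sets[OF _ Int_stable_grid_sets Int_stable_grid_sets],
      unfold indep_sets2_eq, intro conjI ballI)
    show "grid_sets M B r \<subseteq> events" "grid_sets M (shifted B r) s \<subseteq> events"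
      unfolding grid_sets_def using m1 m2 by (auto intro: measurable_sets)
    fix a b assume "a \<in> grid_sets M B r" "b \<in> grid_sets M (shifted B r) s"
    then obtain n C' D' where CD:
      "C' \<in> sets (?P n)" "a = grid_increments B r (2 ^ n) -` C' \<inter> space M"
      "D' \<in> sets (?P n)" "b = grid_increments (shifted B r) s (2 ^ n) -` D' \<inter> space M"
      by (rule grid_sets_common_level)
    define N :: nat where "N = 2 ^ n"
    have N: "N > 0" by (simp add: N_def)
    \<comment> \<open>\<open>N\<close> cells of length \<open>r / N\<close> are followed by
      \<open>N\<close> cells of length \<open>s / N\<close>. Both formulas give \<open>r\<close> at
      index \<open>N\<close>, so the partition has no gap there.\<close>
    define ts where "ts i = (if i \<le> N then real i * r / N else r + real (i - N) * s / N)" for i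
    define X where "X i \<omega> = B (ts (Suc i)) \<omega> - B (ts i) \<omega>" for i \<omega>
    have ts2: "ts (N + i) = r + real i * s / N" for i
      using N by (auto simp: ts_def)
    have step: "real i * c / N < real (Suc i) * c / N" if "0 < c" for i c
      using that N by (intro divide_strict_right_mono mult_strict_right_mono) simp_all
    have ts_less: "ts i < ts (Suc i)" for i
    proof (cases "i < N")
      case True
      then show ?thesis using step[OF assms(2), of i] by (simp add: ts_def del: of_nat_Suc)
    next
      case False
      then have "i = N + (i - N)" by simp
      moreover have "ts (N + (i - N)) < ts (N + Suc (i - N))"
        unfolding ts2 using step[OF assms(3)] by (rule add_strict_left_mono)
      ultimately show ?thesis by simp
    qed
    have ind: "indep_vars (\<lambda>_. borel) X {..<N + N}"
      unfolding X_def by (rule B(6)) (simp_all add: ts_less, simp add: ts_def)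
    have "indep_var (borel_grid N) (\<lambda>\<omega>. restrict (\<lambda>i. X i \<omega>) {..<N})
        (PiM {N..<N + N} (\<lambda>_. borel)) (\<lambda>\<omega>. restrict (\<lambda>i. X i \<omega>) {N..<N + N})"
      by (rule indep_var_restrict[OF ind]) (use N in auto)
    then have "indep_var (borel_grid N) ((\<lambda>d. d) \<circ> (\<lambda>\<omega>. restrict (\<lambda>i. X i \<omega>) {..<N}))
        (borel_grid N) ((\<lambda>d. \<lambda>i\<in>{..<N}. d (N + i)) \<circ> (\<lambda>\<omega>. restrict (\<lambda>i. X i \<omega>) {N..<N + N}))"
      by (rule indep_var_compose)
        (simp, rule measurable_restrict, rule measurable_component_singleton, simp)
    moreover have "(\<lambda>d. d) \<circ> (\<lambda>\<omega>. restrict (\<lambda>i. X i \<omega>) {..<N}) = grid_increments B r N"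
      unfolding comp_def grid_increments_def X_def
      by (intro ext restrict_ext) (simp add: ts_def del: of_nat_Suc)
    moreover have "(\<lambda>d. \<lambda>i\<in>{..<N}. d (N + i)) \<circ> (\<lambda>\<omega>. restrict (\<lambda>i. X i \<omega>) {N..<N + N})
        = grid_increments (shifted B r) s N"
    proof -
      have "X (N + i) \<omega> = shifted B r (real (Suc i) * s / N) \<omega> - shifted B r (real i * s / N) \<omega>" for i \<omega>
        using ts2[of i] ts2[of "Suc i"] unfolding X_def shifted_def by simp
      then show ?thesis
        unfolding comp_def grid_increments_def by (intro ext restrict_ext) simp
    qed
    ultimately have "indep_var (borel_grid N) (grid_increments B r N)
        (borel_grid N) (grid_increments (shifted B r) s N)"
      by simp
    from indep_varD[OF this, of C' D'] CD
    have "prob ((\<lambda>x. (grid_increments B r N x, grid_increments (shifted B r) s N x)) -` (C' \<times> D') \<inter> space M)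
        = prob a * prob b"
      unfolding N_def by simp
    also have "(\<lambda>x. (grid_increments B r N x, grid_increments (shifted B r) s N x)) -` (C' \<times> D') \<inter> space M
        = a \<inter> b"
      using CD by (auto simp: N_def)
    finally show "prob (a \<inter> b) = prob a * prob b" .
  qed
qed

section \<open>Natural filtrations and adaptedness of the functional\<close>

lemma space_natural_filtration: "space (natural_filtration M X t) = space M"
  by (simp add: natural_filtration_def space_measure_of_conv)

lemma sets_natural_filtration:
  "sets (natural_filtration M X t) = sigma_sets (space M)
     (\<Union>s\<in>{s. 0 \<le> s \<and> ennreal s \<le> t}. {X s -` A \<inter> space M | A. A \<in> sets borel})"
  unfolding natural_filtration_def by (rule sets_measure_of) auto

lemma sets_natural_filtration_subset:
  assumes "\<And>s. 0 \<le> s \<Longrightarrow> ennreal s \<le> t \<Longrightarrow> X s \<in> borel_measurable N" "space N = space M"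
  shows "sets (natural_filtration M X t) \<subseteq> sets N"
  unfolding sets_natural_filtration assms(2)[symmetric]
  using assms(1) by (intro sets.sigma_sets_subset) (auto simp: measurable_sets)

lemma measurable_natural_filtration:
  assumes "0 \<le> s" "ennreal s \<le> t"
  shows "X s \<in> borel_measurable (natural_filtration M X t)"
proof (rule measurableI)
  fix A :: "real set" assume "A \<in> sets borel"
  then show "X s -` A \<inter> space (natural_filtration M X t) \<in> sets (natural_filtration M X t)"
    unfolding sets_natural_filtration space_natural_filtration using assms
    by (intro sigma_sets.Basic) blast
qed simp

lemma filtration_natural_filtration: "filtration (space M) (natural_filtration M X)"
proof
  fix i j :: ennreal assume "i \<le> j"
  then show "sets (natural_filtration M X i) \<subseteq> sets (natural_filtration M X j)"
    by (intro sets_natural_filtration_subset measurable_natural_filtration)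
      (auto simp: space_natural_filtration)
qed (simp add: space_natural_filtration)

lemma subalgebra_natural_filtration:
  assumes "\<And>s. 0 \<le> s \<Longrightarrow> X s \<in> borel_measurable M"
  shows "subalgebra M (natural_filtration M X t)"
  unfolding subalgebra_def using sets_natural_filtration_subset[of t X M M] assms
  by (simp add: space_natural_filtration)

text \<open>The hypothesis concerns the drifted path up to \<open>t\<close> and an arbitrary
  \<open>N\<close>. The same Riemann sums thus give measurability for the natural filtration, for
  the sigma-algebra generated by future grids, and for \<open>M\<close>.\<close>

lemma xi_measurable:
  assumes "0 \<le> t" "\<And>\<omega>. \<omega> \<in> space N \<Longrightarrow> continuous_on {0..t} (\<lambda>s. B s \<omega>)"
    and W: "\<And>s. 0 \<le> s \<Longrightarrow> s \<le> t \<Longrightarrow> with_drift B \<mu> s \<in> borel_measurable N"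
  shows "xi B \<mu> t \<in> borel_measurable N"
proof (rule borel_measurable_LIMSEQ_metric)
  let ?g = "\<lambda>s \<omega>. exp (2 * with_drift B \<mu> s \<omega>)"
  fix n :: nat
  have "real i * t / real n \<le> t" if "i < n" for i
    using that assms(1) by (cases "n = 0") (auto simp: pos_divide_le_eq mult.commute[of _ t] intro!: mult_left_mono)
  then have g: "?g (real i * t / real n) \<in> borel_measurable N" if "i < n" for i
    using that W[of "real i * t / real n"] assms(1)
    by (intro borel_measurable_exp[THEN measurable_compose[rotated]] borel_measurable_times) auto
  have "with_drift B \<mu> t \<in> borel_measurable N" using W[of t] assms(1) by simp
  then show "(\<lambda>\<omega>. exp (- 2 * with_drift B \<mu> t \<omega>) *
      ((\<Sum>i<n. ?g (real i * t / real n) \<omega>) * (t / real n))) \<in> borel_measurable N"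
    by (intro borel_measurable_times borel_measurable_sum g
        borel_measurable_exp[THEN measurable_compose[rotated]]) auto
next
  fix \<omega> assume "\<omega> \<in> space N"
  then show "(\<lambda>n. exp (- 2 * with_drift B \<mu> t \<omega>) *
      ((\<Sum>i<n. exp (2 * with_drift B \<mu> (real i * t / real n) \<omega>)) * (t / real n))) \<longlonglongrightarrow> xi B \<mu> t \<omega>"
    using assms(1,2) by (subst xi_eq_integral)
      (simp, intro tendsto_mult tendsto_const riemann_sums_tendsto continuous_intros
        continuous_on_with_drift, simp_all)
qed

section \<open>The Markov property of the affine flow\<close>

lemma indep_set_mono:
  assumes "prob_space M" "prob_space.indep_set M A B" "A' \<subseteq> A" "B' \<subseteq> B"
  shows "prob_space.indep_set M A' B'"
  using assms unfolding prob_space.indep_sets2_eq[OF assms(1)] by (meson subset_iff)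

lemma sigma_sets_vimage_subset:
  assumes "f \<in> measurable N S" "space N = \<Omega>"
  shows "sigma_sets \<Omega> {f -` A \<inter> \<Omega> | A. A \<in> sets S} \<subseteq> sets N"
  unfolding assms(2)[symmetric]
  using assms(1) by (intro sets.sigma_sets_subset) (auto simp: measurable_sets)

text \<open>Handles past and future when one of the two time intervals has length 0.\<close>

lemma indep_set_trivial:
  assumes "prob_space M" "A \<subseteq> sets M" "B \<subseteq> {{}, space M}"
  shows "prob_space.indep_set M A B" "prob_space.indep_set M B A"
proof -
  interpret prob_space M by fact
  have "a \<inter> space M = a" "space M \<inter> a = a" if "a \<in> A" for a
    using that assms(2) sets.sets_into_space by blast+
  then show "indep_set A B" "indep_set B A"
    unfolding indep_sets2_eq using assms(2,3) by (auto simp: prob_space)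
qed

lemma shifted_with_drift:
  "with_drift (shifted B r) \<mu> u \<omega> = with_drift B \<mu> (r + u) \<omega> - with_drift B \<mu> r \<omega>"
  by (simp add: with_drift_def shifted_def algebra_simps)

lemma flow_0 [simp]: "B 0 \<omega> = 0 \<Longrightarrow> flow B \<mu> 0 x \<omega> = x"
  by (simp add: flow_def xi_eq_integral with_drift_def)

text \<open>A pathwise cocycle identity, valid at every time pair and for every continuous path.
  After time \<open>r\<close> the factor \<open>exp (2 * W r)\<close> leaves the integral, and what
  remains involves only increments. For \<open>x = 0\<close> it expresses \<xi> at time
  \<open>r + s\<close> through \<xi> at time \<open>r\<close>.\<close>

lemma flow_shifted:
  assumes cont: "continuous_on {0..} (\<lambda>s. B s \<omega>)" and rs: "0 \<le> r" "0 \<le> s"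
  shows "flow B \<mu> (r + s) x \<omega> = flow (shifted B r) \<mu> s (flow B \<mu> r x \<omega>) \<omega>"
proof -
  let ?W = "\<lambda>s. with_drift B \<mu> s \<omega>" and ?W' = "\<lambda>s. with_drift (shifted B r) \<mu> s \<omega>"
  let ?g = "\<lambda>s. exp (2 * ?W s)"
  have c: "continuous_on {a..b} (\<lambda>s. B s \<omega>)" if "0 \<le> a" for a b
    by (rule continuous_on_subset[OF cont]) (use that in auto)
  have cg: "continuous_on {a..b} ?g" if "0 \<le> a" for a b
    by (intro continuous_intros continuous_on_with_drift c that)
  have c': "continuous_on {0..s} (\<lambda>u. shifted B r u \<omega>)"
    unfolding shifted_def
    by (intro continuous_intros continuous_on_compose2[OF cont]) (use rs in auto)
  have "integral {0..r} ?g + integral {r..r + s} ?g = integral {0..r + s} ?g"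
    using rs by (intro Henstock_Kurzweil_Integration.integral_combine integrable_continuous_interval cg) auto
  moreover have "integral {r..r + s} ?g = integral {0..s} (?g \<circ> (+) r)"
    using integral_shift_Icc_real[of 0 s ?g r] by (simp add: add.commute[of s r])
  moreover have "integral {0..s} (?g \<circ> (+) r) = exp (2 * ?W r) * integral {0..s} (\<lambda>u. exp (2 * ?W' u))"
  proof -
    have "?g \<circ> (+) r = (\<lambda>u. exp (2 * ?W r) * exp (2 * ?W' u))"
      by (simp add: fun_eq_iff shifted_with_drift mult_exp_exp)
    then show ?thesis by simp
  qed
  ultimately have "integral {0..r + s} ?g = integral {0..r} ?g + exp (2 * ?W r) * integral {0..s} (\<lambda>u. exp (2 * ?W' u))"
    by simp
  moreover have "?W (r + s) = ?W r + ?W' s" by (simp add: shifted_with_drift)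
  moreover have "xi B \<mu> (r + s) \<omega> = exp (- 2 * ?W (r + s)) * integral {0..r + s} ?g"
    "xi B \<mu> r \<omega> = exp (- 2 * ?W r) * integral {0..r} ?g"
    "xi (shifted B r) \<mu> s \<omega> = exp (- 2 * ?W' s) * integral {0..s} (\<lambda>u. exp (2 * ?W' u))"
    using c c' by (intro xi_eq_integral; simp)+
  \<comment> \<open>With these two relations between the exponentials, the claim is a polynomial
    identity in the exponentials and the integrals.\<close>
  moreover have "exp (- 2 * (?W r + ?W' s)) = exp (- 2 * ?W' s) * exp (- 2 * ?W r)"
    "exp (- 2 * ?W r) * exp (2 * ?W r) = 1"
    by (simp_all add: mult_exp_exp)
  ultimately show ?thesis
    unfolding flow_def by algebra
qed

lemma flow_zero_eq_xi: "flow B \<mu> t 0 \<omega> = xi B \<mu> t \<omega>"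
  by (simp add: flow_def)

locale drifted_brownian_motion =
  fixes M :: "'a measure" and B :: "real \<Rightarrow> 'a \<Rightarrow> real" and \<mu> :: real
  assumes bm: "brownian_motion M B"
begin

sublocale prob_space M
  using brownian_motionD(1)[OF bm] .

abbreviation "W \<equiv> with_drift B \<mu>"
abbreviation "\<xi> \<equiv> xi B \<mu>"
abbreviation "\<Phi> \<equiv> flow B \<mu>"
abbreviation "F \<equiv> natural_filtration M W"

lemmas B_measurable = brownian_motionD(2)[OF bm]
  and B_0 = brownian_motionD(3)[OF bm]
  and B_continuous = brownian_motionD(4)[OF bm]

lemma with_drift_measurable: "0 \<le> s \<Longrightarrow> W s \<in> borel_measurable M"
  unfolding with_drift_def using B_measurable by simp

lemma subalgebra_F: "subalgebra M (F t)"
  by (rule subalgebra_natural_filtration) (rule with_drift_measurable)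

lemma B_continuous_Icc: "\<omega> \<in> space M \<Longrightarrow> continuous_on {0..t} (\<lambda>s. B s \<omega>)"
  by (rule continuous_on_subset[OF B_continuous]) auto

lemma xi_measurable_F: "0 \<le> s \<Longrightarrow> ennreal s \<le> t \<Longrightarrow> \<xi> s \<in> borel_measurable (F t)"
  by (intro xi_measurable B_continuous_Icc measurable_natural_filtration)
    (auto simp: space_natural_filtration intro: order_trans[OF ennreal_leI])

lemma flow_measurable_F: "0 \<le> s \<Longrightarrow> ennreal s \<le> t \<Longrightarrow> \<Phi> s x \<in> borel_measurable (F t)"
  unfolding flow_def
  by (intro borel_measurable_add borel_measurable_times xi_measurable_F borel_measurable_const
      borel_measurable_exp[THEN measurable_compose[rotated]] measurable_natural_filtration)

lemma xi_measurable_M: "0 \<le> s \<Longrightarrow> \<xi> s \<in> borel_measurable M"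
  using measurable_from_subalg[OF subalgebra_F xi_measurable_F, of s "ennreal s"] by simp

lemma flow_measurable_M: "0 \<le> s \<Longrightarrow> \<Phi> s x \<in> borel_measurable M"
  using measurable_from_subalg[OF subalgebra_F flow_measurable_F, of s "ennreal s"] by simp

lemma flow_measurable_pair:
  assumes "0 \<le> s"
  shows "(\<lambda>(x, \<omega>). \<Phi> s x \<omega>) \<in> borel_measurable (borel \<Otimes>\<^sub>M M)"
  unfolding flow_def using with_drift_measurable[OF assms] xi_measurable_M[OF assms] by measurable

text \<open>Slope and intercept of the random affine map over the time from \<open>r\<close> to
  \<open>r + s\<close>. The map for all starting points is encoded by two numbers, so independence
  is needed only for a pair of real variables.\<close>

definition future :: "real \<Rightarrow> real \<Rightarrow> 'a \<Rightarrow> real \<times> real" where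
  "future r s \<omega> = (exp (- 2 * with_drift (shifted B r) \<mu> s \<omega>), xi (shifted B r) \<mu> s \<omega>)"

lemma flow_future: "flow (shifted B r) \<mu> s x \<omega> = fst (future r s \<omega>) * x + snd (future r s \<omega>)"
  by (simp add: flow_def future_def)

lemma F_subset_grid_sets:
  assumes "0 < r"
  shows "sets (F (ennreal r)) \<subseteq> sigma_sets (space M) (grid_sets M B r)"
proof -
  have "sets (F (ennreal r)) \<subseteq> sets (sigma (space M) (grid_sets M B r))"
  proof (rule sets_natural_filtration_subset)
    fix s assume "0 \<le> s" "ennreal s \<le> ennreal r"
    then have [measurable]: "B s \<in> borel_measurable (sigma (space M) (grid_sets M B r))"
      using assms by (intro borel_measurable_grid_sets B_0 B_continuous_Icc) (auto simp: ennreal_le_iff)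
    show "W s \<in> borel_measurable (sigma (space M) (grid_sets M B r))"
      unfolding with_drift_def by measurable
  qed (simp add: space_measure_of_conv)
  then show ?thesis
    using grid_sets_subset_Pow[of M B r] by simp
qed

lemma future_measurable_grid_sets:
  assumes "0 \<le> r" "0 < s"
  shows "future r s \<in> measurable (sigma (space M) (grid_sets M (shifted B r) s)) (borel \<Otimes>\<^sub>M borel)"
    (is "_ \<in> measurable ?N _")
proof -
  have w: "wiener_on M (shifted B r) s"
    using wiener_on_shift[OF bm assms] .
  have B': "shifted B r u \<in> borel_measurable ?N" if "0 \<le> u" "u \<le> s" for u
    using w assms that
    by (intro borel_measurable_grid_sets) (auto simp: wiener_on_def)
  have W': "with_drift (shifted B r) \<mu> u \<in> borel_measurable ?N" if "0 \<le> u" "u \<le> s" for u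
    unfolding with_drift_def using B'[OF that] by simp
  have [measurable]: "xi (shifted B r) \<mu> s \<in> borel_measurable ?N"
    using w assms W' by (intro xi_measurable) (auto simp: wiener_on_def space_measure_of_conv)
  have [measurable]: "with_drift (shifted B r) \<mu> s \<in> borel_measurable ?N"
    using W'[of s] assms by simp
  show ?thesis unfolding future_def by measurable
qed

lemma future_measurable_M:
  assumes "0 \<le> r" "0 \<le> s"
  shows "future r s \<in> measurable M (borel \<Otimes>\<^sub>M borel)"
proof -
  have B': "shifted B r u \<in> borel_measurable M" if "0 \<le> u" for u
    unfolding shifted_def using B_measurable assms that by simp
  have W': "with_drift (shifted B r) \<mu> u \<in> borel_measurable M" if "0 \<le> u" for u
    unfolding with_drift_def using B'[OF that] by simp
  have [measurable]: "xi (shifted B r) \<mu> s \<in> borel_measurable M"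
  proof (rule xi_measurable[OF assms(2) _ W'])
    fix \<omega> assume "\<omega> \<in> space M"
    then show "continuous_on {0..s} (\<lambda>u. shifted B r u \<omega>)"
      unfolding shifted_def
      by (intro continuous_intros continuous_on_compose2[OF B_continuous]) (use assms in auto)
  qed
  have [measurable]: "with_drift (shifted B r) \<mu> s \<in> borel_measurable M"
    using W'[of s] assms by simp
  show ?thesis unfolding future_def by measurable
qed

text \<open>For positive lengths both sides are contained in the sigma-algebras of dyadic grid
  events before and after \<open>r\<close>, which are independent.\<close>

lemma indep_past_future:
  assumes rs: "0 \<le> r" "0 \<le> s"
  shows "indep_set (sets (F (ennreal r)))
    (sigma_sets (space M) {future r s -` A \<inter> space M |A. A \<in> sets (borel \<Otimes>\<^sub>M borel)})"
    (is "indep_set ?A ?B")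
proof -
  have fut: "random_variable (borel \<Otimes>\<^sub>M borel) (future r s)"
    using future_measurable_M[OF rs] .
  have A': "?A \<subseteq> sets M"
    using subalgebra_F unfolding subalgebra_def by blast
  have B: "?B \<subseteq> sets M"
    by (rule sigma_sets_vimage_subset[OF fut refl])
  \<comment> \<open>The grids need positive length on both sides. For \<open>r = 0\<close> the past
    is trivial because the path starts at 0; for \<open>s = 0\<close> the future pair is the
    constant \<open>(1, 0)\<close>.\<close>
  consider "r = 0" | "s = 0" | "0 < r" "0 < s" using rs by linarith
  then show "indep_set ?A ?B"
  proof cases
    case 1
    have "sets (F (ennreal r)) \<subseteq> sets (sigma (space M) {})"
    proof (rule sets_natural_filtration_subset)
      fix u assume u: "0 \<le> u" "ennreal u \<le> ennreal r"
      then have "u = 0" using 1 by simp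
      then have "W u \<in> borel_measurable (sigma (space M) {})
          \<longleftrightarrow> (\<lambda>_. 0 :: real) \<in> borel_measurable (sigma (space M) {})"
        by (intro measurable_cong) (simp add: with_drift_def B_0 space_measure_of_conv)
      then show "W u \<in> borel_measurable (sigma (space M) {})" by simp
    qed (simp add: space_measure_of_conv)
    then have "?A \<subseteq> {{}, space M}"
      by (simp add: sigma_sets_empty_eq)
    then show ?thesis by (rule indep_set_trivial(2)[OF prob_space_axioms B])
  next
    case 2
    have "future r s = (\<lambda>_. (1, 0))"
      by (simp add: fun_eq_iff future_def 2 with_drift_def shifted_def xi_eq_integral)
    then have "?B \<subseteq> sets (sigma (space M) {})"
      by (intro sigma_sets_vimage_subset) (simp_all add: space_measure_of_conv)
    then have "?B \<subseteq> {{}, space M}" by (simp add: sigma_sets_empty_eq)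
    then show ?thesis by (rule indep_set_trivial(1)[OF prob_space_axioms A'])
  next
    case 3
    have "?B \<subseteq> sets (sigma (space M) (grid_sets M (shifted B r) s))"
      using 3 rs by (intro sigma_sets_vimage_subset future_measurable_grid_sets)
        (simp_all add: space_measure_of_conv)
    then have "?B \<subseteq> sigma_sets (space M) (grid_sets M (shifted B r) s)"
      using grid_sets_subset_Pow[of M "shifted B r" s] by simp
    with F_subset_grid_sets[OF 3(1)] show ?thesis
      by (rule indep_set_mono[OF prob_space_axioms indep_set_grid_sets[OF bm 3]])
  qed
qed

text \<open>The future map may be integrated out while the starting point \<open>Y\<close> is
  frozen. Allowing any \<open>Y\<close> measurable at time \<open>r\<close> covers both
  \<open>\<Phi> s x\<close>, for the semigroup law, and \<xi> itself, for the strong Markov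
  property.\<close>

lemma markov_nn_integral:
  assumes rs: "0 \<le> r" "0 \<le> s" and A: "A \<in> sets (F (ennreal r))"
    and Y: "Y \<in> borel_measurable (F (ennreal r))"
    and [measurable]: "g \<in> borel_measurable borel"
  shows "(\<integral>\<^sup>+\<omega>. indicator A \<omega> * g (flow (shifted B r) \<mu> s (Y \<omega>) \<omega>) \<partial>M)
    = (\<integral>\<^sup>+\<omega>. indicator A \<omega> * (\<integral>\<^sup>+\<omega>'. g (\<Phi> s (Y \<omega>) \<omega>') \<partial>M) \<partial>M)"
proof -
  let ?F = "F (ennreal r)" and ?B = "borel \<Otimes>\<^sub>M borel :: (real \<times> real) measure"
  note A[measurable] Y[measurable] future_measurable_M[OF rs, measurable]
  \<comment> \<open>The identity, read as a map into the coarser sigma-algebra at time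
    \<open>r\<close>, plays the role of the past: both \<open>A\<close> and \<open>Y\<close> are
    functions of it.\<close>
  have id[measurable]: "(\<lambda>\<omega>. \<omega>) \<in> measurable M ?F"
    by (rule measurable_from_subalg[OF subalgebra_F measurable_ident_sets[OF refl]])
  interpret D: prob_space "distr M ?B (future r s)"
    by (rule prob_space_distr) simp
  let ?H = "\<lambda>(\<omega>, v). indicator A \<omega> * g (fst v * Y \<omega> + snd v)"
  have H[measurable]: "?H \<in> borel_measurable (?F \<Otimes>\<^sub>M ?B)" by measurable
  have "(\<integral>\<^sup>+\<omega>. indicator A \<omega> * g (flow (shifted B r) \<mu> s (Y \<omega>) \<omega>) \<partial>M)
      = (\<integral>\<^sup>+p. ?H p \<partial>distr M (?F \<Otimes>\<^sub>M ?B) (\<lambda>\<omega>. (\<omega>, future r s \<omega>)))"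
    by (subst nn_integral_distr) (simp_all add: flow_future)
  \<comment> \<open>Independence in the form used here: the joint law of the past and the future
    pair is the product of its marginals.\<close>
  also have "distr M (?F \<Otimes>\<^sub>M ?B) (\<lambda>\<omega>. (\<omega>, future r s \<omega>))
      = distr M ?F (\<lambda>\<omega>. \<omega>) \<Otimes>\<^sub>M distr M ?B (future r s)"
  proof (rule pair_measure_eqI[symmetric])
    fix a b assume "a \<in> sets (distr M ?F (\<lambda>\<omega>. \<omega>))" "b \<in> sets (distr M ?B (future r s))"
    then have ab: "a \<in> sets ?F" "b \<in> sets ?B" by simp_all
    have "prob (a \<inter> (future r s -` b \<inter> space M)) = prob a * prob (future r s -` b \<inter> space M)"
      using ab by (intro indep_setD[OF indep_past_future[OF rs]] sigma_sets.Basic) blast+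
    moreover have "(\<lambda>\<omega>. (\<omega>, future r s \<omega>)) -` (a \<times> b) \<inter> space M = a \<inter> (future r s -` b \<inter> space M)"
      by auto
    moreover have "a \<inter> space M = a"
      using sets.sets_into_space[OF ab(1)] by (auto simp: space_natural_filtration)
    ultimately show "emeasure (distr M ?F (\<lambda>\<omega>. \<omega>)) a * emeasure (distr M ?B (future r s)) b
        = emeasure (distr M (?F \<Otimes>\<^sub>M ?B) (\<lambda>\<omega>. (\<omega>, future r s \<omega>))) (a \<times> b)"
      using ab by (simp add: emeasure_distr emeasure_eq_measure ennreal_mult')
  qed (simp_all add: D.sigma_finite_measure prob_space_imp_sigma_finite prob_space_distr)
  also have "(\<integral>\<^sup>+p. ?H p \<partial>\<dots>)
      = (\<integral>\<^sup>+\<omega>. \<integral>\<^sup>+v. ?H (\<omega>, v) \<partial>distr M ?B (future r s) \<partial>distr M ?F (\<lambda>\<omega>. \<omega>))"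
    by (rule D.nn_integral_fst[symmetric]) simp
  also have "\<dots> = (\<integral>\<^sup>+\<omega>. \<integral>\<^sup>+v. ?H (\<omega>, v) \<partial>distr M ?B (future r s) \<partial>M)"
    by (subst nn_integral_distr) (simp_all add: D.borel_measurable_nn_integral)
  also have "\<dots> = (\<integral>\<^sup>+\<omega>. indicator A \<omega> * (\<integral>\<^sup>+\<omega>'. g (\<Phi> s (Y \<omega>) \<omega>') \<partial>M) \<partial>M)"
  proof (rule nn_integral_cong)
    fix \<omega> assume \<omega>: "\<omega> \<in> space M"
    \<comment> \<open>Time homogeneity: the flow driven by increments after \<open>r\<close> has the
      law of the flow driven by \<open>B\<close>. For \<open>s = 0\<close> both maps are the
      identity.\<close>
    have law: "distr M borel (flow (shifted B r) \<mu> s y) = distr M borel (\<Phi> s y)" for y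
    proof (cases "s = 0")
      case True
      then show ?thesis by (intro distr_cong) (simp_all add: B_0 shifted_def)
    next
      case False
      with rs show ?thesis
        by (intro distr_flow_eq prob_space_axioms wiener_on_shift wiener_on_brownian_motion bm) auto
    qed
    have fm[measurable]: "flow (shifted B r) \<mu> s y \<in> borel_measurable M" for y
      unfolding flow_future by measurable
    have "(\<integral>\<^sup>+v. ?H (\<omega>, v) \<partial>distr M ?B (future r s))
        = (\<integral>\<^sup>+\<omega>'. indicator A \<omega> * g (flow (shifted B r) \<mu> s (Y \<omega>) \<omega>') \<partial>M)"
      by (subst nn_integral_distr) (simp_all add: flow_future)
    also have "\<dots> = indicator A \<omega> * (\<integral>\<^sup>+\<omega>'. g (flow (shifted B r) \<mu> s (Y \<omega>) \<omega>') \<partial>M)"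
      by (rule nn_integral_cmult) simp
    also have "(\<integral>\<^sup>+\<omega>'. g (flow (shifted B r) \<mu> s (Y \<omega>) \<omega>') \<partial>M)
        = (\<integral>\<^sup>+y. g y \<partial>distr M borel (flow (shifted B r) \<mu> s (Y \<omega>)))"
      by (subst nn_integral_distr) simp_all
    also have "\<dots> = (\<integral>\<^sup>+\<omega>'. g (\<Phi> s (Y \<omega>) \<omega>') \<partial>M)"
      unfolding law using flow_measurable_M[OF rs(2)] by (subst nn_integral_distr) simp_all
    finally show "(\<integral>\<^sup>+v. ?H (\<omega>, v) \<partial>distr M ?B (future r s))
        = indicator A \<omega> * (\<integral>\<^sup>+\<omega>'. g (\<Phi> s (Y \<omega>) \<omega>') \<partial>M)" .
  qed
  finally show ?thesis .
qed

end

section \<open>Moments\<close>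

text \<open>Completing the square turns the exponentially tilted normal density into a multiple of
  the normal density with mean \<open>c * \<sigma>^2\<close>.\<close>

lemma has_bochner_integral_normal_exp:
  assumes "distributed M lborel X (normal_density 0 \<sigma>)" "0 < \<sigma>"
  shows "has_bochner_integral M (\<lambda>\<omega>. exp (c * X \<omega>)) (exp (c\<^sup>2 * \<sigma>\<^sup>2 / 2))"
proof -
  have eq: "normal_density 0 \<sigma> x * exp (c * x) = exp (c\<^sup>2 * \<sigma>\<^sup>2 / 2) * normal_density (c * \<sigma>\<^sup>2) \<sigma> x" for x
  proof -
    have "- (x - 0)\<^sup>2 / (2 * \<sigma>\<^sup>2) + c * x = c\<^sup>2 * \<sigma>\<^sup>2 / 2 + - (x - c * \<sigma>\<^sup>2)\<^sup>2 / (2 * \<sigma>\<^sup>2)"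
      using assms(2) by (simp add: field_simps power2_eq_square)
    then have "exp (- (x - 0)\<^sup>2 / (2 * \<sigma>\<^sup>2)) * exp (c * x)
        = exp (c\<^sup>2 * \<sigma>\<^sup>2 / 2) * exp (- (x - c * \<sigma>\<^sup>2)\<^sup>2 / (2 * \<sigma>\<^sup>2))"
      unfolding mult_exp_exp by simp
    then show ?thesis
      unfolding normal_density_def by (simp add: mult.left_commute mult.assoc)
  qed
  have "has_bochner_integral lborel (\<lambda>x. exp (c\<^sup>2 * \<sigma>\<^sup>2 / 2) * normal_density (c * \<sigma>\<^sup>2) \<sigma> x)
      (exp (c\<^sup>2 * \<sigma>\<^sup>2 / 2) * 1)"
    using assms(2) by (intro has_bochner_integral_mult_right) (simp add: has_bochner_integral_iff)
  then have "has_bochner_integral lborel (\<lambda>x. normal_density 0 \<sigma> x * exp (c * x)) (exp (c\<^sup>2 * \<sigma>\<^sup>2 / 2))"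
    unfolding eq by simp
  then show ?thesis
    using distributed_integrable[OF assms(1), of "\<lambda>x. exp (c * x)"]
      distributed_integral[OF assms(1), of "\<lambda>x. exp (c * x)"]
    by (simp add: has_bochner_integral_iff)
qed

lemma tendsto_exp_minus_1_div:
  "((\<lambda>t. (exp (a * t) - 1) / t) \<longlongrightarrow> a) (at_right (0::real))"
proof -
  have "((\<lambda>t. exp (a * t)) has_real_derivative a) (at 0)"
    by (auto intro!: derivative_eq_intros)
  then have "((\<lambda>t. (exp (a * t) - 1) / t) \<longlongrightarrow> a) (at 0)"
    by (simp add: has_field_derivative_iff)
  then show ?thesis by (rule filterlim_mono) (auto simp: at_within_le_at)
qed

context drifted_brownian_motion
begin

lemma exp_increment:
  assumes "0 \<le> s" "s \<le> t"
  shows "has_bochner_integral M (\<lambda>\<omega>. exp (c * (W t \<omega> - W s \<omega>)))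
    (exp ((c\<^sup>2 / 2 + c * \<mu>) * (t - s)))"
proof (cases "s = t")
  case True
  then show ?thesis by (simp add: has_bochner_integral_iff prob_space)
next
  case False
  with assms have "s < t" by simp
  then have "has_bochner_integral M (\<lambda>\<omega>. exp (c * (B t \<omega> - B s \<omega>))) (exp (c\<^sup>2 * (sqrt (t - s))\<^sup>2 / 2))"
    using assms by (intro has_bochner_integral_normal_exp brownian_motionD(5)[OF bm]) auto
  then have "has_bochner_integral M (\<lambda>\<omega>. exp (c * \<mu> * (t - s)) * exp (c * (B t \<omega> - B s \<omega>)))
      (exp (c * \<mu> * (t - s)) * exp (c\<^sup>2 * (sqrt (t - s))\<^sup>2 / 2))"
    by (rule has_bochner_integral_mult_right)
  then show ?thesis
    using \<open>s < t\<close> by (simp add: mult_exp_exp with_drift_def algebra_simps add_divide_distrib diff_divide_distrib)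
qed

abbreviation Z :: "real \<Rightarrow> 'a \<Rightarrow> real" where
  "Z t \<omega> \<equiv> exp (- 2 * W t \<omega>)"

text \<open>\<open>m k u\<close> is the \<open>k\<close>-th moment of \<open>exp (- 2 (W\<^sub>t - W\<^sub>s))\<close> with \<open>u = t - s\<close>.\<close>

definition m :: "nat \<Rightarrow> real \<Rightarrow> real" where
  "m k u = exp ((2 * (real k)\<^sup>2 - 2 * real k * \<mu>) * u)"

lemma increment_moment:
  assumes "0 \<le> s" "s \<le> t"
  shows "has_bochner_integral M (\<lambda>\<omega>. exp (- 2 * (W t \<omega> - W s \<omega>)) ^ k) (m k (t - s))"
proof -
  have "exp (- 2 * (W t \<omega> - W s \<omega>)) ^ k
      = exp (- 2 * real k * (W t \<omega> - W s \<omega>))" for \<omega>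
    by (simp add: exp_of_nat_mult[symmetric] algebra_simps)
  moreover have "((- 2 * real k)\<^sup>2 / 2 + - 2 * real k * \<mu>) = 2 * (real k)\<^sup>2 - 2 * real k * \<mu>"
    by (simp add: power_mult_distrib)
  ultimately show ?thesis
    using exp_increment[OF assms, of "- 2 * real k"] unfolding m_def by simp
qed

lemma increment_variation:
  assumes "0 \<le> s" "s \<le> t"
  shows "has_bochner_integral M (\<lambda>\<omega>. (exp (- 2 * (W t \<omega> - W s \<omega>)) - 1)\<^sup>2)
    (m 2 (t - s) - 2 * m 1 (t - s) + 1)"
proof -
  let ?U = "\<lambda>\<omega>. exp (- 2 * (W t \<omega> - W s \<omega>))"
  have "has_bochner_integral M (\<lambda>\<omega>. ?U \<omega> ^ 2 - 2 * ?U \<omega> ^ 1 + 1) (m 2 (t - s) - 2 * m 1 (t - s) + 1)"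
    by (intro has_bochner_integral_add has_bochner_integral_diff has_bochner_integral_mult_right
        increment_moment assms) (simp add: has_bochner_integral_iff prob_space)
  moreover have "?U \<omega> ^ 2 - 2 * ?U \<omega> ^ 1 + 1 = (?U \<omega> - 1)\<^sup>2" for \<omega>
    by (simp add: power2_eq_square algebra_simps)
  ultimately show ?thesis by simp
qed

lemma Z_moment:
  assumes "0 \<le> t"
  shows "has_bochner_integral M (\<lambda>\<omega>. Z t \<omega> ^ k) (m k t)"
proof -
  have "has_bochner_integral M (\<lambda>\<omega>. exp (- 2 * (W t \<omega> - W 0 \<omega>)) ^ k) (m k t)"
    using increment_moment[of 0 t k] assms by simp
  then show ?thesis
    by (rule has_bochner_integral_cong[THEN iffD1, rotated -1]) (simp_all add: with_drift_def B_0)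
qed

lemma Z_minus_1:
  assumes "0 \<le> t"
  shows "has_bochner_integral M (\<lambda>\<omega>. Z t \<omega> - 1) (m 1 t - 1)"
    "has_bochner_integral M (\<lambda>\<omega>. (Z t \<omega> - 1)\<^sup>2) (m 2 t - 2 * m 1 t + 1)"
    "has_bochner_integral M (\<lambda>\<omega>. (Z t \<omega> - 1) ^ 4) (m 4 t - 4 * m 3 t + 6 * m 2 t - 4 * m 1 t + 1)"
proof -
  have 1: "has_bochner_integral M (\<lambda>_. 1) (1::real)"
    by (simp add: has_bochner_integral_iff prob_space)
  show "has_bochner_integral M (\<lambda>\<omega>. Z t \<omega> - 1) (m 1 t - 1)"
    using has_bochner_integral_diff[OF Z_moment[OF assms, of 1] 1] by simp
  have "has_bochner_integral M (\<lambda>\<omega>. Z t \<omega> ^ 2 - 2 * Z t \<omega> ^ 1 + 1) (m 2 t - 2 * m 1 t + 1)"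
    by (intro has_bochner_integral_add has_bochner_integral_diff has_bochner_integral_mult_right
        Z_moment assms 1)
  moreover have "Z t \<omega> ^ 2 - 2 * Z t \<omega> ^ 1 + 1 = (Z t \<omega> - 1)\<^sup>2" for \<omega>
    by (simp add: power2_eq_square algebra_simps)
  ultimately show "has_bochner_integral M (\<lambda>\<omega>. (Z t \<omega> - 1)\<^sup>2) (m 2 t - 2 * m 1 t + 1)" by simp
  have "has_bochner_integral M (\<lambda>\<omega>. Z t \<omega> ^ 4 - 4 * Z t \<omega> ^ 3 + 6 * Z t \<omega> ^ 2 - 4 * Z t \<omega> ^ 1 + 1)
      (m 4 t - 4 * m 3 t + 6 * m 2 t - 4 * m 1 t + 1)"
    by (intro has_bochner_integral_add has_bochner_integral_diff has_bochner_integral_mult_right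
        Z_moment assms 1)
  moreover have "z ^ 4 - 4 * z ^ 3 + 6 * z ^ 2 - 4 * z ^ 1 + 1 = (z - 1) ^ 4" for z :: real
    by (simp add: power2_eq_square power3_eq_cube power4_eq_xxxx algebra_simps)
  ultimately show "has_bochner_integral M (\<lambda>\<omega>. (Z t \<omega> - 1) ^ 4)
      (m 4 t - 4 * m 3 t + 6 * m 2 t - 4 * m 1 t + 1)" by simp
qed

lemma m_tendsto: "((\<lambda>t. (m k t - 1) / t) \<longlongrightarrow> 2 * (real k)\<^sup>2 - 2 * real k * \<mu>) (at_right 0)"
  unfolding m_def by (rule tendsto_exp_minus_1_div)

text \<open>To first order in \<open>t\<close> the \<open>k\<close>-th moment of \<open>Z t\<close>
  is 1 plus \<open>t\<close> times a quadratic polynomial in \<open>k\<close>, and the powers of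
  \<open>Z t - 1\<close> form its finite differences. The second difference is 4; the fourth
  difference of a quadratic vanishes. The binomial coefficients alternate to 0, which allows 1 to be
  subtracted from each moment.\<close>

lemma Z_minus_1_tendsto:
  "((\<lambda>t. expectation (\<lambda>\<omega>. Z t \<omega> - 1) / t) \<longlongrightarrow> 2 - 2 * \<mu>) (at_right 0)"
  "((\<lambda>t. expectation (\<lambda>\<omega>. (Z t \<omega> - 1)\<^sup>2) / t) \<longlongrightarrow> 4) (at_right 0)"
  "((\<lambda>t. expectation (\<lambda>\<omega>. (Z t \<omega> - 1) ^ 4) / t) \<longlongrightarrow> 0) (at_right 0)"
proof -
  have ev: "\<forall>\<^sub>F t in at_right 0. (0::real) < t" by (simp add: eventually_at_right_less)
  note I = Z_minus_1[THEN has_bochner_integral_integral_eq]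
  show "((\<lambda>t. expectation (\<lambda>\<omega>. Z t \<omega> - 1) / t) \<longlongrightarrow> 2 - 2 * \<mu>) (at_right 0)"
  proof (rule Lim_transform_eventually)
    show "((\<lambda>t. (m 1 t - 1) / t) \<longlongrightarrow> 2 - 2 * \<mu>) (at_right 0)"
      using m_tendsto[of 1] by simp
    show "\<forall>\<^sub>F t in at_right 0. (m 1 t - 1) / t = expectation (\<lambda>\<omega>. Z t \<omega> - 1) / t"
      using ev by eventually_elim (simp only: I less_imp_le)
  qed
  show "((\<lambda>t. expectation (\<lambda>\<omega>. (Z t \<omega> - 1)\<^sup>2) / t) \<longlongrightarrow> 4) (at_right 0)"
  proof (rule Lim_transform_eventually)
    have "((\<lambda>t. (m 2 t - 1) / t - 2 * ((m 1 t - 1) / t)) \<longlongrightarrow>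
        (2 * (real 2)\<^sup>2 - 2 * real 2 * \<mu>) - 2 * (2 * (real 1)\<^sup>2 - 2 * real 1 * \<mu>)) (at_right 0)"
      by (intro tendsto_intros m_tendsto)
    then show "((\<lambda>t. (m 2 t - 1) / t - 2 * ((m 1 t - 1) / t)) \<longlongrightarrow> 4) (at_right 0)"
      by (simp add: algebra_simps)
    show "\<forall>\<^sub>F t in at_right 0. (m 2 t - 1) / t - 2 * ((m 1 t - 1) / t) = expectation (\<lambda>\<omega>. (Z t \<omega> - 1)\<^sup>2) / t"
      using ev by eventually_elim (simp only: I less_imp_le, simp add: add_divide_distrib diff_divide_distrib)
  qed
  show "((\<lambda>t. expectation (\<lambda>\<omega>. (Z t \<omega> - 1) ^ 4) / t) \<longlongrightarrow> 0) (at_right 0)"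
  proof (rule Lim_transform_eventually)
    let ?g = "\<lambda>t. (m 4 t - 1) / t - 4 * ((m 3 t - 1) / t) + 6 * ((m 2 t - 1) / t) - 4 * ((m 1 t - 1) / t)"
    have "(?g \<longlongrightarrow> (2 * (real 4)\<^sup>2 - 2 * real 4 * \<mu>) - 4 * (2 * (real 3)\<^sup>2 - 2 * real 3 * \<mu>)
        + 6 * (2 * (real 2)\<^sup>2 - 2 * real 2 * \<mu>) - 4 * (2 * (real 1)\<^sup>2 - 2 * real 1 * \<mu>)) (at_right 0)"
      by (intro tendsto_intros m_tendsto)
    then show "(?g \<longlongrightarrow> 0) (at_right 0)"
      by (simp add: algebra_simps)
    show "\<forall>\<^sub>F t in at_right 0. ?g t = expectation (\<lambda>\<omega>. (Z t \<omega> - 1) ^ 4) / t"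
      using ev by eventually_elim (simp only: I less_imp_le, simp add: add_divide_distrib diff_divide_distrib)
  qed
qed

text \<open>The quantity \<open>\<xi> t / t\<close> is the time average over \<open>s\<close> of
  \<open>exp (- 2 * (W t - W s))\<close>, whose mean-square distance from 1 is explicit. Convexity
  bounds the second moment of the average minus 1 by the supremum of these distances.\<close>

lemma xi_average:
  assumes t: "0 < t" and e: "\<And>u. 0 \<le> u \<Longrightarrow> u \<le> t \<Longrightarrow> m 2 u - 2 * m 1 u + 1 \<le> e"
  shows "integrable M (\<lambda>\<omega>. (\<xi> t \<omega> / t - 1)\<^sup>2)" "expectation (\<lambda>\<omega>. (\<xi> t \<omega> / t - 1)\<^sup>2) \<le> e"
proof -
  let ?U = "\<lambda>n i \<omega>. exp (- 2 * (W t \<omega> - W (real i * t / real (Suc n)) \<omega>)) - 1"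
  have e0: "0 \<le> e" using e[of 0] t by (simp add: m_def)
  have ti: "0 \<le> real i * t / real (Suc n)" "real i * t / real (Suc n) \<le> t" if "i < Suc n" for i n
    using that t by (auto simp: pos_divide_le_eq mult.commute[of _ t] simp del: of_nat_Suc intro!: mult_left_mono)
  have lim: "(\<lambda>n. (\<Sum>i<Suc n. ?U n i \<omega>) / real (Suc n)) \<longlonglongrightarrow> \<xi> t \<omega> / t - 1" if \<omega>: "\<omega> \<in> space M" for \<omega>
  proof -
    let ?g = "\<lambda>s. exp (2 * W s \<omega>)"
    have "(\<lambda>n. exp (- 2 * W t \<omega>) * ((\<Sum>i<Suc n. ?g (real i * t / real (Suc n))) * (t / real (Suc n))) / t - 1)
        \<longlonglongrightarrow> \<xi> t \<omega> / t - 1"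
      unfolding xi_eq_integral[of t B \<omega> \<mu>, OF B_continuous_Icc[OF \<omega>]] using t
      by (intro tendsto_intros LIMSEQ_Suc[OF riemann_sums_tendsto] continuous_intros
          continuous_on_with_drift B_continuous_Icc \<omega>) simp_all
    moreover have "exp (- 2 * W t \<omega>) * ((\<Sum>i<Suc n. ?g (real i * t / real (Suc n))) * (t / real (Suc n))) / t - 1
        = (\<Sum>i<Suc n. ?U n i \<omega>) / real (Suc n)" for n
    proof -
      have "(\<Sum>i<Suc n. ?U n i \<omega>) = (\<Sum>i<Suc n. exp (- 2 * W t \<omega>) * ?g (real i * t / real (Suc n))) - real (Suc n)"
        unfolding sum_subtractf by (simp add: mult_exp_exp algebra_simps del: sum.lessThan_Suc of_nat_Suc)
      also have "\<dots> = exp (- 2 * W t \<omega>) * (\<Sum>i<Suc n. ?g (real i * t / real (Suc n))) - real (Suc n)"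
        by (simp only: sum_distrib_left)
      finally show ?thesis
        using t by (simp add: diff_divide_distrib del: sum.lessThan_Suc of_nat_Suc)
    qed
    ultimately show ?thesis by simp
  qed
  have Um[measurable]: "?U n i \<in> borel_measurable M" if "i < Suc n" for n i
    using with_drift_measurable[OF less_imp_le[OF t]] with_drift_measurable[OF ti(1)[OF that]] by measurable
  have sm: "(\<lambda>\<omega>. \<Sum>i<Suc n. ?U n i \<omega>) \<in> borel_measurable M" for n
    by (rule borel_measurable_sum) (use Um in auto)
  have bound: "(\<integral>\<^sup>+\<omega>. ennreal (((\<Sum>i<Suc n. ?U n i \<omega>) / real (Suc n))\<^sup>2) \<partial>M) \<le> ennreal e" for n
  proof -
    have "(\<integral>\<^sup>+\<omega>. ennreal (((\<Sum>i<Suc n. ?U n i \<omega>) / real (Suc n))\<^sup>2) \<partial>M)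
        \<le> (\<integral>\<^sup>+\<omega>. ennreal ((\<Sum>i<Suc n. (?U n i \<omega>)\<^sup>2) / real (Suc n)) \<partial>M)"
    proof (intro nn_integral_mono ennreal_leI)
      fix \<omega>
      \<comment> \<open>Cauchy-Schwarz: the square of an average is at most the average of the
        squares, which avoids the covariances of the overlapping increments.\<close>
      have "(\<Sum>i<Suc n. ?U n i \<omega>)\<^sup>2 \<le> (\<Sum>i<Suc n. (?U n i \<omega>)\<^sup>2) * real (card {..<Suc n})"
        by (rule sum_squared_le_sum_of_squares)
      then show "((\<Sum>i<Suc n. ?U n i \<omega>) / real (Suc n))\<^sup>2 \<le> (\<Sum>i<Suc n. (?U n i \<omega>)\<^sup>2) / real (Suc n)"
        by (simp add: power_divide pos_divide_le_eq power2_eq_square[of "real (Suc n)"] del: sum.lessThan_Suc of_nat_Suc)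
    qed
    also have "\<dots> = ennreal ((\<Sum>i<Suc n. m 2 (t - real i * t / real (Suc n)) - 2 * m 1 (t - real i * t / real (Suc n)) + 1) / real (Suc n))"
    proof -
      have "has_bochner_integral M (\<lambda>\<omega>. (\<Sum>i<Suc n. (?U n i \<omega>)\<^sup>2) / real (Suc n))
          ((\<Sum>i<Suc n. m 2 (t - real i * t / real (Suc n)) - 2 * m 1 (t - real i * t / real (Suc n)) + 1) / real (Suc n))"
        using ti by (intro has_bochner_integral_divide_zero has_bochner_integral_sum increment_variation) auto
      then show ?thesis
        by (subst nn_integral_eq_integral)
          (auto simp: has_bochner_integral_iff simp del: sum.lessThan_Suc intro!: divide_nonneg_nonneg sum_nonneg)
    qed
    also have "\<dots> \<le> ennreal ((\<Sum>i<Suc n. e) / real (Suc n))"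
      using ti by (intro ennreal_leI divide_right_mono sum_mono e) auto
    also have "(\<Sum>i<Suc n. e) / real (Suc n) = e"
      by (simp del: sum.lessThan_Suc of_nat_Suc)
    finally show ?thesis .
  qed
  have "(\<integral>\<^sup>+\<omega>. ennreal ((\<xi> t \<omega> / t - 1)\<^sup>2) \<partial>M)
      = (\<integral>\<^sup>+\<omega>. liminf (\<lambda>n. ennreal (((\<Sum>i<Suc n. ?U n i \<omega>) / real (Suc n))\<^sup>2)) \<partial>M)"
  proof (rule nn_integral_cong)
    fix \<omega> assume "\<omega> \<in> space M"
    then have "(\<lambda>n. ennreal (((\<Sum>i<Suc n. ?U n i \<omega>) / real (Suc n))\<^sup>2)) \<longlonglongrightarrow> ennreal ((\<xi> t \<omega> / t - 1)\<^sup>2)"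
      by (intro tendsto_ennrealI tendsto_power lim)
    then show "ennreal ((\<xi> t \<omega> / t - 1)\<^sup>2) = liminf (\<lambda>n. ennreal (((\<Sum>i<Suc n. ?U n i \<omega>) / real (Suc n))\<^sup>2))"
      by (rule lim_imp_Liminf[OF trivial_limit_sequentially, symmetric])
  qed
  \<comment> \<open>Fatou's lemma passes from the Riemann sums to the integral and yields finiteness
    of the second moment along with the bound.\<close>
  also have "\<dots> \<le> liminf (\<lambda>n. \<integral>\<^sup>+\<omega>. ennreal (((\<Sum>i<Suc n. ?U n i \<omega>) / real (Suc n))\<^sup>2) \<partial>M)"
    using sm by (intro nn_integral_liminf) simp
  also have "\<dots> \<le> liminf (\<lambda>n::nat. ennreal e)"
    using bound by (intro Liminf_mono always_eventually allI)
  also have "\<dots> = ennreal e"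
    by (simp add: Liminf_const)
  finally have le: "(\<integral>\<^sup>+\<omega>. ennreal ((\<xi> t \<omega> / t - 1)\<^sup>2) \<partial>M) \<le> ennreal e" .
  have [measurable]: "\<xi> t \<in> borel_measurable M"
    using xi_measurable_M t by simp
  show int: "integrable M (\<lambda>\<omega>. (\<xi> t \<omega> / t - 1)\<^sup>2)"
    using le by (intro integrableI_nonneg) (auto simp: top_unique[symmetric] less_top intro: le_less_trans)
  show "expectation (\<lambda>\<omega>. (\<xi> t \<omega> / t - 1)\<^sup>2) \<le> e"
    using le e0 nn_integral_eq_integral[OF int] by (simp add: ennreal_le_iff)
qed

lemma continuous_variation: "continuous_on S (\<lambda>u. m 2 u - 2 * m 1 u + 1)"
  unfolding m_def by (intro continuous_intros)

lemma integrable_xi_average: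
  assumes "0 < t"
  shows "integrable M (\<lambda>\<omega>. (\<xi> t \<omega> / t - 1)\<^sup>2)"
proof -
  obtain u where "\<forall>v\<in>{0..t}. m 2 v - 2 * m 1 v + 1 \<le> m 2 u - 2 * m 1 u + 1"
    using continuous_attains_sup[OF _ _ continuous_variation, of "{0..t}"] assms by auto
  then show ?thesis by (intro xi_average(1)[OF assms, of "m 2 u - 2 * m 1 u + 1"]) (simp only: atLeastAtMost_iff)
qed

text \<open>The mean-square distance \<open>m 2 u - 2 * m 1 u + 1\<close> is continuous and vanishes
  at \<open>u = 0\<close>, so it is uniformly small on a short interval.\<close>

lemma xi_average_tendsto:
  "((\<lambda>t. expectation (\<lambda>\<omega>. (\<xi> t \<omega> / t - 1)\<^sup>2)) \<longlongrightarrow> 0) (at_right 0)"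
proof (rule tendstoI)
  fix e :: real assume e: "0 < e"
  have "isCont (\<lambda>u. m 2 u - 2 * m 1 u + 1) 0"
    using continuous_variation[of UNIV] by (simp add: continuous_on_eq_continuous_at)
  then have "\<exists>d>0. \<forall>u. \<bar>u\<bar> < d \<longrightarrow> \<bar>m 2 u - 2 * m 1 u + 1\<bar> < e'" if "0 < e'" for e'
    using that unfolding continuous_at_real_range by (simp add: m_def)
  then obtain d where d: "0 < d" "\<And>u. \<bar>u\<bar> < d \<Longrightarrow> \<bar>m 2 u - 2 * m 1 u + 1\<bar> < e / 2"
    using half_gt_zero[OF e] by blast
  have "\<forall>\<^sub>F t in at_right 0. 0 < t \<and> t < d"
    using d(1) by (auto simp: eventually_at_right_field)
  then show "\<forall>\<^sub>F t in at_right 0. dist (expectation (\<lambda>\<omega>. (\<xi> t \<omega> / t - 1)\<^sup>2)) 0 < e"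
  proof eventually_elim
    case (elim t)
    have "expectation (\<lambda>\<omega>. (\<xi> t \<omega> / t - 1)\<^sup>2) \<le> e / 2"
    proof (rule xi_average(2))
      fix u assume "0 \<le> u" "u \<le> t"
      then show "m 2 u - 2 * m 1 u + 1 \<le> e / 2"
        using elim abs_ge_self[of "m 2 u - 2 * m 1 u + 1"] d(2)[of u] by linarith
    qed (use elim in simp)
    moreover have "0 \<le> expectation (\<lambda>\<omega>. (\<xi> t \<omega> / t - 1)\<^sup>2)"
      by (intro integral_nonneg_AE) auto
    ultimately show ?case using e by (simp add: dist_real_def)
  qed
qed

end

section \<open>The Feller semigroup\<close>

text \<open>Compact subsets of the closed half-line may contain 0, so vanishing at infinity is a
  condition for large arguments only.\<close>

lemma C0_tail:
  fixes f :: "real \<Rightarrow> real"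
  assumes "f \<in> C0 {0..}" "0 < e"
  obtains k where "0 < k" "\<And>x. k < x \<Longrightarrow> \<bar>f x\<bar> < e"
proof -
  obtain K where K: "compact K" "K \<subseteq> {0..}" "\<forall>x\<in>{0..} - K. \<bar>f x\<bar> < e"
    using assms unfolding C0_def by blast
  obtain k where k: "0 < k" "\<forall>x\<in>K. norm x \<le> k"
    using compact_imp_bounded[OF K(1)] unfolding bounded_pos by blast
  have "\<bar>f x\<bar> < e" if "k < x" for x
    using K(3) k that by force
  with k(1) show ?thesis by (rule that)
qed

lemma C0I_tail:
  fixes f :: "real \<Rightarrow> real"
  assumes "continuous_on {0..} f" "\<And>e. 0 < e \<Longrightarrow> \<exists>k. \<forall>x>k. 0 \<le> x \<longrightarrow> \<bar>f x\<bar> < e"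
  shows "f \<in> C0 {0..}"
  unfolding C0_def
proof (intro CollectI conjI allI impI assms(1))
  fix e :: real assume "0 < e"
  then obtain k where "\<forall>x>k. 0 \<le> x \<longrightarrow> \<bar>f x\<bar> < e" using assms(2) by blast
  then show "\<exists>K. compact K \<and> K \<subseteq> {0..} \<and> (\<forall>x\<in>{0..} - K. \<bar>f x\<bar> < e)"
    by (intro exI[of _ "{0..k}"]) auto
qed

lemma C0_continuous: "f \<in> C0 S \<Longrightarrow> continuous_on S f"
  by (simp add: C0_def)

lemma C0_bounded:
  fixes f :: "real \<Rightarrow> real"
  assumes "f \<in> C0 {0..}"
  obtains N where "0 < N" "\<And>x. 0 \<le> x \<Longrightarrow> \<bar>f x\<bar> \<le> N"
proof -
  obtain k where k: "0 < k" "\<And>x. k < x \<Longrightarrow> \<bar>f x\<bar> < 1"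
    using C0_tail[OF assms, of 1] by auto
  have "compact (f ` {0..k})"
    by (intro compact_continuous_image continuous_on_subset[OF C0_continuous[OF assms]]) auto
  then obtain N where N: "0 < N" "\<forall>x\<in>f ` {0..k}. norm x \<le> N"
    using compact_imp_bounded bounded_pos by metis
  have "\<bar>f x\<bar> \<le> N + 1" if "0 \<le> x" for x
    using that N k(2)[of x] by (cases "x \<le> k") force+
  with N(1) show ?thesis by (intro that[of "N + 1"]) auto
qed

lemma C0_uniformly_continuous:
  fixes f :: "real \<Rightarrow> real"
  assumes f: "f \<in> C0 {0..}" and e: "0 < e"
  obtains d where "0 < d"
    "\<And>x y. 0 \<le> x \<Longrightarrow> 0 \<le> y \<Longrightarrow> \<bar>y - x\<bar> < d \<Longrightarrow> \<bar>f y - f x\<bar> < e"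
proof -
  obtain k where k: "0 < k" "\<And>x. k < x \<Longrightarrow> \<bar>f x\<bar> < e / 2"
    using C0_tail[OF f, of "e / 2"] e by auto
  have "uniformly_continuous_on {0..k + 1} f"
    by (intro compact_uniformly_continuous continuous_on_subset[OF C0_continuous[OF f]]) auto
  then obtain d where d: "0 < d"
    "\<And>x y. x \<in> {0..k + 1} \<Longrightarrow> y \<in> {0..k + 1} \<Longrightarrow> dist y x < d \<Longrightarrow> dist (f y) (f x) < e"
    using e unfolding uniformly_continuous_on_def by metis
  \<comment> \<open>Capping the radius at 1 ensures that two close points either both lie in the
    compact interval up to \<open>k + 1\<close> or both lie beyond \<open>k\<close>.\<close>
  have "\<bar>f y - f x\<bar> < e" if xy: "0 \<le> x" "0 \<le> y" "\<bar>y - x\<bar> < min d 1" for x y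
  proof (cases "x \<le> k + 1 \<and> y \<le> k + 1")
    case True
    then show ?thesis using d(2)[of x y] xy by (simp add: dist_real_def)
  next
    case False
    then have "k < x" "k < y" using xy by auto
    then show ?thesis using k(2)[of x] k(2)[of y] by linarith
  qed
  with d(1) show ?thesis by (intro that[of "min d 1"]) auto
qed

text \<open>The bound is uniform in \<open>x\<close> although the displacement
  \<open>(z - 1) * x\<close> is not. On a bounded range uniform continuity or Chebyshev-type
  domination applies; far out, \<open>f\<close> is small at both points unless
  \<open>z <= 1 / 2\<close>, and that event is paid for by \<open>(z - 1)^2\<close>.\<close>

lemma C0_perturbation_bound:
  fixes f :: "real \<Rightarrow> real"
  assumes f: "f \<in> C0 {0..}" and e: "0 < e"
  obtains C where "0 \<le> C"
    "\<And>x z w. 0 \<le> x \<Longrightarrow> 0 < z \<Longrightarrow> 0 \<le> w \<Longrightarrow> \<bar>f (z * x + w) - f x\<bar> \<le> e + C * ((z - 1)\<^sup>2 + w\<^sup>2)"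
proof -
  obtain N where N: "0 < N" "\<And>x. 0 \<le> x \<Longrightarrow> \<bar>f x\<bar> \<le> N" using C0_bounded[OF f] by blast
  obtain k where k: "0 < k" "\<And>x. k < x \<Longrightarrow> \<bar>f x\<bar> < e / 2" using C0_tail[OF f, of "e / 2"] e by auto
  obtain d where d: "0 < d" "\<And>x y. 0 \<le> x \<Longrightarrow> 0 \<le> y \<Longrightarrow> \<bar>y - x\<bar> < d \<Longrightarrow> \<bar>f y - f x\<bar> < e"
    using C0_uniformly_continuous[OF f e] by blast
  \<comment> \<open>A displacement of at least \<open>d\<close> costs at most \<open>2 * N\<close>,
    and for \<open>x <= 2 * k\<close> its square is at most
    \<open>(8 * k^2 + 2) * ((z - 1)^2 + w^2)\<close>. The 8 comes from
    \<open>2 * (2 * k)^2\<close>.\<close>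
  define D where "D = 2 * N / d\<^sup>2 * (8 * k\<^sup>2 + 2)"
  have D: "0 \<le> D" using N d by (simp add: D_def)
  have "\<bar>f (z * x + w) - f x\<bar> \<le> e + (D + 4 * N) * ((z - 1)\<^sup>2 + w\<^sup>2)"
    if xzw: "0 \<le> x" "0 < z" "0 \<le> w" for x z w
  proof -
    have y: "0 \<le> z * x + w" using xzw by simp
    have expand: "(D + 4 * N) * ((z - 1)\<^sup>2 + w\<^sup>2) = D * ((z - 1)\<^sup>2 + w\<^sup>2) + 4 * N * (z - 1)\<^sup>2 + 4 * N * w\<^sup>2"
      by (simp add: algebra_simps)
    have nn: "0 \<le> D * ((z - 1)\<^sup>2 + w\<^sup>2)" "0 \<le> 4 * N * (z - 1)\<^sup>2" "0 \<le> 4 * N * w\<^sup>2"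
      using D N by simp_all
    show ?thesis
    proof (cases "x \<le> 2 * k")
      case True
      show ?thesis
      proof (cases "\<bar>z * x + w - x\<bar> < d")
        case True
        then show ?thesis using d(2)[OF xzw(1) y] nn expand by linarith
      next
        case False
        then have "d\<^sup>2 \<le> \<bar>z * x + w - x\<bar>\<^sup>2" using d(1) by (intro power_mono) auto
        also have "\<bar>z * x + w - x\<bar>\<^sup>2 = ((z - 1) * x + w)\<^sup>2" by (simp add: algebra_simps)
        also have "\<dots> \<le> 2 * ((z - 1) * x)\<^sup>2 + 2 * w\<^sup>2"
          using sum_squares_ge_zero[of "(z - 1) * x - w" 0] by (simp add: power2_eq_square algebra_simps)
        also have "((z - 1) * x)\<^sup>2 \<le> (z - 1)\<^sup>2 * (2 * k)\<^sup>2"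
          unfolding power_mult_distrib[of "z - 1"] using True xzw by (intro mult_left_mono power_mono) auto
        finally have "d\<^sup>2 \<le> (8 * k\<^sup>2 + 2) * ((z - 1)\<^sup>2 + w\<^sup>2)"
          by (simp add: algebra_simps power_mult_distrib) (smt (verit) mult_nonneg_nonneg zero_le_power2)
        then have "2 * N / d\<^sup>2 * d\<^sup>2 \<le> 2 * N / d\<^sup>2 * ((8 * k\<^sup>2 + 2) * ((z - 1)\<^sup>2 + w\<^sup>2))"
          using N d by (intro mult_left_mono) auto
        then have "2 * N \<le> D * ((z - 1)\<^sup>2 + w\<^sup>2)" using d by (simp add: D_def mult.assoc)
        then show ?thesis using N(2)[OF xzw(1)] N(2)[OF y] nn expand e by linarith
      qed
    next
      case False
      then have fx: "\<bar>f x\<bar> < e / 2" using k by auto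
      show ?thesis
      proof (cases "z \<le> 1 / 2")
        \<comment> \<open>Here \<open>(z - 1)^2\<close> is at least \<open>1 / 4\<close>, which is
          where the summand \<open>4 * N\<close> of the final constant comes from.\<close>
        case True
        then have "(1 / 2)\<^sup>2 \<le> (1 - z)\<^sup>2" by (intro power_mono) auto
        then have "1 / 4 \<le> (z - 1)\<^sup>2" by (simp add: power2_commute[of 1 z] power_divide)
        from mult_left_mono[OF this, of "4 * N"] have "N \<le> 4 * N * (z - 1)\<^sup>2" using N(1) by simp
        then show ?thesis using fx N(2)[OF y] nn expand e by linarith
      next
        case False
        then have "1 / 2 * (2 * k) < z * x" using \<open>\<not> x \<le> 2 * k\<close> k(1) xzw
          by (intro mult_strict_mono) auto
        then have "\<bar>f (z * x + w)\<bar> < e / 2" using xzw by (intro k(2)) auto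
        then show ?thesis using fx nn expand e by linarith
      qed
    qed
  qed
  then show ?thesis using D N by (intro that[of "D + 4 * N"]) auto
qed

section \<open>The transition semigroup as the laws of the flow\<close>

context drifted_brownian_motion
begin

definition P :: "real \<Rightarrow> real \<Rightarrow> real measure" where
  "P t x = distr M (restrict_space borel {0..}) (\<Phi> t x)"

lemma xi_nonneg: "\<omega> \<in> space M \<Longrightarrow> 0 \<le> t \<Longrightarrow> 0 \<le> \<xi> t \<omega>"
  unfolding xi_eq_integral[OF B_continuous_Icc]
  by (intro mult_nonneg_nonneg Henstock_Kurzweil_Integration.integral_nonneg integrable_continuous_interval
      continuous_intros continuous_on_with_drift B_continuous_Icc) auto

lemma flow_nonneg: "\<omega> \<in> space M \<Longrightarrow> 0 \<le> t \<Longrightarrow> 0 \<le> x \<Longrightarrow> 0 \<le> \<Phi> t x \<omega>"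
  unfolding flow_def by (simp add: xi_nonneg)

lemma flow_measurable_halfline:
  assumes "0 \<le> t" "0 \<le> x"
  shows "\<Phi> t x \<in> measurable M (restrict_space borel {0..})"
  using assms by (intro measurable_restrict_space2 flow_measurable_M) (auto simp: flow_nonneg)

lemma P_kernel:
  assumes "0 \<le> t"
  shows "P t \<in> restrict_space borel {0..} \<rightarrow>\<^sub>M prob_algebra (restrict_space borel {0..})"
proof -
  have "(\<lambda>x. distr M (restrict_space borel {0..}) (\<Phi> t x))
      \<in> restrict_space borel {0..} \<rightarrow>\<^sub>M prob_algebra (restrict_space borel {0..})"
  proof (rule measurable_distr_prob_space2[where g="\<lambda>_. M" and M=M])
    show "(\<lambda>_. M) \<in> restrict_space borel {0..} \<rightarrow>\<^sub>M prob_algebra M"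
      by (simp add: space_prob_algebra prob_space_axioms)
    have "(\<lambda>p. (fst p, snd p)) \<in> restrict_space borel {0::real..} \<Otimes>\<^sub>M M \<rightarrow>\<^sub>M borel \<Otimes>\<^sub>M M"
      by (intro measurable_Pair measurable_compose[OF measurable_fst] measurable_restrict_space1) auto
    from measurable_compose[OF this flow_measurable_pair[OF assms]]
    have "(\<lambda>(x, \<omega>). \<Phi> t x \<omega>) \<in> borel_measurable (restrict_space borel {0..} \<Otimes>\<^sub>M M)"
      by (simp add: case_prod_beta)
    then show "(\<lambda>(x, \<omega>). \<Phi> t x \<omega>) \<in> restrict_space borel {0..} \<Otimes>\<^sub>M M \<rightarrow>\<^sub>M restrict_space borel {0..}"
      using assms by (intro measurable_restrict_space2)
        (auto simp: space_pair_measure flow_nonneg)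
  qed
  then show ?thesis by (simp add: P_def[abs_def])
qed

lemma integral_P:
  fixes f :: "real \<Rightarrow> real"
  assumes "f \<in> borel_measurable (restrict_space borel {0..})" "0 \<le> t" "0 \<le> x"
  shows "(\<integral>y. f y \<partial>P t x) = expectation (\<lambda>\<omega>. f (\<Phi> t x \<omega>))"
  unfolding P_def using assms by (intro integral_distr flow_measurable_halfline) auto

lemma P_0:
  assumes "x \<in> {0..}"
  shows "P 0 x = return (restrict_space borel {0..}) x"
proof -
  have "P 0 x = distr M (restrict_space borel {0..}) (\<lambda>_. x)"
    unfolding P_def by (intro distr_cong) (auto simp: B_0)
  also have "\<dots> = return (restrict_space borel {0..}) x"
    using assms by (intro distr_const) (auto simp: space_restrict_space)
  finally show ?thesis .
qed

text \<open>The cocycle identity splits the path at time \<open>s\<close>. Integrating the later map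
  out is the Markov formula for the full event and the starting point
  \<open>\<Phi> s x\<close>.\<close>

lemma P_semigroup:
  assumes st: "0 \<le> s" "0 \<le> t" and x: "x \<in> {0..}"
  shows "P (s + t) x = P s x \<bind> P t"
proof (rule measure_eqI)
  let ?S = "restrict_space borel {0::real..}"
  have sets_P: "sets (P u y) = sets ?S" for u y by (simp add: P_def)
  have space_P: "space (P u y) = {0..}" for u y by (simp add: P_def space_restrict_space)
  have kern: "P t \<in> P s x \<rightarrow>\<^sub>M subprob_algebra ?S"
    using measurable_prob_algebraD[OF P_kernel[OF st(2)]] measurable_cong_sets[OF sets_P refl] by blast
  show "sets (P (s + t) x) = sets (P s x \<bind> P t)"
    using sets_bind[of "P s x" "P t" ?S] sets_P space_P by auto
  fix A assume "A \<in> sets (P (s + t) x)"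
  then have A: "A \<in> sets ?S" using sets_P by simp
  then have [measurable]: "A \<in> sets borel" by (auto simp: sets_restrict_space)
  have em: "emeasure (P u y) A = (\<integral>\<^sup>+\<omega>. indicator A (\<Phi> u y \<omega>) \<partial>M)" if "0 \<le> u" "0 \<le> y" for u y
  proof -
    have "emeasure (P u y) A = (\<integral>\<^sup>+z. indicator A z \<partial>P u y)"
      using A sets_P by simp
    also have "\<dots> = (\<integral>\<^sup>+\<omega>. indicator A (\<Phi> u y \<omega>) \<partial>M)"
      unfolding P_def using A that by (intro nn_integral_distr flow_measurable_halfline) auto
    finally show ?thesis .
  qed
  have "emeasure (P s x \<bind> P t) A = (\<integral>\<^sup>+y. emeasure (P t y) A \<partial>P s x)"
    using space_P A by (intro emeasure_bind[OF _ kern]) auto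
  also have "\<dots> = (\<integral>\<^sup>+\<omega>. emeasure (P t (\<Phi> s x \<omega>)) A \<partial>M)"
    unfolding P_def[of s x] using st x A P_kernel[OF st(2)]
    by (intro nn_integral_distr flow_measurable_halfline measurable_emeasure_kernel[where N="?S"]
        measurable_prob_algebraD) auto
  also have "\<dots> = (\<integral>\<^sup>+\<omega>. indicator (space M) \<omega> * (\<integral>\<^sup>+\<omega>'. indicator A (\<Phi> t (\<Phi> s x \<omega>) \<omega>') \<partial>M) \<partial>M)"
    using st x by (intro nn_integral_cong) (simp add: em flow_nonneg)
  also have "\<dots> = (\<integral>\<^sup>+\<omega>. indicator (space M) \<omega> * indicator A (flow (shifted B s) \<mu> t (\<Phi> s x \<omega>) \<omega>) \<partial>M)"
    using st sets.top[of "F (ennreal s)"]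
    by (intro markov_nn_integral[symmetric] flow_measurable_F) (auto simp: space_natural_filtration)
  also have "\<dots> = (\<integral>\<^sup>+\<omega>. indicator A (\<Phi> (s + t) x \<omega>) \<partial>M)"
    using st by (intro nn_integral_cong) (simp add: flow_shifted B_continuous)
  also have "\<dots> = emeasure (P (s + t) x) A"
    using st x by (simp add: em)
  finally show "emeasure (P (s + t) x) A = emeasure (P s x \<bind> P t) A" ..
qed

lemma P_bounded_continuous:
  fixes f :: "real \<Rightarrow> real"
  assumes f: "continuous_on {0..} f" and N: "\<And>x. 0 \<le> x \<Longrightarrow> \<bar>f x\<bar> \<le> N" and t: "0 \<le> t"
  shows "continuous_on {0..} (\<lambda>x. \<integral>y. f y \<partial>P t x)"
proof (rule continuous_on_sequentiallyI)
  fix u a assume u: "\<forall>n. u n \<in> {0..}" "a \<in> {0..}" "u \<longlonglongrightarrow> (a::real)"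
  have fm: "f \<in> borel_measurable (restrict_space borel {0..})"
    by (rule borel_measurable_continuous_on_restrict[OF f])
  have fl: "(\<lambda>\<omega>. f (\<Phi> t y \<omega>)) \<in> borel_measurable M" if "0 \<le> y" for y
    using measurable_compose[OF flow_measurable_halfline[OF t that] fm] .
  have "(\<lambda>n. expectation (\<lambda>\<omega>. f (\<Phi> t (u n) \<omega>))) \<longlonglongrightarrow> expectation (\<lambda>\<omega>. f (\<Phi> t a \<omega>))"
  proof (rule integral_dominated_convergence[where w="\<lambda>_. N"])
    show "AE \<omega> in M. (\<lambda>n. f (\<Phi> t (u n) \<omega>)) \<longlonglongrightarrow> f (\<Phi> t a \<omega>)"
    proof (rule AE_I2)
      fix \<omega> assume \<omega>: "\<omega> \<in> space M"
      have "(\<lambda>n. \<Phi> t (u n) \<omega>) \<longlonglongrightarrow> \<Phi> t a \<omega>"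
        unfolding flow_def by (intro tendsto_intros u)
      then show "(\<lambda>n. f (\<Phi> t (u n) \<omega>)) \<longlonglongrightarrow> f (\<Phi> t a \<omega>)"
        using u \<omega> t by (intro continuous_on_tendsto_compose[OF f]) (auto simp: flow_nonneg)
    qed
    show "AE \<omega> in M. norm (f (\<Phi> t (u n) \<omega>)) \<le> N" for n
      using u t by (intro AE_I2) (auto intro!: N flow_nonneg)
  qed (use u fl in auto)
  then show "(\<lambda>n. \<integral>y. f y \<partial>P t (u n)) \<longlonglongrightarrow> (\<integral>y. f y \<partial>P t a)"
    using u t by (simp add: integral_P[OF fm])
qed

text \<open>For each path the slope \<open>Z t\<close> is positive and the intercept nonnegative, so
  the image of \<open>x\<close> tends to infinity with \<open>x\<close>; dominated convergence then
  makes the expectation vanish.\<close>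

lemma P_C0:
  assumes f: "f \<in> C0 {0..}" and t: "0 \<le> t"
  shows "(\<lambda>x. \<integral>y. f y \<partial>P t x) \<in> C0 {0..}"
proof -
  obtain N where N: "0 < N" "\<And>x. 0 \<le> x \<Longrightarrow> \<bar>f x\<bar> \<le> N" using C0_bounded[OF f] by blast
  have fm: "f \<in> borel_measurable (restrict_space borel {0..})"
    by (rule borel_measurable_continuous_on_restrict[OF C0_continuous[OF f]])
  have fl: "(\<lambda>\<omega>. f (\<Phi> t y \<omega>)) \<in> borel_measurable M" if "0 \<le> y" for y
    using measurable_compose[OF flow_measurable_halfline[OF t that] fm] .
  \<comment> \<open>The limit theorem ranges over all real \<open>x\<close>; \<open>max 0 x\<close>
    keeps the starting point in the half-line without affecting the limit.\<close>
  have "((\<lambda>x. expectation (\<lambda>\<omega>. f (\<Phi> t (max 0 x) \<omega>))) \<longlongrightarrow> expectation (\<lambda>\<omega>. 0)) at_top"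
  proof (rule integral_dominated_convergence_at_top[where w="\<lambda>_. N"])
    show "AE \<omega> in M. ((\<lambda>x. f (\<Phi> t (max 0 x) \<omega>)) \<longlongrightarrow> 0) at_top"
    proof (rule AE_I2)
      fix \<omega> assume \<omega>: "\<omega> \<in> space M"
      show "((\<lambda>x. f (\<Phi> t (max 0 x) \<omega>)) \<longlongrightarrow> 0) at_top"
      proof (rule tendstoI)
        fix e :: real assume "0 < e"
        then obtain k where k: "0 < k" "\<And>x. k < x \<Longrightarrow> \<bar>f x\<bar> < e" using C0_tail[OF f] by blast
        have "\<forall>\<^sub>F x in at_top. k / Z t \<omega> < x" by (rule eventually_gt_at_top)
        then show "\<forall>\<^sub>F x in at_top. dist (f (\<Phi> t (max 0 x) \<omega>)) 0 < e"
        proof eventually_elim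
          case (elim x)
          have "0 < x" using elim k(1) by (meson divide_pos_pos exp_gt_zero less_trans)
          moreover have "k < Z t \<omega> * x" using elim by (simp add: pos_divide_less_eq mult.commute)
          ultimately show ?case
            using k(2)[of "\<Phi> t (max 0 x) \<omega>"] xi_nonneg[OF \<omega> t] by (simp add: flow_def)
        qed
      qed
    qed
    show "\<forall>\<^sub>F x in at_top. AE \<omega> in M. norm (f (\<Phi> t (max 0 x) \<omega>)) \<le> N"
      using t by (intro always_eventually allI AE_I2) (auto intro!: N flow_nonneg)
  qed (use fl in auto)
  then have lim: "((\<lambda>x. expectation (\<lambda>\<omega>. f (\<Phi> t (max 0 x) \<omega>))) \<longlongrightarrow> 0) at_top" by simp
  show ?thesis
  proof (rule C0I_tail[OF P_bounded_continuous[OF C0_continuous[OF f] N(2) t]])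
    fix e :: real assume "0 < e"
    then obtain k where k: "\<forall>x\<ge>k. dist (expectation (\<lambda>\<omega>. f (\<Phi> t (max 0 x) \<omega>))) 0 < e"
      using tendstoD[OF lim] unfolding eventually_at_top_linorder by blast
    show "\<exists>k. \<forall>x>k. 0 \<le> x \<longrightarrow> \<bar>\<integral>y. f y \<partial>P t x\<bar> < e"
    proof (intro exI allI impI)
      fix x :: real assume x: "k < x" "0 \<le> x"
      then show "\<bar>\<integral>y. f y \<partial>P t x\<bar> < e"
        using k[rule_format, of x] t by (simp add: integral_P[OF fm])
    qed
  qed
qed

text \<open>The inequality for the quotient is \<open>(\<zeta> - 2)^2 >= 0\<close> rearranged. It
  bounds the square of the intercept by \<open>t^2\<close> times a quantity with bounded expectation
  for small \<open>t\<close>.\<close>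

lemma xi_sq_le:
  assumes "0 < t"
  shows "(\<xi> t \<omega>)\<^sup>2 \<le> 2 * t\<^sup>2 * (1 + (\<xi> t \<omega> / t - 1)\<^sup>2)"
proof -
  define \<zeta> where "\<zeta> = \<xi> t \<omega> / t"
  have "\<xi> t \<omega> = t * \<zeta>" using assms by (simp add: \<zeta>_def)
  moreover have "\<zeta>\<^sup>2 \<le> 2 * (1 + (\<zeta> - 1)\<^sup>2)"
    using zero_le_power2[of "\<zeta> - 2"] by (simp add: power2_eq_square algebra_simps)
  ultimately show ?thesis
    unfolding \<zeta>_def[symmetric] using mult_left_mono[of "\<zeta>\<^sup>2" "2 * (1 + (\<zeta> - 1)\<^sup>2)" "t\<^sup>2"]
    by (simp only: power_mult_distrib mult.left_commute mult.assoc zero_le_power2)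
qed

lemma has_bochner_integral_prob_const: "has_bochner_integral M (\<lambda>_. c) (c :: real)"
  by (simp add: has_bochner_integral_iff prob_space)

text \<open>Take expectations in the perturbation bound with the random slope and intercept of the
  flow: the result no longer contains \<open>x\<close>.\<close>

lemma P_uniform_limit:
  assumes f: "f \<in> C0 {0..}"
  shows "uniform_limit {0..} (\<lambda>t x. \<integral>y. f y \<partial>P t x) f (at_right 0)"
proof (rule uniform_limitI)
  fix e :: real assume e: "0 < e"
  obtain C where C: "0 \<le> C" "\<And>x z w. 0 \<le> x \<Longrightarrow> 0 < z \<Longrightarrow> 0 \<le> w \<Longrightarrow>
      \<bar>f (z * x + w) - f x\<bar> \<le> e / 2 + C * ((z - 1)\<^sup>2 + w\<^sup>2)"
    using C0_perturbation_bound[OF f, of "e / 2"] e by auto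
  obtain N where N: "0 < N" "\<And>x. 0 \<le> x \<Longrightarrow> \<bar>f x\<bar> \<le> N" using C0_bounded[OF f] by blast
  have fm: "f \<in> borel_measurable (restrict_space borel {0..})"
    by (rule borel_measurable_continuous_on_restrict[OF C0_continuous[OF f]])
  \<comment> \<open>The expectations are written as multiples of the quotients whose limits are
    known; \<open>G\<close> then tends to \<open>e / 2\<close>.\<close>
  define G where "G t = e / 2 + C * (t * (expectation (\<lambda>\<omega>. (Z t \<omega> - 1)\<^sup>2) / t)
      + 2 * t\<^sup>2 * (1 + expectation (\<lambda>\<omega>. (\<xi> t \<omega> / t - 1)\<^sup>2)))" for t
  have "(G \<longlongrightarrow> e / 2 + C * (0 * 4 + 2 * 0\<^sup>2 * (1 + 0))) (at_right 0)"
    unfolding G_def by (intro tendsto_intros Z_minus_1_tendsto xi_average_tendsto)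
  then have "\<forall>\<^sub>F t in at_right 0. G t < e"
    by (rule order_tendstoD(2)) (use e in simp)
  moreover have "\<forall>\<^sub>F t in at_right 0. (0::real) < t" by (simp add: eventually_at_right_less)
  ultimately show "\<forall>\<^sub>F t in at_right 0. \<forall>x\<in>{0..}. dist (\<integral>y. f y \<partial>P t x) (f x) < e"
  proof eventually_elim
    case (elim t)
    then have t: "0 < t" by simp
    show ?case
    proof
      fix x :: real assume "x \<in> {0..}"
      then have x: "0 \<le> x" by simp
      have fl[measurable]: "(\<lambda>\<omega>. f (\<Phi> t x \<omega>)) \<in> borel_measurable M"
        using measurable_compose[OF flow_measurable_halfline[OF _ x] fm] t by simp
      have int: "integrable M (\<lambda>\<omega>. f (\<Phi> t x \<omega>))"
        using t x by (intro integrable_const_bound[of _ N]) (auto intro!: N flow_nonneg)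
      let ?R = "\<lambda>\<omega>. e / 2 + C * ((Z t \<omega> - 1)\<^sup>2 + 2 * t\<^sup>2 * (1 + (\<xi> t \<omega> / t - 1)\<^sup>2))"
      have Zi: "integrable M (\<lambda>\<omega>. (Z t \<omega> - 1)\<^sup>2)"
        using Z_minus_1(2)[of t] t by (simp only: has_bochner_integral_iff less_imp_le)
      have "dist (\<integral>y. f y \<partial>P t x) (f x) = \<bar>expectation (\<lambda>\<omega>. f (\<Phi> t x \<omega>) - f x)\<bar>"
        using t x int by (simp add: integral_P[OF fm] dist_real_def prob_space)
      also have "\<dots> \<le> expectation (\<lambda>\<omega>. \<bar>f (\<Phi> t x \<omega>) - f x\<bar>)"
        by (rule integral_abs_bound)
      also have "\<dots> \<le> expectation ?R"
      proof (rule integral_mono)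
        show "integrable M (\<lambda>\<omega>. \<bar>f (\<Phi> t x \<omega>) - f x\<bar>)" using int by simp
        show "integrable M ?R"
          by (intro Bochner_Integration.integrable_add integrable_mult_right integrable_const Zi
              integrable_xi_average t)
        fix \<omega> assume \<omega>: "\<omega> \<in> space M"
        have "\<bar>f (\<Phi> t x \<omega>) - f x\<bar> \<le> e / 2 + C * ((Z t \<omega> - 1)\<^sup>2 + (\<xi> t \<omega>)\<^sup>2)"
          unfolding flow_def using x t \<omega> by (intro C(2)) (auto simp: xi_nonneg)
        also have "\<dots> \<le> ?R \<omega>"
          using C(1) xi_sq_le[OF t, of \<omega>] by (intro add_left_mono mult_left_mono) auto
        finally show "\<bar>f (\<Phi> t x \<omega>) - f x\<bar> \<le> ?R \<omega>" .
      qed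
      also have "\<dots> = G t"
      proof -
        have "has_bochner_integral M ?R (e / 2 + C * (expectation (\<lambda>\<omega>. (Z t \<omega> - 1)\<^sup>2)
            + 2 * t\<^sup>2 * (1 + expectation (\<lambda>\<omega>. (\<xi> t \<omega> / t - 1)\<^sup>2))))"
          by (intro has_bochner_integral_add has_bochner_integral_mult_right
              has_bochner_integral_prob_const has_bochner_integral_integrable Zi integrable_xi_average t)
        then show ?thesis
          unfolding G_def using t by (simp add: has_bochner_integral_integral_eq)
      qed
      finally show "dist (\<integral>y. f y \<partial>P t x) (f x) < e" using elim by simp
    qed
  qed
qed

lemma feller: "feller_semigroup {0..} P"
  unfolding feller_semigroup_def
  using P_kernel P_0 P_semigroup P_C0 P_uniform_limit by blast

end

section \<open>The generator\<close>

text \<open>A point beyond \<open>k\<close> is interior to the half-line and has a neighbourhood on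
  which \<open>f\<close> vanishes. Applied twice, this carries compact support over to
  \<open>f'\<close> and \<open>f''\<close>.\<close>

lemma has_real_derivative_halfline_zero:
  assumes "(f has_real_derivative c) (at x within {0..})" "0 \<le> k" "k < x" "\<And>y. k < y \<Longrightarrow> f y = 0"
  shows "c = 0"
proof -
  have "at x within {0..} = at x"
    using assms by (intro at_within_interior) (simp add: interior_real_atLeast)
  then have "(f has_real_derivative c) (at x)" using assms(1) by simp
  then have "((\<lambda>_. 0) has_real_derivative c) (at x)"
    by (rule has_field_derivative_transform_within_open[where S="{k<..}"]) (use assms in auto)
  then show ?thesis using DERIV_unique DERIV_const by blast
qed

lemma Cc2_props:
  assumes "Cc2 {0..} f f' f''"
  obtains k where "0 < k" "\<And>x. k < x \<Longrightarrow> f x = 0" "\<And>x. k < x \<Longrightarrow> f' x = 0" "\<And>x. k < x \<Longrightarrow> f'' x = 0"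
    "f \<in> C0 {0..}" "f' \<in> C0 {0..}" "f'' \<in> C0 {0..}"
proof -
  have d: "(f has_real_derivative f' x) (at x within {0..})" "(f' has_real_derivative f'' x) (at x within {0..})"
    if "0 \<le> x" for x
    using assms that unfolding Cc2_def by auto
  obtain K where K: "compact K" "K \<subseteq> {0..}" "\<forall>x\<in>{0..} - K. f x = 0"
    using assms unfolding Cc2_def by blast
  obtain k where k: "0 < k" "\<forall>x\<in>K. norm x \<le> k"
    using compact_imp_bounded[OF K(1)] unfolding bounded_pos by blast
  have f0: "f x = 0" if "k < x" for x using K(3) k that by force
  have f'0: "f' x = 0" if "k < x" for x
    using has_real_derivative_halfline_zero[OF d(1)[of x] _ that f0] k that by simp
  have f''0: "f'' x = 0" if "k < x" for x
    using has_real_derivative_halfline_zero[OF d(2)[of x] _ that f'0] k that by simp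
  have c: "continuous_on {0..} f" "continuous_on {0..} f'"
    using d by (auto intro!: DERIV_continuous_on)
  have c'': "continuous_on {0..} f''" using assms unfolding Cc2_def by blast
  have C0: "g \<in> C0 {0..}" if "continuous_on {0..} g" "\<And>x. k < x \<Longrightarrow> g x = 0" for g
    using that by (intro C0I_tail) (auto intro!: exI[of _ k])
  show ?thesis
    using that k(1) f0 f'0 f''0 C0[OF c(1) f0] C0[OF c(2) f'0] C0[OF c'' f''0] by blast
qed

section \<open>Taylor estimates up to the boundary of the half-line\<close>

lemma halfline_mvt_bound:
  assumes d: "\<And>x. 0 \<le> x \<Longrightarrow> (h has_real_derivative h' x) (at x within {0..})"
    and xy: "0 \<le> x" "0 \<le> y"
    and b: "\<And>s. 0 \<le> s \<Longrightarrow> min x y \<le> s \<Longrightarrow> s \<le> max x y \<Longrightarrow> \<bar>h' s\<bar> \<le> E"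
  shows "\<bar>h y - h x\<bar> \<le> E * \<bar>y - x\<bar>"
proof -
  have "norm (h y - h x) \<le> E * norm (y - x)"
  proof (rule field_differentiable_bound[where S="{min x y..max x y}"])
    fix s assume s: "s \<in> {min x y..max x y}"
    then show "(h has_field_derivative h' s) (at s within {min x y..max x y})"
      using xy by (intro has_field_derivative_subset[OF d]) auto
    show "norm (h' s) \<le> E" using s xy by (auto intro!: b)
  qed (use xy in auto)
  then show ?thesis by simp
qed

text \<open>Two mean value estimates: one for \<open>f\<close> minus its second-order polynomial,
  and inside it one for the derivative of that difference. Only the oscillation of
  \<open>f''\<close> within distance \<open>\<bar>y - x\<bar>\<close> of \<open>x\<close>
  enters.\<close>

lemma halfline_taylor2:
  assumes d: "\<And>x. 0 \<le> x \<Longrightarrow> (f has_real_derivative f' x) (at x within {0..})"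
    "\<And>x. 0 \<le> x \<Longrightarrow> (f' has_real_derivative f'' x) (at x within {0..})"
    and xy: "0 \<le> x" "0 \<le> y"
    and E: "\<And>s. 0 \<le> s \<Longrightarrow> \<bar>s - x\<bar> \<le> \<bar>y - x\<bar> \<Longrightarrow> \<bar>f'' s - f'' x\<bar> \<le> E"
  shows "\<bar>f y - f x - f' x * (y - x) - f'' x * (y - x)\<^sup>2 / 2\<bar> \<le> E * (y - x)\<^sup>2"
proof -
  have E0: "0 \<le> E" using E[of x] xy by auto
  have "\<bar>(f y - f' x * (y - x) - f'' x * (y - x)\<^sup>2 / 2) - (f x - f' x * (x - x) - f'' x * (x - x)\<^sup>2 / 2)\<bar>
      \<le> (E * \<bar>y - x\<bar>) * \<bar>y - x\<bar>"
  proof (rule halfline_mvt_bound[where h'="\<lambda>s. f' s - f' x - f'' x * (s - x)"])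
    fix s :: real assume s: "0 \<le> s" "min x y \<le> s" "s \<le> max x y"
    then have sx: "\<bar>s - x\<bar> \<le> \<bar>y - x\<bar>" by linarith
    have "\<bar>(f' s - f'' x * (s - x)) - (f' x - f'' x * (x - x))\<bar> \<le> E * \<bar>s - x\<bar>"
    proof (rule halfline_mvt_bound[where h'="\<lambda>s. f'' s - f'' x"])
      fix u :: real assume "0 \<le> u" "min x s \<le> u" "u \<le> max x s"
      then show "\<bar>f'' u - f'' x\<bar> \<le> E" using sx by (intro E) linarith+
    qed (use xy s in \<open>auto intro!: derivative_eq_intros d\<close>)
    also have "\<dots> \<le> E * \<bar>y - x\<bar>" using sx E0 by (rule mult_left_mono)
    finally show "\<bar>f' s - f' x - f'' x * (s - x)\<bar> \<le> E * \<bar>y - x\<bar>" by (simp add: algebra_simps)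
  qed (use xy in \<open>auto intro!: derivative_eq_intros d simp: field_simps\<close>)
  moreover have "(E * \<bar>y - x\<bar>) * \<bar>y - x\<bar> = E * (y - x)\<^sup>2"
    by (simp add: mult.assoc power2_eq_square flip: abs_mult)
  ultimately show ?thesis by (simp add: algebra_simps)
qed

text \<open>First absolute moments are traded for second moments, which are the ones known. The
  price is an additive \<open>e\<close>, chosen small before \<open>t\<close> tends to 0.\<close>

lemma abs_le_add_square_div: "0 < e \<Longrightarrow> \<bar>u :: real\<bar> \<le> e + u\<^sup>2 / e"
proof -
  assume e: "0 < e"
  have "2 * \<bar>u\<bar> * e \<le> \<bar>u\<bar>\<^sup>2 + e\<^sup>2" by (rule sum_squares_bound)
  then have "\<bar>u\<bar> * e \<le> u\<^sup>2 + e\<^sup>2"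
    using zero_le_power2[of u] zero_le_power2[of e] unfolding power2_abs by linarith
  also have "\<dots> = (e + u\<^sup>2 / e) * e" using e by (simp add: power2_eq_square algebra_simps)
  finally have "\<bar>u\<bar> * e \<le> (e + u\<^sup>2 / e) * e" .
  then show ?thesis using e by simp
qed

text \<open>The affine perturbation \<open>x \<mapsto> z x + t \<zeta>\<close> stands for the flow over a short time \<open>t\<close>: the
  multiplicative noise \<open>z - 1\<close> is expanded to second order, the additive part \<open>t \<zeta>\<close> to first order.\<close>

lemma generator_remainder_bound:
  assumes f: "Cc2 {0..} f f' f''"
  obtains D where "0 \<le> D"
    "\<And>e. 0 < e \<Longrightarrow> \<exists>C\<ge>0. \<forall>x\<ge>0. \<forall>z>0. \<forall>\<zeta>\<ge>0. \<forall>t>0.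
       \<bar>f (z * x + t * \<zeta>) - f x - x * f' x * (z - 1) - x\<^sup>2 * f'' x / 2 * (z - 1)\<^sup>2 - t * f' x\<bar>
       \<le> D * e * ((z - 1)\<^sup>2 + t) + C * (z - 1) ^ 4
         + C * t * ((z - 1)\<^sup>2 + (\<zeta> - 1)\<^sup>2 + t * (1 + (\<zeta> - 1)\<^sup>2))"
proof -
  have d: "(f has_real_derivative f' x) (at x within {0..})" "(f' has_real_derivative f'' x) (at x within {0..})"
    if "0 \<le> x" for x
    using f that unfolding Cc2_def by auto
  obtain k where k: "0 < k" and k0: "\<And>x. k < x \<Longrightarrow> f x = 0" "\<And>x. k < x \<Longrightarrow> f' x = 0" "\<And>x. k < x \<Longrightarrow> f'' x = 0"
    and C0: "f \<in> C0 {0..}" "f' \<in> C0 {0..}" "f'' \<in> C0 {0..}"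
    using Cc2_props[OF f] by blast
  obtain N0 N2 where N0: "0 < N0" "\<And>x. 0 \<le> x \<Longrightarrow> \<bar>f x\<bar> \<le> N0"
    and N2: "0 < N2" "\<And>x. 0 \<le> x \<Longrightarrow> \<bar>f'' x\<bar> \<le> N2"
    using C0_bounded[OF C0(1)] C0_bounded[OF C0(3)] by metis
  obtain N1 where N1: "0 < N1" "\<And>x. 0 \<le> x \<Longrightarrow> \<bar>f' x\<bar> \<le> N1"
    using C0_bounded[OF C0(2)] by blast
  define N where "N = N0 + N1 + N2"
  have N: "0 < N" "\<And>x. 0 \<le> x \<Longrightarrow> \<bar>f x\<bar> \<le> N" "\<And>x. 0 \<le> x \<Longrightarrow> \<bar>f' x\<bar> \<le> N" "\<And>x. 0 \<le> x \<Longrightarrow> \<bar>f'' x\<bar> \<le> N"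
    subgoal using N0(1) N1(1) N2(1) by (simp add: N_def)
    subgoal for x using N0(2)[of x] N1(1) N2(1) by (simp add: N_def)
    subgoal for x using N1(2)[of x] N0(1) N2(1) by (simp add: N_def)
    subgoal for x using N2(2)[of x] N0(1) N1(1) by (simp add: N_def)
    done
  \<comment> \<open>\<open>4 * k^2\<close> bounds \<open>x^2\<close> in the Taylor term, and
    \<open>(2 * k + 1) * N\<close> collects the additive \<open>e\<close> from the estimates of
    \<open>\<bar>z - 1\<bar>\<close> and \<open>\<bar>\<zeta> - 1\<bar>\<close>. \<open>D\<close> is
    independent of \<open>e\<close>: it multiplies terms of order \<open>t\<close>, so a small
    \<open>e\<close> must control them, while \<open>C\<close> may blow up because its terms are
    o(t).\<close>
  define D where "D = 4 * k\<^sup>2 + (2 * k + 1) * N"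
  have "\<exists>C\<ge>0. \<forall>x\<ge>0. \<forall>z>0. \<forall>\<zeta>\<ge>0. \<forall>t>0.
       \<bar>f (z * x + t * \<zeta>) - f x - x * f' x * (z - 1) - x\<^sup>2 * f'' x / 2 * (z - 1)\<^sup>2 - t * f' x\<bar>
       \<le> D * e * ((z - 1)\<^sup>2 + t) + C * (z - 1) ^ 4
         + C * t * ((z - 1)\<^sup>2 + (\<zeta> - 1)\<^sup>2 + t * (1 + (\<zeta> - 1)\<^sup>2))" if e: "0 < e" for e
  proof -
    obtain \<delta> where \<delta>: "0 < \<delta>" "\<And>x y. 0 \<le> x \<Longrightarrow> 0 \<le> y \<Longrightarrow> \<bar>y - x\<bar> < \<delta> \<Longrightarrow> \<bar>f'' y - f'' x\<bar> < e"
      using C0_uniformly_continuous[OF C0(3) e] by blast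
    \<comment> \<open>For a displacement of at least \<open>\<delta>\<close> the crude Taylor error
      \<open>2 * N * (x * (z - 1))^2\<close> is multiplied by
      \<open>(x * (z - 1))^2 / \<delta>^2\<close>, which is at least 1. This yields a fourth power
      of \<open>z - 1\<close>, with \<open>16 * k^4\<close> bounding \<open>x^4\<close>.\<close>
    define A where "A = 2 * N / \<delta>\<^sup>2 * (16 * k ^ 4)"
    \<comment> \<open>The summands serve, in order, the large displacements, the case
      \<open>z <= 1 / 2\<close> far out, and the coefficients of \<open>p\<close>, \<open>q\<close>
      and \<open>t * (1 + q)\<close> in the additive part.\<close>
    define C where "C = A + 16 * N + 2 * k * N / e + 2 * k * N + N / e + 2 * N"
    have A0: "0 \<le> A" using N(1) \<delta>(1) k by (simp add: A_def)
    have C_ge: "A \<le> C" "16 * N \<le> C" "2 * k * N / e + 2 * k * N \<le> C" "2 * k * N + N / e \<le> C" "2 * N \<le> C" "0 \<le> C"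
      using A0 N(1) e k by (simp_all add: C_def)
    have "\<bar>f (z * x + t * \<zeta>) - f x - x * f' x * (z - 1) - x\<^sup>2 * f'' x / 2 * (z - 1)\<^sup>2 - t * f' x\<bar>
       \<le> D * e * ((z - 1)\<^sup>2 + t) + C * (z - 1) ^ 4
         + C * t * ((z - 1)\<^sup>2 + (\<zeta> - 1)\<^sup>2 + t * (1 + (\<zeta> - 1)\<^sup>2))"
      if xz: "0 \<le> x" "0 < z" "0 \<le> \<zeta>" "0 < t" for x z \<zeta> t
    proof -
      define p q where "p = (z - 1)\<^sup>2" and "q = (\<zeta> - 1)\<^sup>2"
      have pq: "0 \<le> p" "0 \<le> q" by (simp_all add: p_def q_def)
      have p4: "(z - 1) ^ 4 = p\<^sup>2" by (simp add: p_def)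
      have y: "0 \<le> z * x + t * \<zeta>" "0 \<le> z * x" using xz by simp_all
      have D0: "0 \<le> D" using k N(1) by (simp add: D_def)
      show ?thesis
      proof (cases "x \<le> 2 * k")
        case True
        have x2: "x\<^sup>2 \<le> 4 * k\<^sup>2" using power_mono[OF True xz(1), of 2] by (simp add: power_mult_distrib)
        have x4: "x ^ 4 \<le> 16 * k ^ 4" using power_mono[OF True xz(1), of 4] by (simp add: power_mult_distrib)
        have yx: "z * x - x = x * (z - 1)" by (simp add: algebra_simps)
        have "\<bar>f (z * x) - f x - f' x * (z * x - x) - f'' x * (z * x - x)\<^sup>2 / 2\<bar>
            \<le> 4 * k\<^sup>2 * e * p + A * p\<^sup>2"
        proof (cases "\<bar>z * x - x\<bar> < \<delta>")
          case True
          have "\<bar>f (z * x) - f x - f' x * (z * x - x) - f'' x * (z * x - x)\<^sup>2 / 2\<bar> \<le> e * (z * x - x)\<^sup>2"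
            using True xz y \<delta>(2)[of x]
            by (intro halfline_taylor2 d) (auto intro!: less_imp_le)
          also have "\<dots> = e * x\<^sup>2 * p" by (simp add: yx p_def power_mult_distrib)
          also have "\<dots> \<le> e * (4 * k\<^sup>2) * p"
            using x2 e pq by (intro mult_right_mono mult_left_mono) auto
          finally show ?thesis using A0 by (simp add: mult.commute mult.left_commute add_increasing2)
        next
          case False
          have "\<bar>f (z * x) - f x - f' x * (z * x - x) - f'' x * (z * x - x)\<^sup>2 / 2\<bar> \<le> (2 * N) * (z * x - x)\<^sup>2"
          proof (intro halfline_taylor2 d)
            fix s :: real assume "0 \<le> s"
            then show "\<bar>f'' s - f'' x\<bar> \<le> 2 * N" using N(4)[of s] N(4)[of x] xz by linarith
          qed (use xz y in auto)
          also have "\<dots> \<le> (2 * N / \<delta>\<^sup>2 * (z * x - x)\<^sup>2) * (z * x - x)\<^sup>2"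
          proof (rule mult_right_mono)
            have "\<delta>\<^sup>2 \<le> \<bar>z * x - x\<bar>\<^sup>2" using False \<delta>(1) by (intro power_mono) auto
            then have "2 * N / \<delta>\<^sup>2 * \<delta>\<^sup>2 \<le> 2 * N / \<delta>\<^sup>2 * (z * x - x)\<^sup>2"
              using N(1) by (intro mult_left_mono) auto
            then show "2 * N \<le> 2 * N / \<delta>\<^sup>2 * (z * x - x)\<^sup>2" using \<delta>(1) by simp
          qed simp
          also have "\<dots> = 2 * N / \<delta>\<^sup>2 * x ^ 4 * p\<^sup>2"
            unfolding yx p_def by (simp add: power_mult_distrib power2_eq_square power4_eq_xxxx)
          also have "\<dots> \<le> A * p\<^sup>2"
            unfolding A_def using x4 N(1) by (intro mult_right_mono mult_left_mono) auto
          finally show ?thesis using e pq by (simp add: add_increasing)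
        qed
        then have first: "\<bar>f (z * x) - f x - x * f' x * (z - 1) - x\<^sup>2 * f'' x / 2 * (z - 1)\<^sup>2\<bar>
            \<le> 4 * k\<^sup>2 * e * p + A * p\<^sup>2"
          unfolding yx power_mult_distrib by (simp add: mult.commute mult.left_commute)
        \<comment> \<open>The additive step from \<open>z * x\<close> is handled by the mean value
          estimate for \<open>f\<close> minus the linear function with slope \<open>f' x\<close>.
          Since \<open>f'\<close> is Lipschitz with constant \<open>N\<close>, its slope error is at
          most \<open>N\<close> times the distance from \<open>x\<close>.\<close>
        have "\<bar>(f (z * x + t * \<zeta>) - (z * x + t * \<zeta>) * f' x) - (f (z * x) - z * x * f' x)\<bar>
            \<le> (N * (x * \<bar>z - 1\<bar> + t * \<zeta>)) * \<bar>z * x + t * \<zeta> - z * x\<bar>"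
        proof (rule halfline_mvt_bound[where h'="\<lambda>s. f' s - f' x"])
          fix s :: real assume s: "0 \<le> s" "min (z * x) (z * x + t * \<zeta>) \<le> s" "s \<le> max (z * x) (z * x + t * \<zeta>)"
          have "\<bar>f' s - f' x\<bar> \<le> N * \<bar>s - x\<bar>"
            using xz s(1) by (intro halfline_mvt_bound[where h'=f''] d N)
          also have "\<bar>s - x\<bar> \<le> \<bar>z * x - x\<bar> + t * \<zeta>" using s xz by auto
          also have "\<bar>z * x - x\<bar> = x * \<bar>z - 1\<bar>" unfolding yx using xz by (simp add: abs_mult)
          finally show "\<bar>f' s - f' x\<bar> \<le> N * (x * \<bar>z - 1\<bar> + t * \<zeta>)" using N(1) by simp
        qed (use y in \<open>auto intro!: derivative_eq_intros d\<close>)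
        then have "\<bar>f (z * x + t * \<zeta>) - f (z * x) - t * \<zeta> * f' x\<bar> \<le> (N * (x * \<bar>z - 1\<bar> + t * \<zeta>)) * (t * \<zeta>)"
          using xz by (simp add: algebra_simps)
        moreover have "\<bar>t * \<zeta> * f' x - t * f' x\<bar> \<le> t * (\<bar>\<zeta> - 1\<bar> * N)"
        proof -
          have "\<bar>t * \<zeta> * f' x - t * f' x\<bar> = t * (\<bar>\<zeta> - 1\<bar> * \<bar>f' x\<bar>)"
            using xz(4) by (simp add: abs_mult[symmetric] right_diff_distrib left_diff_distrib
                abs_mult_pos[symmetric] flip: abs_mult_pos') (metis abs_mult abs_of_pos mult.assoc right_diff_distrib)
          then show ?thesis using N(3)[OF xz(1)] xz by (simp add: mult_left_mono)
        qed
        moreover have "(N * (x * \<bar>z - 1\<bar> + t * \<zeta>)) * (t * \<zeta>) = t * (N * x * (\<zeta> * \<bar>z - 1\<bar>) + N * t * \<zeta>\<^sup>2)"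
          by (simp add: algebra_simps power2_eq_square)
        ultimately have second: "\<bar>f (z * x + t * \<zeta>) - f (z * x) - t * f' x\<bar>
            \<le> t * (N * x * (\<zeta> * \<bar>z - 1\<bar>) + N * t * \<zeta>\<^sup>2 + \<bar>\<zeta> - 1\<bar> * N)"
          unfolding distrib_left by linarith
        have ap: "\<bar>z - 1\<bar> \<le> e + p / e" and aq: "\<bar>\<zeta> - 1\<bar> \<le> e + q / e"
          using e by (simp_all add: p_def q_def abs_le_add_square_div)
        \<comment> \<open>The product of both noises has no computed moment. Writing \<zeta> as 1
          plus its deviation splits it into a first-order term in \<open>z - 1\<close> and a product
          bounded by squares.\<close>
        have cross: "\<zeta> * \<bar>z - 1\<bar> \<le> e + p / e + p + q"
        proof -
          have "\<zeta> * \<bar>z - 1\<bar> \<le> (1 + \<bar>\<zeta> - 1\<bar>) * \<bar>z - 1\<bar>" by (intro mult_right_mono) auto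
          also have "\<dots> = \<bar>z - 1\<bar> + \<bar>\<zeta> - 1\<bar> * \<bar>z - 1\<bar>" by (simp add: algebra_simps)
          also have "\<bar>\<zeta> - 1\<bar> * \<bar>z - 1\<bar> \<le> p + q"
          proof -
            have "2 * (\<bar>\<zeta> - 1\<bar> * \<bar>z - 1\<bar>) \<le> q + p"
              using sum_squares_bound[of "\<bar>\<zeta> - 1\<bar>" "\<bar>z - 1\<bar>"] by (simp add: p_def q_def mult.assoc)
            moreover have "0 \<le> \<bar>\<zeta> - 1\<bar> * \<bar>z - 1\<bar>" by simp
            ultimately show ?thesis by linarith
          qed
          finally show ?thesis using ap by linarith
        qed
        have sq: "\<zeta>\<^sup>2 \<le> 2 * (1 + q)"
          using zero_le_power2[of "\<zeta> - 2"] by (simp add: q_def power2_eq_square algebra_simps)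
        have "N * x * (\<zeta> * \<bar>z - 1\<bar>) \<le> N * (2 * k) * (e + p / e + p + q)"
          using cross True N(1) xz k e pq by (intro mult_mono) auto
        moreover have "N * t * \<zeta>\<^sup>2 \<le> N * t * (2 * (1 + q))"
          using sq N(1) xz by (intro mult_left_mono) auto
        moreover have "\<bar>\<zeta> - 1\<bar> * N \<le> (e + q / e) * N"
          using aq N(1) by (intro mult_right_mono) auto
        ultimately have "N * x * (\<zeta> * \<bar>z - 1\<bar>) + N * t * \<zeta>\<^sup>2 + \<bar>\<zeta> - 1\<bar> * N
            \<le> (2 * k + 1) * N * e + ((2 * k * N / e + 2 * k * N) * p + (2 * k * N + N / e) * q + 2 * N * (t * (1 + q)))"
          by (simp add: algebra_simps)
        also have "\<dots> \<le> D * e + (C * p + C * q + C * (t * (1 + q)))"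
          using C_ge pq xz e k
          by (intro add_mono mult_right_mono) (auto simp: D_def)
        finally have "N * x * (\<zeta> * \<bar>z - 1\<bar>) + N * t * \<zeta>\<^sup>2 + \<bar>\<zeta> - 1\<bar> * N
            \<le> D * e + C * (p + q + t * (1 + q))" by (simp only: distrib_left)
        then have "t * (N * x * (\<zeta> * \<bar>z - 1\<bar>) + N * t * \<zeta>\<^sup>2 + \<bar>\<zeta> - 1\<bar> * N)
            \<le> t * (D * e + C * (p + q + t * (1 + q)))"
          using xz by (intro mult_left_mono) auto
        moreover have "4 * k\<^sup>2 * e * p \<le> D * e * p"
          using e pq k N(1) by (intro mult_right_mono) (auto simp: D_def)
        moreover have "A * p\<^sup>2 \<le> C * p\<^sup>2" using C_ge by (intro mult_right_mono) auto
        moreover have "t * (D * e + C * (p + q + t * (1 + q))) = D * e * t + C * t * (p + q + t * (1 + q))"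
          by (simp add: algebra_simps)
        moreover have "D * e * (p + t) = D * e * p + D * e * t" by (simp add: distrib_left)
        ultimately show ?thesis
          using first second unfolding p_def[symmetric] q_def[symmetric] p4 by linarith
      next
        case False
        \<comment> \<open>At \<open>x\<close> itself \<open>f\<close> and its derivatives vanish, so
          only the value at the moved point is left. It vanishes too unless
          \<open>z <= 1 / 2\<close>, and in that case \<open>(z - 1)^4 >= 1 / 16\<close>.\<close>
        then have "k < x" using k by linarith
        then have "\<bar>f (z * x + t * \<zeta>) - f x - x * f' x * (z - 1) - x\<^sup>2 * f'' x / 2 * (z - 1)\<^sup>2 - t * f' x\<bar>
            = \<bar>f (z * x + t * \<zeta>)\<bar>"
          using k0 by simp
        also have "\<dots> \<le> C * p\<^sup>2"
        proof (cases "z \<le> 1 / 2")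
          case True
          then have "(1 / 2) ^ 4 \<le> (1 - z) ^ 4" by (intro power_mono) auto
          also have "(1 - z) ^ 4 = p\<^sup>2" unfolding p_def power2_commute[of z 1] by simp
          finally have "16 * N * (1 / 16) \<le> C * p\<^sup>2"
            using C_ge N(1) by (intro mult_mono) (auto simp: power_divide)
          then show ?thesis using N(2)[OF y(1)] by simp
        next
          case False
          then have "1 / 2 * (2 * k) < z * x" using \<open>\<not> x \<le> 2 * k\<close> k xz
            by (intro mult_strict_mono) auto
          then have "k < z * x + t * \<zeta>" using xz by (simp add: add_strict_increasing2 add.commute)
          then show ?thesis using k0(1) C_ge by simp
        qed
        also have "\<dots> \<le> D * e * (p + t) + C * p\<^sup>2 + C * t * (p + q + t * (1 + q))"
          using D0 e pq xz C_ge by simp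
        finally show ?thesis unfolding p_def[symmetric] q_def[symmetric] p4 .
      qed
    qed
    then show ?thesis using C_ge(6) by blast
  qed
  moreover have "0 \<le> D" using k N(1) by (simp add: D_def)
  ultimately show ?thesis using that by blast
qed

text \<open>Taking expectations of the remainder bound and dividing by \<open>t\<close> leaves the
  first two moments of \<open>Z t - 1\<close> and the drift term \<open>t * f' x\<close>. The limit
  4 halves to the coefficient \<open>2 * x^2\<close>, the limit \<open>2 - 2 * \<mu>\<close>
  multiplies \<open>x\<close>, and the additive part contributes the 1.\<close>

lemma (in drifted_brownian_motion) generator:
  assumes f: "Cc2 {0..} f f' f''"
  shows "in_generator {0..} P f (\<lambda>x. 2 * x\<^sup>2 * f'' x + ((2 - 2 * \<mu>) * x + 1) * f' x)"
proof -
  let ?L = "\<lambda>x. 2 * x\<^sup>2 * f'' x + ((2 - 2 * \<mu>) * x + 1) * f' x"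
  obtain k where k: "0 < k" and k0: "\<And>x. k < x \<Longrightarrow> f x = 0" "\<And>x. k < x \<Longrightarrow> f' x = 0" "\<And>x. k < x \<Longrightarrow> f'' x = 0"
    and C0: "f \<in> C0 {0..}" "f' \<in> C0 {0..}" "f'' \<in> C0 {0..}"
    using Cc2_props[OF f] by blast
  obtain N where N: "0 < N" "\<And>x. 0 \<le> x \<Longrightarrow> \<bar>f x\<bar> \<le> N" using C0_bounded[OF C0(1)] by blast
  obtain N1 where N1: "0 < N1" "\<And>x. 0 \<le> x \<Longrightarrow> \<bar>f' x\<bar> \<le> N1" using C0_bounded[OF C0(2)] by blast
  obtain N2 where N2: "0 < N2" "\<And>x. 0 \<le> x \<Longrightarrow> \<bar>f'' x\<bar> \<le> N2" using C0_bounded[OF C0(3)] by blast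
  have LC0: "?L \<in> C0 {0..}"
    using C0[THEN C0_continuous] k0
    by (intro C0I_tail) (auto intro!: continuous_intros exI[of _ k])
  \<comment> \<open>These products are bounded on the whole half-line because \<open>f'\<close> and
    \<open>f''\<close> vanish beyond \<open>k\<close>. This makes convergence of the moments uniform
    in \<open>x\<close>.\<close>
  have b1: "\<bar>x * f' x\<bar> \<le> k * N1" and b2: "\<bar>x\<^sup>2 * f'' x / 2\<bar> \<le> k\<^sup>2 * N2" if x: "0 \<le> x" for x
  proof -
    show "\<bar>x * f' x\<bar> \<le> k * N1"
    proof (cases "x \<le> k")
      case True
      then show ?thesis using x N1 k unfolding abs_mult by (intro mult_mono) auto
    qed (use k0 k N1 in simp)
    show "\<bar>x\<^sup>2 * f'' x / 2\<bar> \<le> k\<^sup>2 * N2"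
    proof (cases "x \<le> k")
      case True
      then have "x\<^sup>2 * \<bar>f'' x\<bar> \<le> k\<^sup>2 * N2" using x N2 by (intro mult_mono power_mono) auto
      moreover have "\<bar>x\<^sup>2 * f'' x / 2\<bar> = x\<^sup>2 * \<bar>f'' x\<bar> / 2" by (simp add: abs_mult)
      moreover have "0 \<le> x\<^sup>2 * \<bar>f'' x\<bar>" by simp
      ultimately show ?thesis by linarith
    qed (use k0 N2 in simp)
  qed
  have fm: "f \<in> borel_measurable (restrict_space borel {0..})"
    by (rule borel_measurable_continuous_on_restrict[OF C0_continuous[OF C0(1)]])
  obtain D where D: "0 \<le> D"
    "\<And>e. 0 < e \<Longrightarrow> \<exists>C\<ge>0. \<forall>x\<ge>0. \<forall>z>0. \<forall>\<zeta>\<ge>0. \<forall>t>0.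
       \<bar>f (z * x + t * \<zeta>) - f x - x * f' x * (z - 1) - x\<^sup>2 * f'' x / 2 * (z - 1)\<^sup>2 - t * f' x\<bar>
       \<le> D * e * ((z - 1)\<^sup>2 + t) + C * (z - 1) ^ 4
         + C * t * ((z - 1)\<^sup>2 + (\<zeta> - 1)\<^sup>2 + t * (1 + (\<zeta> - 1)\<^sup>2))"
    using generator_remainder_bound[OF f] by blast
  have "uniform_limit {0..} (\<lambda>t x. ((\<integral>y. f y \<partial>P t x) - f x) / t) ?L (at_right 0)"
  proof (rule uniform_limitI)
    fix \<epsilon> :: real assume \<epsilon>: "0 < \<epsilon>"
    \<comment> \<open>The part of the error that does not vanish with \<open>t\<close> tends to
      \<open>D * e * (4 + 1)\<close>: the 4 is the limit of the second moment over \<open>t\<close>,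
      the 1 comes from \<open>t / t\<close>. The choice puts it below \<open>\<epsilon>\<close>,
      also when \<open>D = 0\<close>.\<close>
    define e where "e = \<epsilon> / (5 * D + 1)"
    have e: "0 < e" and De: "D * e * (4 + 1) < \<epsilon>"
      using \<epsilon> D(1) by (simp_all add: e_def field_simps)
    obtain C where C: "0 \<le> C" "\<And>x z \<zeta> t. 0 \<le> x \<Longrightarrow> 0 < z \<Longrightarrow> 0 \<le> \<zeta> \<Longrightarrow> 0 < t \<Longrightarrow>
       \<bar>f (z * x + t * \<zeta>) - f x - x * f' x * (z - 1) - x\<^sup>2 * f'' x / 2 * (z - 1)\<^sup>2 - t * f' x\<bar>
       \<le> D * e * ((z - 1)\<^sup>2 + t) + C * (z - 1) ^ 4
         + C * t * ((z - 1)\<^sup>2 + (\<zeta> - 1)\<^sup>2 + t * (1 + (\<zeta> - 1)\<^sup>2))"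
      using D(2)[OF e] by blast
    let ?E1 = "\<lambda>t. expectation (\<lambda>\<omega>. Z t \<omega> - 1)" and ?E2 = "\<lambda>t. expectation (\<lambda>\<omega>. (Z t \<omega> - 1)\<^sup>2)"
      and ?E4 = "\<lambda>t. expectation (\<lambda>\<omega>. (Z t \<omega> - 1) ^ 4)"
      and ?Q = "\<lambda>t. expectation (\<lambda>\<omega>. (\<xi> t \<omega> / t - 1)\<^sup>2)"
    \<comment> \<open>A bound free of \<open>x\<close>: the first two lines are the expected
      remainder over \<open>t\<close>, the last one compares the rescaled moments with their
      limits.\<close>
    define H where "H t = D * e * (?E2 t / t + 1) + C * (?E4 t / t)
        + C * (t * (?E2 t / t) + ?Q t + t * (1 + ?Q t))
        + k * N1 * \<bar>?E1 t / t - (2 - 2 * \<mu>)\<bar> + k\<^sup>2 * N2 * \<bar>?E2 t / t - 4\<bar>" for t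
    have "(H \<longlongrightarrow> D * e * (4 + 1) + C * 0 + C * (0 * 4 + 0 + 0 * (1 + 0))
        + k * N1 * \<bar>(2 - 2 * \<mu>) - (2 - 2 * \<mu>)\<bar> + k\<^sup>2 * N2 * \<bar>4 - 4\<bar>) (at_right 0)"
      unfolding H_def by (intro tendsto_intros Z_minus_1_tendsto xi_average_tendsto)
    then have "\<forall>\<^sub>F t in at_right 0. H t < \<epsilon>"
      by (rule order_tendstoD(2)) (use De in simp)
    moreover have "\<forall>\<^sub>F t in at_right 0. (0::real) < t" by (simp add: eventually_at_right_less)
    ultimately show "\<forall>\<^sub>F t in at_right 0. \<forall>x\<in>{0..}. dist (((\<integral>y. f y \<partial>P t x) - f x) / t) (?L x) < \<epsilon>"
    proof eventually_elim
      case (elim t)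
      then have t: "0 < t" by simp
      have E1: "has_bochner_integral M (\<lambda>\<omega>. Z t \<omega> - 1) (?E1 t)"
        and E2: "has_bochner_integral M (\<lambda>\<omega>. (Z t \<omega> - 1)\<^sup>2) (?E2 t)"
        and E4: "has_bochner_integral M (\<lambda>\<omega>. (Z t \<omega> - 1) ^ 4) (?E4 t)"
        using Z_minus_1[OF less_imp_le[OF t]] by (simp_all only: has_bochner_integral_iff)
      have Q: "has_bochner_integral M (\<lambda>\<omega>. (\<xi> t \<omega> / t - 1)\<^sup>2) (?Q t)"
        by (intro has_bochner_integral_integrable integrable_xi_average t)
      note const = has_bochner_integral_prob_const
      show ?case
      proof
        fix x :: real assume "x \<in> {0..}"
        then have x: "0 \<le> x" by simp
        let ?R = "\<lambda>\<omega>. f (\<Phi> t x \<omega>) - f x - x * f' x * (Z t \<omega> - 1)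
            - x\<^sup>2 * f'' x / 2 * (Z t \<omega> - 1)\<^sup>2 - t * f' x"
        let ?U = "\<lambda>\<omega>. D * e * ((Z t \<omega> - 1)\<^sup>2 + t) + C * (Z t \<omega> - 1) ^ 4
            + C * t * ((Z t \<omega> - 1)\<^sup>2 + (\<xi> t \<omega> / t - 1)\<^sup>2 + t * (1 + (\<xi> t \<omega> / t - 1)\<^sup>2))"
        have fl[measurable]: "(\<lambda>\<omega>. f (\<Phi> t x \<omega>)) \<in> borel_measurable M"
          using measurable_compose[OF flow_measurable_halfline[OF _ x] fm] t by simp
        have "integrable M (\<lambda>\<omega>. f (\<Phi> t x \<omega>))"
          using t x by (intro integrable_const_bound[of _ N]) (auto intro!: N flow_nonneg)
        moreover have "expectation (\<lambda>\<omega>. f (\<Phi> t x \<omega>)) = (\<integral>y. f y \<partial>P t x)"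
          using t x by (simp add: integral_P[OF fm])
        ultimately have Pf: "has_bochner_integral M (\<lambda>\<omega>. f (\<Phi> t x \<omega>)) (\<integral>y. f y \<partial>P t x)"
          by (simp add: has_bochner_integral_iff)
        have R: "has_bochner_integral M ?R ((\<integral>y. f y \<partial>P t x) - f x - x * f' x * ?E1 t
            - x\<^sup>2 * f'' x / 2 * ?E2 t - t * f' x)"
          by (intro has_bochner_integral_diff has_bochner_integral_mult_right Pf E1 E2 const)
        have U: "has_bochner_integral M ?U (D * e * (?E2 t + t) + C * ?E4 t
            + C * t * (?E2 t + ?Q t + t * (1 + ?Q t)))"
          by (intro has_bochner_integral_add has_bochner_integral_mult_right E2 E4 Q const)
        have "\<bar>expectation ?R\<bar> \<le> expectation (\<lambda>\<omega>. \<bar>?R \<omega>\<bar>)"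
          by (rule integral_abs_bound)
        also have "\<dots> \<le> expectation ?U"
        proof (rule integral_mono)
          show "integrable M (\<lambda>\<omega>. \<bar>?R \<omega>\<bar>)" "integrable M ?U"
            using R U by (auto simp only: has_bochner_integral_iff intro!: integrable_abs)
          fix \<omega> assume \<omega>: "\<omega> \<in> space M"
          have "\<Phi> t x \<omega> = Z t \<omega> * x + t * (\<xi> t \<omega> / t)"
            unfolding flow_def using t by simp
          then show "\<bar>?R \<omega>\<bar> \<le> ?U \<omega>"
            using C(2)[of x "Z t \<omega>" "\<xi> t \<omega> / t" t] x t xi_nonneg[OF \<omega>, of t] by simp
        qed
        finally have bound: "\<bar>(\<integral>y. f y \<partial>P t x) - f x - x * f' x * ?E1 t - x\<^sup>2 * f'' x / 2 * ?E2 t - t * f' x\<bar>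
            \<le> D * e * (?E2 t + t) + C * ?E4 t + C * t * (?E2 t + ?Q t + t * (1 + ?Q t))"
          unfolding has_bochner_integral_integral_eq[OF R] has_bochner_integral_integral_eq[OF U] .
        define d where "d = ((\<integral>y. f y \<partial>P t x) - f x - x * f' x * ?E1 t - x\<^sup>2 * f'' x / 2 * ?E2 t - t * f' x) / t"
        have "\<bar>d\<bar> \<le> (D * e * (?E2 t + t) + C * ?E4 t + C * t * (?E2 t + ?Q t + t * (1 + ?Q t))) / t"
          unfolding d_def abs_divide using bound t by (simp add: divide_right_mono)
        also have "\<dots> = D * e * (?E2 t / t + 1) + C * (?E4 t / t) + C * (t * (?E2 t / t) + ?Q t + t * (1 + ?Q t))"
          using t by (simp add: add_divide_distrib distrib_left)
        finally have d_le: "\<bar>d\<bar> \<le> D * e * (?E2 t / t + 1) + C * (?E4 t / t)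
            + C * (t * (?E2 t / t) + ?Q t + t * (1 + ?Q t))" .
        have tri: "\<bar>u + v + w\<bar> \<le> \<bar>u\<bar> + \<bar>v\<bar> + \<bar>w\<bar>" for u v w :: real
          by linarith
        \<comment> \<open>The quotient differs from the operator by the rescaled remainder
          \<open>d\<close> and by the errors in the first and second moment.\<close>
        have "((\<integral>y. f y \<partial>P t x) - f x) / t - ?L x
            = d + x * f' x * (?E1 t / t - (2 - 2 * \<mu>)) + x\<^sup>2 * f'' x / 2 * (?E2 t / t - 4)"
          unfolding d_def using t by (simp add: field_simps)
        then have "dist (((\<integral>y. f y \<partial>P t x) - f x) / t) (?L x)
            \<le> \<bar>d\<bar> + \<bar>x * f' x * (?E1 t / t - (2 - 2 * \<mu>))\<bar> + \<bar>x\<^sup>2 * f'' x / 2 * (?E2 t / t - 4)\<bar>"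
          unfolding dist_real_def by (simp only: tri)
        moreover have "\<bar>x * f' x * (?E1 t / t - (2 - 2 * \<mu>))\<bar> \<le> k * N1 * \<bar>?E1 t / t - (2 - 2 * \<mu>)\<bar>"
          unfolding abs_mult[of "x * f' x"] using b1[OF x] by (rule mult_right_mono) simp
        moreover have "\<bar>x\<^sup>2 * f'' x / 2 * (?E2 t / t - 4)\<bar> \<le> k\<^sup>2 * N2 * \<bar>?E2 t / t - 4\<bar>"
          unfolding abs_mult[of "x\<^sup>2 * f'' x / 2"] using b2[OF x] by (rule mult_right_mono) simp
        moreover have "H t < \<epsilon>" using elim by simp
        ultimately show "dist (((\<integral>y. f y \<partial>P t x) - f x) / t) (?L x) < \<epsilon>"
          using d_le unfolding H_def by linarith
      qed
    qed
  qed
  with C0(1) LC0 show ?thesis unfolding in_generator_def by blast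
qed

section \<open>The strong Markov property\<close>

context drifted_brownian_motion
begin

lemma xi_continuous:
  assumes \<omega>: "\<omega> \<in> space M"
  shows "continuous_on {0..} (\<lambda>t. \<xi> t \<omega>)"
proof -
  let ?g = "\<lambda>s. exp (2 * W s \<omega>)"
  have W: "continuous_on {0..} (\<lambda>t. W t \<omega>)"
    by (intro continuous_on_with_drift B_continuous \<omega>)
  have "continuous (at t within {0..}) (\<lambda>t. integral {0..t} ?g)" if "0 \<le> t" for t
  proof -
    have "continuous_on {0..t + 1} (\<lambda>u. integral {0..u} ?g)"
      by (intro indefinite_integral_continuous_1 integrable_continuous_interval continuous_intros
          continuous_on_with_drift B_continuous_Icc \<omega>)
    then have "continuous (at t within {0..t + 1}) (\<lambda>u. integral {0..u} ?g)"
      using that by (simp add: continuous_on_eq_continuous_within)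
    moreover have "at t within {0..t + 1} = at t within {0..}"
      by (rule at_within_nhd[where S="{..<t + 1}"]) auto
    ultimately show ?thesis by (simp add: continuous_within)
  qed
  then have "continuous_on {0..} (\<lambda>t. integral {0..t} ?g)"
    by (simp add: continuous_on_eq_continuous_within)
  then have "continuous_on {0..} (\<lambda>t. exp (- 2 * W t \<omega>) * integral {0..t} ?g)"
    by (intro continuous_intros W)
  then show ?thesis
    unfolding xi_eq_integral[of _ B \<omega> \<mu>, OF B_continuous_Icc[OF \<omega>]] .
qed

section \<open>Measurability along stopping times\<close>

lemma xi_at_random_time_measurable:
  assumes "\<tau> \<in> borel_measurable M" "\<And>\<omega>. \<omega> \<in> space M \<Longrightarrow> 0 \<le> \<tau> \<omega>"
  shows "(\<lambda>\<omega>. \<xi> (\<tau> \<omega>) \<omega>) \<in> borel_measurable M"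
  by (rule borel_measurable_process_at_random_time[OF assms(1) xi_measurable_M assms(2) xi_continuous])

lemma stopping_time_measurable:
  assumes T: "stopping_time F T"
  shows "T \<in> borel_measurable (F \<top>)" "T \<in> borel_measurable M"
proof -
  show "T \<in> borel_measurable (F \<top>)"
  proof (rule measurable_stopping_time[OF T])
    show "sets (F t) \<subseteq> sets (F \<top>)" for t
      by (rule filtration.sets_F_mono[OF filtration_natural_filtration top_greatest])
  qed (simp add: space_natural_filtration)
  then show "T \<in> borel_measurable M"
    by (rule measurable_from_subalg[OF subalgebra_F])
qed

lemma subalgebra_pre_sigma:
  assumes T: "stopping_time F T"
  shows "subalgebra M (filtration.pre_sigma (space M) F T)"
proof -
  interpret filtration "space M" F by (rule filtration_natural_filtration)
  have "A \<in> sets M" if "A \<in> sets (pre_sigma T)" for A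
    using sets_pre_sigmaD[OF T that, of \<top>] subalgebra_F[of \<top>] by (auto simp: subalgebra_def)
  then show ?thesis by (auto simp: subalgebra_def space_pre_sigma)
qed

text \<open>On the event \<open>T <= u\<close> the time \<open>T\<close> may be capped at
  \<open>u\<close>. The capped time is measurable at \<open>u\<close>, and evaluating the path there
  uses the process up to \<open>u\<close> only. The composition with \<open>h\<close> allows the
  transition function itself to be inserted.\<close>

lemma xi_at_stopping_time_measurable:
  fixes h :: "real \<Rightarrow> real"
  assumes T: "stopping_time F T" and h: "h \<in> borel_measurable (restrict_space borel {0..})"
  shows "(\<lambda>\<omega>. indicator {\<omega>. T \<omega> < \<infinity>} \<omega> * h (\<xi> (enn2real (T \<omega>)) \<omega>))
    \<in> borel_measurable (filtration.pre_sigma (space M) F T)"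
    (is "?g \<in> _")
proof -
  interpret filtration "space M" F by (rule filtration_natural_filtration)
  have comp: "(\<lambda>\<omega>. h (Y \<omega>)) \<in> borel_measurable N"
    if "Y \<in> borel_measurable N" "\<And>\<omega>. \<omega> \<in> space N \<Longrightarrow> 0 \<le> Y \<omega>" for Y and N :: "'a measure"
    using that by (intro measurable_compose[OF measurable_restrict_space2 h]) auto
  note space_natural_filtration[simp]
  show ?thesis
  proof (rule measurableI)
    fix C :: "real set" assume C: "C \<in> sets borel"
    show "?g -` C \<inter> space (pre_sigma T) \<in> sets (pre_sigma T)"
    proof (rule sets_pre_sigmaI[OF T])
      fix u :: ennreal
      show "{\<omega> \<in> ?g -` C \<inter> space (pre_sigma T). T \<omega> \<le> u} \<in> sets (F u)"
      proof (cases u)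
        case top
        \<comment> \<open>The index \<open>u\<close> may be infinite. There the sigma-algebra is
          that of the whole process, and \<open>enn2real\<close> sends an infinite \<open>T\<close>
          to 0, where the indicator removes its effect.\<close>
        note stopping_time_measurable(1)[OF T, measurable]
        have "(\<lambda>\<omega>. \<xi> (enn2real (T \<omega>)) \<omega>) \<in> borel_measurable (F \<top>)"
          by (rule borel_measurable_process_at_random_time) (simp_all add: xi_measurable_F xi_continuous)
        then have [measurable]: "(\<lambda>\<omega>. h (\<xi> (enn2real (T \<omega>)) \<omega>)) \<in> borel_measurable (F \<top>)"
          by (rule comp) (auto simp: xi_nonneg)
        have "?g \<in> borel_measurable (F \<top>)" by measurable
        from measurable_sets[OF this C] have "?g -` C \<inter> space M \<in> sets (F \<top>)" by simp
        moreover have "{\<omega> \<in> ?g -` C \<inter> space (pre_sigma T). T \<omega> \<le> u} = ?g -` C \<inter> space M"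
          using top by (auto simp: space_pre_sigma)
        ultimately show ?thesis using top by simp
      next
        case (real t)
        let ?\<tau> = "\<lambda>\<omega>. enn2real (min u (T \<omega>))"
        \<comment> \<open>A level set of the capped time is the whole space for levels from
          \<open>u\<close> on, and an event \<open>T <= c\<close> with \<open>c < u\<close>
          otherwise.\<close>
        have "(\<lambda>\<omega>. min u (T \<omega>)) \<in> borel_measurable (F u)"
        proof (rule borel_measurableI_le)
          fix c
          show "{\<omega> \<in> space (F u). min u (T \<omega>) \<le> c} \<in> sets (F u)"
          proof (cases "u \<le> c")
            case True
            then have "{\<omega> \<in> space (F u). min u (T \<omega>) \<le> c} = space (F u)"
              by (auto intro: min.coboundedI1)
            then show ?thesis by (simp only: sets.top)
          next
            case False
            then show ?thesis
              using stopping_time_le_const[OF T, of c u] by (simp add: pred_def min_le_iff_disj)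
          qed
        qed
        then have \<tau>: "?\<tau> \<in> borel_measurable (F u)" by simp
        have \<tau>_le: "?\<tau> \<omega> \<le> t" for \<omega>
          using real by (metis enn2real_ennreal enn2real_mono ennreal_less_top min.cobounded1)
        \<comment> \<open>Freezing the process after \<open>t\<close> makes it measurable at
          \<open>u\<close> for every index; since the random time never exceeds \<open>t\<close>,
          its value there is unchanged.\<close>
        have "(\<lambda>\<omega>. \<xi> (min t (?\<tau> \<omega>)) \<omega>) \<in> borel_measurable (F u)"
        proof (rule borel_measurable_process_at_random_time[where X="\<lambda>s. \<xi> (min t s)"])
          show "\<xi> (min t s) \<in> borel_measurable (F u)" if "0 \<le> s" for s
            using real that by (intro xi_measurable_F) (auto simp: ennreal_leI)
          show "continuous_on {0..} (\<lambda>s. \<xi> (min t s) \<omega>)" if "\<omega> \<in> space (F u)" for \<omega>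
            using real that
            by (intro continuous_on_compose2[OF xi_continuous]) (auto intro!: continuous_intros)
        qed (use \<tau> in auto)
        then have "(\<lambda>\<omega>. \<xi> (?\<tau> \<omega>) \<omega>) \<in> borel_measurable (F u)"
          using \<tau>_le by (simp add: min_absorb2)
        then have "(\<lambda>\<omega>. h (\<xi> (?\<tau> \<omega>) \<omega>)) \<in> borel_measurable (F u)"
          by (rule comp) (auto simp: xi_nonneg)
        from measurable_sets[OF this C]
        have "(\<lambda>\<omega>. h (\<xi> (?\<tau> \<omega>) \<omega>)) -` C \<inter> space M \<inter> {\<omega> \<in> space M. T \<omega> \<le> u} \<in> sets (F u)"
          using stopping_timeD[OF T, of u] by (simp add: pred_def)
        also have "(\<lambda>\<omega>. h (\<xi> (?\<tau> \<omega>) \<omega>)) -` C \<inter> space M \<inter> {\<omega> \<in> space M. T \<omega> \<le> u}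
            = {\<omega> \<in> ?g -` C \<inter> space (pre_sigma T). T \<omega> \<le> u}"
        proof -
          have "u < \<infinity>" using real by simp
          then show ?thesis by (auto simp: space_pre_sigma min_absorb2)
        qed
        finally show ?thesis .
      qed
    qed
  qed simp
qed

text \<open>On the piece \<open>q \<le> T < r\<close> of an event of \<open>F\<^sub>T\<close> the random time is replaced by the constant \<open>r\<close>,
  for which the ordinary Markov property applies.\<close>

lemma pre_sigma_slice:
  assumes T: "stopping_time F T" and A: "A \<in> sets (filtration.pre_sigma (space M) F T)"
    and qr: "0 \<le> q" "q \<le> r"
  shows "{\<omega> \<in> A. ennreal q \<le> T \<omega> \<and> T \<omega> < ennreal r} \<in> sets (F (ennreal r))"
proof -
  interpret filtration "space M" F by (rule filtration_natural_filtration)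
  have less: "{\<omega> \<in> A. T \<omega> < ennreal c} \<in> sets (F (ennreal r))" if c: "0 \<le> c" "c \<le> r" for c
  proof -
    \<comment> \<open>The guard \<open>1 / real (Suc n) <= c\<close> matters because
      \<open>ennreal\<close> sends negative numbers to 0: without it the event \<open>T = 0\<close>
      would enter the union for \<open>c = 0\<close>.\<close>
    have "{\<omega> \<in> A. T \<omega> < ennreal c} = (\<Union>n::nat. {\<omega> \<in> A. T \<omega> \<le> ennreal (c - 1 / real (Suc n)) \<and> 1 / real (Suc n) \<le> c})"
    proof (intro set_eqI iffI)
      fix \<omega> assume \<omega>: "\<omega> \<in> {\<omega> \<in> A. T \<omega> < ennreal c}"
      then obtain t where t: "T \<omega> = ennreal t" "0 \<le> t" by (cases "T \<omega>") auto
      then have "t < c" using \<omega> c by (simp add: ennreal_less_iff)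
      then obtain n where "1 / real (Suc n) < c - t" using nat_approx_posE[of "c - t"] by auto
      with \<omega> t have "T \<omega> \<le> ennreal (c - 1 / real (Suc n)) \<and> 1 / real (Suc n) \<le> c"
        by (auto intro!: ennreal_leI)
      with \<omega> show "\<omega> \<in> (\<Union>n::nat. {\<omega> \<in> A. T \<omega> \<le> ennreal (c - 1 / real (Suc n)) \<and> 1 / real (Suc n) \<le> c})"
        by blast
    next
      fix \<omega> assume "\<omega> \<in> (\<Union>n::nat. {\<omega> \<in> A. T \<omega> \<le> ennreal (c - 1 / real (Suc n)) \<and> 1 / real (Suc n) \<le> c})"
      then obtain n where n: "\<omega> \<in> A" "T \<omega> \<le> ennreal (c - 1 / real (Suc n))" "1 / real (Suc n) \<le> c" by blast
      have "ennreal (c - 1 / real (Suc n)) < ennreal c"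
        using n(3) by (intro ennreal_lessI) (auto intro: less_le_trans[of _ "1 / real (Suc n)"])
      with n show "\<omega> \<in> {\<omega> \<in> A. T \<omega> < ennreal c}" by auto
    qed
    also have "\<dots> \<in> sets (F (ennreal r))"
    proof (intro sets.countable_UN subsetI, elim imageE)
      fix S and n :: nat
      assume S: "S = {\<omega> \<in> A. T \<omega> \<le> ennreal (c - 1 / real (Suc n)) \<and> 1 / real (Suc n) \<le> c}"
      show "S \<in> sets (F (ennreal r))"
      proof (cases "1 / real (Suc n) \<le> c")
        case True
        have "c - 1 / real (Suc n) \<le> r" using c by (smt (verit) divide_nonneg_nonneg of_nat_0_le_iff)
        then have "{\<omega> \<in> A. T \<omega> \<le> ennreal (c - 1 / real (Suc n))} \<in> sets (F (ennreal r))"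
          using sets_pre_sigmaD[OF T A] sets_F_mono[OF ennreal_leI] by blast
        then show ?thesis unfolding S using True by simp
      next
        case False
        then show ?thesis unfolding S by simp
      qed
    qed
    finally show ?thesis .
  qed
  have "{\<omega> \<in> A. ennreal q \<le> T \<omega> \<and> T \<omega> < ennreal r} = {\<omega> \<in> A. T \<omega> < ennreal r} - {\<omega> \<in> A. T \<omega> < ennreal q}"
    by auto
  then show ?thesis using less[of r] less[of q] qr by auto
qed

section \<open>From discretized times to all stopping times\<close>

lemma nn_integral_flow_measurable:
  assumes s: "0 \<le> s" and g: "g \<in> borel_measurable borel"
  shows "(\<lambda>y. \<integral>\<^sup>+\<omega>. ennreal (g (\<Phi> s y \<omega>)) \<partial>M) \<in> borel_measurable borel"
proof (rule borel_measurable_nn_integral)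
  have "(\<lambda>x. ennreal (g x)) \<in> borel_measurable borel" using g by simp
  from measurable_compose[OF flow_measurable_pair[OF s] this]
  show "(\<lambda>(y, \<omega>). ennreal (g (\<Phi> s y \<omega>))) \<in> borel_measurable (borel \<Otimes>\<^sub>M M)"
    by (simp add: case_prod_beta')
qed

text \<open>The rounded time is the right end of the cell of length \<open>1 / Suc n\<close>
  containing \<open>T\<close>. On the slice \<open>S k\<close> it is the constant
  \<open>r k\<close>, and the slice belongs to the past of \<open>r k\<close>; summing the Markov
  formula over the countably many slices gives the claim.\<close>

lemma strong_markov_discretized:
  fixes \<phi> :: "real \<Rightarrow> real"
  assumes T: "stopping_time F T" and A: "A \<in> sets (filtration.pre_sigma (space M) F T)"
    and s: "0 \<le> s" and [measurable]: "\<phi> \<in> borel_measurable borel"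
    and \<tau>: "\<And>\<omega>. \<tau> \<omega> = (of_int \<lfloor>real (Suc n) * enn2real (T \<omega>)\<rfloor> + 1) / real (Suc n)"
  shows "(\<integral>\<^sup>+\<omega>. ennreal (\<phi> (\<xi> (\<tau> \<omega> + s) \<omega>)) * indicator (A \<inter> {\<omega>. T \<omega> < \<infinity>}) \<omega> \<partial>M)
    = (\<integral>\<^sup>+\<omega>. (\<integral>\<^sup>+\<omega>'. ennreal (\<phi> (\<Phi> s (\<xi> (\<tau> \<omega>) \<omega>) \<omega>')) \<partial>M) * indicator (A \<inter> {\<omega>. T \<omega> < \<infinity>}) \<omega> \<partial>M)"
proof -
  interpret filtration "space M" F by (rule filtration_natural_filtration)
  note stopping_time_measurable(2)[OF T, measurable]
  have \<tau>_nn: "0 \<le> \<tau> \<omega>" for \<omega> unfolding \<tau> by simp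
  have \<tau>_meas[measurable]: "\<tau> \<in> borel_measurable M" unfolding \<tau>[abs_def] by measurable
  define r where "r k = real (Suc k) / real (Suc n)" for k
  have r: "0 \<le> r k" for k by (simp add: r_def)
  define S where "S k = {\<omega> \<in> A. ennreal (real k / real (Suc n)) \<le> T \<omega> \<and> T \<omega> < ennreal (r k)}" for k
  have S: "S k \<in> sets (F (ennreal (r k)))" for k
    unfolding S_def by (rule pre_sigma_slice[OF T A]) (auto simp: r_def divide_right_mono)
  then have SM[measurable]: "S k \<in> sets M" for k
    using subalgebra_F unfolding subalgebra_def by blast
  have S_iff: "\<omega> \<in> S k \<longleftrightarrow> \<omega> \<in> A \<and> T \<omega> < \<infinity> \<and> nat \<lfloor>real (Suc n) * enn2real (T \<omega>)\<rfloor> = k" for \<omega> k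
  proof (cases "T \<omega>")
    case (real t)
    have "0 \<le> \<lfloor>real (Suc n) * t\<rfloor>" using real(1) by simp
    then have "nat \<lfloor>real (Suc n) * t\<rfloor> = k \<longleftrightarrow> \<lfloor>real (Suc n) * t\<rfloor> = int k"
      by linarith
    then have "nat \<lfloor>real (Suc n) * t\<rfloor> = k \<longleftrightarrow> real k \<le> real (Suc n) * t \<and> real (Suc n) * t < real k + 1"
      unfolding floor_eq_iff by simp
    moreover have "real k / real (Suc n) \<le> t \<longleftrightarrow> real k \<le> real (Suc n) * t"
      "t < r k \<longleftrightarrow> real (Suc n) * t < real k + 1"
      by (simp_all add: r_def pos_divide_le_eq pos_less_divide_eq mult.commute del: of_nat_Suc) (simp add: add.commute)
    ultimately show ?thesis
      using real by (auto simp: S_def ennreal_less_iff ennreal_le_iff)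
  qed (simp add: S_def)
  have UN: "(\<Union>k. S k) = A \<inter> {\<omega>. T \<omega> < \<infinity>}" by (auto simp: S_iff)
  have disj: "disjoint_family S"
    unfolding disjoint_family_on_def
  proof (intro ballI impI equals0I)
    fix i j \<omega> assume "i \<noteq> j" "\<omega> \<in> S i \<inter> S j"
    then show False unfolding Int_iff S_iff by (elim conjE) simp
  qed
  have on_S: "\<tau> \<omega> = r k" if "\<omega> \<in> S k" for \<omega> k
  proof -
    have "nat \<lfloor>real (Suc n) * enn2real (T \<omega>)\<rfloor> = k" using that unfolding S_iff by (elim conjE)
    moreover have "0 \<le> \<lfloor>real (Suc n) * enn2real (T \<omega>)\<rfloor>" by simp
    ultimately have "of_int \<lfloor>real (Suc n) * enn2real (T \<omega>)\<rfloor> = real k" by linarith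
    then show ?thesis unfolding \<tau> r_def by simp
  qed
  let ?g = "\<lambda>y. \<integral>\<^sup>+\<omega>'. ennreal (\<phi> (\<Phi> s y \<omega>')) \<partial>M"
  have g[measurable]: "?g \<in> borel_measurable borel"
    by (rule nn_integral_flow_measurable[OF s]) measurable
  have X1[measurable]: "(\<lambda>\<omega>. \<xi> (\<tau> \<omega> + s) \<omega>) \<in> borel_measurable M"
    by (rule xi_at_random_time_measurable) (simp_all add: \<tau>_nn s)
  have X2[measurable]: "(\<lambda>\<omega>. \<xi> (\<tau> \<omega>) \<omega>) \<in> borel_measurable M"
    by (rule xi_at_random_time_measurable) (simp_all add: \<tau>_nn)
  have slice: "(\<integral>\<^sup>+\<omega>. ennreal (\<phi> (\<xi> (\<tau> \<omega> + s) \<omega>)) * indicator (S k) \<omega> \<partial>M)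
      = (\<integral>\<^sup>+\<omega>. ?g (\<xi> (\<tau> \<omega>) \<omega>) * indicator (S k) \<omega> \<partial>M)" for k
  proof -
    have "(\<integral>\<^sup>+\<omega>. ennreal (\<phi> (\<xi> (\<tau> \<omega> + s) \<omega>)) * indicator (S k) \<omega> \<partial>M)
        = (\<integral>\<^sup>+\<omega>. indicator (S k) \<omega> * ennreal (\<phi> (flow (shifted B (r k)) \<mu> s (\<xi> (r k) \<omega>) \<omega>)) \<partial>M)"
    proof (rule nn_integral_cong)
      fix \<omega> assume \<omega>: "\<omega> \<in> space M"
      show "ennreal (\<phi> (\<xi> (\<tau> \<omega> + s) \<omega>)) * indicator (S k) \<omega>
          = indicator (S k) \<omega> * ennreal (\<phi> (flow (shifted B (r k)) \<mu> s (\<xi> (r k) \<omega>) \<omega>))"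
        using flow_shifted[where B=B and \<omega>=\<omega> and r="r k" and s=s and \<mu>=\<mu> and x=0, OF B_continuous[OF \<omega>] r s] on_S[of \<omega> k]
        by (cases "\<omega> \<in> S k") (simp_all add: flow_zero_eq_xi)
    qed
    also have "\<dots> = (\<integral>\<^sup>+\<omega>. indicator (S k) \<omega> * ?g (\<xi> (r k) \<omega>) \<partial>M)"
      by (rule markov_nn_integral[OF r s S xi_measurable_F]) (auto simp: r)
    also have "\<dots> = (\<integral>\<^sup>+\<omega>. ?g (\<xi> (\<tau> \<omega>) \<omega>) * indicator (S k) \<omega> \<partial>M)"
    proof (rule nn_integral_cong)
      fix \<omega>
      show "indicator (S k) \<omega> * ?g (\<xi> (r k) \<omega>) = ?g (\<xi> (\<tau> \<omega>) \<omega>) * indicator (S k) \<omega>"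
        using on_S[of \<omega> k] by (cases "\<omega> \<in> S k") simp_all
    qed
    finally show ?thesis .
  qed
  have "(\<integral>\<^sup>+\<omega>. ennreal (\<phi> (\<xi> (\<tau> \<omega> + s) \<omega>)) * indicator (\<Union>k. S k) \<omega> \<partial>M)
      = (\<Sum>k. \<integral>\<^sup>+\<omega>. ennreal (\<phi> (\<xi> (\<tau> \<omega> + s) \<omega>)) * indicator (S k) \<omega> \<partial>M)"
    by (rule nn_integral_disjoint_family[OF _ SM disj]) measurable
  also have "\<dots> = (\<Sum>k. \<integral>\<^sup>+\<omega>. ?g (\<xi> (\<tau> \<omega>) \<omega>) * indicator (S k) \<omega> \<partial>M)"
    by (simp only: slice)
  also have "\<dots> = (\<integral>\<^sup>+\<omega>. ?g (\<xi> (\<tau> \<omega>) \<omega>) * indicator (\<Union>k. S k) \<omega> \<partial>M)"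
    by (rule nn_integral_disjoint_family[OF measurable_compose[OF X2 g] SM disj, symmetric])
  finally show ?thesis unfolding UN .
qed

text \<open>Rounding \<open>T\<close> up converges to \<open>T\<close> for each path. The left side
  follows by continuity of paths and of the test function, the right side by continuity of the
  transition function in its starting point. The event \<open>A\<close> stays fixed
  throughout.\<close>

lemma strong_markov_continuous:
  fixes \<phi> :: "real \<Rightarrow> real"
  assumes T: "stopping_time F T" and A: "A \<in> sets (filtration.pre_sigma (space M) F T)"
    and s: "0 \<le> s" and \<phi>: "continuous_on UNIV \<phi>" "\<And>x. 0 \<le> \<phi> x \<and> \<phi> x \<le> 1"
  defines "\<tau> \<equiv> \<lambda>\<omega>. enn2real (T \<omega>)"
  shows "(\<integral>\<^sup>+\<omega>. ennreal (\<phi> (\<xi> (\<tau> \<omega> + s) \<omega>)) * indicator (A \<inter> {\<omega>. T \<omega> < \<infinity>}) \<omega> \<partial>M)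
    = (\<integral>\<^sup>+\<omega>. (\<integral>\<^sup>+\<omega>'. ennreal (\<phi> (\<Phi> s (\<xi> (\<tau> \<omega>) \<omega>) \<omega>')) \<partial>M) * indicator (A \<inter> {\<omega>. T \<omega> < \<infinity>}) \<omega> \<partial>M)"
proof -
  note stopping_time_measurable(2)[OF T, measurable]
  have AM: "A \<in> sets M" using A subalgebra_pre_sigma[OF T] by (auto simp: subalgebra_def)
  have "A \<inter> {\<omega>. T \<omega> < \<infinity>} = {\<omega> \<in> space M. \<omega> \<in> A \<and> T \<omega> < \<infinity>}"
    using sets.sets_into_space[OF AM] by auto
  then have "A \<inter> {\<omega>. T \<omega> < \<infinity>} \<in> sets M" using AM by simp
  moreover define A' where "A' = A \<inter> {\<omega>. T \<omega> < \<infinity>}"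
  ultimately have A': "A' \<in> sets M" by simp
  have [measurable]: "\<phi> \<in> borel_measurable borel" using \<phi>(1) by (rule borel_measurable_continuous_onI)
  have \<tau>_nn: "0 \<le> \<tau> \<omega>" for \<omega> by (simp add: \<tau>_def)
  have [measurable]: "\<tau> \<in> borel_measurable M" unfolding \<tau>_def by measurable
  define \<tau>n where "\<tau>n n \<omega> = (of_int \<lfloor>real (Suc n) * \<tau> \<omega>\<rfloor> + 1) / real (Suc n)" for n \<omega>
  have [measurable]: "\<tau>n n \<in> borel_measurable M" for n unfolding \<tau>n_def[abs_def] by measurable
  have \<tau>n_nn: "0 \<le> \<tau>n n \<omega>" for n \<omega> unfolding \<tau>n_def by (simp add: \<tau>_nn)
  have \<tau>n_lim: "(\<lambda>n. \<tau>n n \<omega>) \<longlonglongrightarrow> \<tau> \<omega>" for \<omega>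
  proof (rule tendsto_sandwich[of "\<lambda>n. \<tau> \<omega>" _ _ "\<lambda>n. \<tau> \<omega> + 1 / real (Suc n)"])
    show "(\<lambda>n. \<tau> \<omega> + 1 / real (Suc n)) \<longlonglongrightarrow> \<tau> \<omega>"
      using tendsto_add[OF tendsto_const LIMSEQ_inverse_real_of_nat] by (simp add: inverse_eq_divide)
    have "\<tau> \<omega> \<le> \<tau>n n \<omega> \<and> \<tau>n n \<omega> \<le> \<tau> \<omega> + 1 / real (Suc n)" for n
    proof -
      have "real (Suc n) * (\<tau> \<omega> + 1 / real (Suc n)) = real (Suc n) * \<tau> \<omega> + 1"
        by (simp add: field_simps)
      moreover have "real (Suc n) * \<tau> \<omega> \<le> of_int \<lfloor>real (Suc n) * \<tau> \<omega>\<rfloor> + 1"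
        "of_int \<lfloor>real (Suc n) * \<tau> \<omega>\<rfloor> \<le> real (Suc n) * \<tau> \<omega>"
        by linarith+
      ultimately show ?thesis unfolding \<tau>n_def
        by (simp del: of_nat_Suc add: pos_le_divide_eq pos_divide_le_eq mult.commute)
    qed
    then show "\<forall>\<^sub>F n in sequentially. \<tau> \<omega> \<le> \<tau>n n \<omega>" "\<forall>\<^sub>F n in sequentially. \<tau>n n \<omega> \<le> \<tau> \<omega> + 1 / real (Suc n)"
      by auto
  qed auto
  let ?g = "\<lambda>y. \<integral>\<^sup>+\<omega>'. ennreal (\<phi> (\<Phi> s y \<omega>')) \<partial>M"
  have g[measurable]: "?g \<in> borel_measurable borel"
    by (rule nn_integral_flow_measurable[OF s]) measurable
  have g_le: "?g y \<le> 1" for y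
  proof -
    have "?g y \<le> (\<integral>\<^sup>+\<omega>'. 1 \<partial>M)" using \<phi>(2) by (intro nn_integral_mono) simp
    then show ?thesis by (simp add: emeasure_space_1)
  qed
  have e\<phi>: "(\<lambda>x. ennreal (\<phi> x)) \<in> borel_measurable borel" by simp
  \<comment> \<open>Continuity in the starting point is visible path by path, since the flow is
    affine in it.\<close>
  have g_lim: "(\<lambda>n. ?g (u n)) \<longlonglongrightarrow> ?g a" if u: "u \<longlonglongrightarrow> a" for u :: "nat \<Rightarrow> real" and a
  proof (rule nn_integral_dominated_convergence[where w="\<lambda>_. 1"])
    show "AE x in M. (\<lambda>n. ennreal (\<phi> (\<Phi> s (u n) x))) \<longlonglongrightarrow> ennreal (\<phi> (\<Phi> s a x))"
      unfolding flow_def using u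
      by (intro AE_I2 tendsto_ennrealI continuous_on_tendsto_compose[OF \<phi>(1)] tendsto_intros) auto
    show "AE x in M. ennreal (\<phi> (\<Phi> s (u j) x)) \<le> 1" for j
      using \<phi>(2) by (intro AE_I2) simp
  qed (simp_all add: emeasure_space_1 measurable_compose[OF flow_measurable_M[OF s] e\<phi>])
  have xim: "(\<lambda>\<omega>. \<xi> (\<sigma> \<omega>) \<omega>) \<in> borel_measurable M"
    if "\<sigma> \<in> borel_measurable M" "\<And>\<omega>. 0 \<le> \<sigma> \<omega>" for \<sigma>
    using that by (rule xi_at_random_time_measurable)
  have xlim: "(\<lambda>n. \<xi> (\<tau>n n \<omega> + c) \<omega>) \<longlonglongrightarrow> \<xi> (\<tau> \<omega> + c) \<omega>" if "\<omega> \<in> space M" "0 \<le> c" for \<omega> c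
  proof (rule continuous_on_tendsto_compose[OF xi_continuous[OF that(1)]])
    show "(\<lambda>n. \<tau>n n \<omega> + c) \<longlonglongrightarrow> \<tau> \<omega> + c"
      by (intro tendsto_add \<tau>n_lim tendsto_const)
  qed (simp_all add: \<tau>n_nn \<tau>_nn that(2))
  have lim1: "(\<lambda>n. \<integral>\<^sup>+\<omega>. ennreal (\<phi> (\<xi> (\<tau>n n \<omega> + s) \<omega>)) * indicator A' \<omega> \<partial>M)
      \<longlonglongrightarrow> (\<integral>\<^sup>+\<omega>. ennreal (\<phi> (\<xi> (\<tau> \<omega> + s) \<omega>)) * indicator A' \<omega> \<partial>M)"
  proof (rule nn_integral_dominated_convergence[where w="\<lambda>_. 1"])
    have "(\<lambda>\<omega>. \<xi> (\<tau>n n \<omega> + s) \<omega>) \<in> borel_measurable M" for n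
      by (rule xim) (simp_all add: \<tau>n_nn \<tau>_nn s)
    from measurable_compose[OF this e\<phi>]
    show "(\<lambda>\<omega>. ennreal (\<phi> (\<xi> (\<tau>n n \<omega> + s) \<omega>)) * indicator A' \<omega>) \<in> borel_measurable M" for n
      by (rule borel_measurable_times_ennreal) (rule borel_measurable_indicator[OF A'])
    have "(\<lambda>\<omega>. \<xi> (\<tau> \<omega> + s) \<omega>) \<in> borel_measurable M"
      by (rule xim) (simp_all add: \<tau>n_nn \<tau>_nn s)
    from measurable_compose[OF this e\<phi>]
    show "(\<lambda>\<omega>. ennreal (\<phi> (\<xi> (\<tau> \<omega> + s) \<omega>)) * indicator A' \<omega>) \<in> borel_measurable M"
      by (rule borel_measurable_times_ennreal) (rule borel_measurable_indicator[OF A'])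
    show "AE \<omega> in M. ennreal (\<phi> (\<xi> (\<tau>n n \<omega> + s) \<omega>)) * indicator A' \<omega> \<le> 1" for n
      using \<phi>(2) by (intro AE_I2) (simp add: indicator_def)
    show "AE \<omega> in M. (\<lambda>n. ennreal (\<phi> (\<xi> (\<tau>n n \<omega> + s) \<omega>)) * indicator A' \<omega>)
        \<longlonglongrightarrow> ennreal (\<phi> (\<xi> (\<tau> \<omega> + s) \<omega>)) * indicator A' \<omega>"
    proof (rule AE_I2)
      fix \<omega> assume "\<omega> \<in> space M"
      then have "(\<lambda>n. ennreal (\<phi> (\<xi> (\<tau>n n \<omega> + s) \<omega>))) \<longlonglongrightarrow> ennreal (\<phi> (\<xi> (\<tau> \<omega> + s) \<omega>))"
        by (intro tendsto_ennrealI continuous_on_tendsto_compose[OF \<phi>(1)] xlim) (simp_all add: s)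
      then show "(\<lambda>n. ennreal (\<phi> (\<xi> (\<tau>n n \<omega> + s) \<omega>)) * indicator A' \<omega>)
        \<longlonglongrightarrow> ennreal (\<phi> (\<xi> (\<tau> \<omega> + s) \<omega>)) * indicator A' \<omega>"
        by (cases "\<omega> \<in> A'") simp_all
    qed
  qed (simp_all add: emeasure_space_1)
  have lim2: "(\<lambda>n. \<integral>\<^sup>+\<omega>. ?g (\<xi> (\<tau>n n \<omega>) \<omega>) * indicator A' \<omega> \<partial>M)
      \<longlonglongrightarrow> (\<integral>\<^sup>+\<omega>. ?g (\<xi> (\<tau> \<omega>) \<omega>) * indicator A' \<omega> \<partial>M)"
  proof (rule nn_integral_dominated_convergence[where w="\<lambda>_. 1"])
    have "(\<lambda>\<omega>. \<xi> (\<tau>n n \<omega>) \<omega>) \<in> borel_measurable M" for n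
      by (rule xim) (simp_all add: \<tau>n_nn \<tau>_nn s)
    from measurable_compose[OF this g]
    show "(\<lambda>\<omega>. ?g (\<xi> (\<tau>n n \<omega>) \<omega>) * indicator A' \<omega>) \<in> borel_measurable M" for n
      by (rule borel_measurable_times_ennreal) (rule borel_measurable_indicator[OF A'])
    have "(\<lambda>\<omega>. \<xi> (\<tau> \<omega>) \<omega>) \<in> borel_measurable M"
      by (rule xim) (simp_all add: \<tau>n_nn \<tau>_nn s)
    from measurable_compose[OF this g]
    show "(\<lambda>\<omega>. ?g (\<xi> (\<tau> \<omega>) \<omega>) * indicator A' \<omega>) \<in> borel_measurable M"
      by (rule borel_measurable_times_ennreal) (rule borel_measurable_indicator[OF A'])
    show "AE \<omega> in M. ?g (\<xi> (\<tau>n n \<omega>) \<omega>) * indicator A' \<omega> \<le> 1" for n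
      by (intro AE_I2) (simp add: indicator_def g_le)
    show "AE \<omega> in M. (\<lambda>n. ?g (\<xi> (\<tau>n n \<omega>) \<omega>) * indicator A' \<omega>)
        \<longlonglongrightarrow> ?g (\<xi> (\<tau> \<omega>) \<omega>) * indicator A' \<omega>"
    proof (rule AE_I2)
      fix \<omega> assume "\<omega> \<in> space M"
      then have "(\<lambda>n. ?g (\<xi> (\<tau>n n \<omega>) \<omega>)) \<longlonglongrightarrow> ?g (\<xi> (\<tau> \<omega>) \<omega>)"
        using xlim[of \<omega> 0] by (intro g_lim) simp
      then show "(\<lambda>n. ?g (\<xi> (\<tau>n n \<omega>) \<omega>) * indicator A' \<omega>)
        \<longlonglongrightarrow> ?g (\<xi> (\<tau> \<omega>) \<omega>) * indicator A' \<omega>"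
        by (cases "\<omega> \<in> A'") simp_all
    qed
  qed (simp_all add: emeasure_space_1)
  have eq: "(\<integral>\<^sup>+\<omega>. ennreal (\<phi> (\<xi> (\<tau>n n \<omega> + s) \<omega>)) * indicator A' \<omega> \<partial>M)
      = (\<integral>\<^sup>+\<omega>. ?g (\<xi> (\<tau>n n \<omega>) \<omega>) * indicator A' \<omega> \<partial>M)" for n
    unfolding A'_def by (rule strong_markov_discretized[OF T A s _ \<tau>n_def[unfolded \<tau>_def]]) simp
  show ?thesis unfolding A'_def[symmetric] by (rule LIMSEQ_unique[OF lim1[unfolded eq] lim2])
qed


text \<open>Both sides are integrals of \<open>f\<close> against finite measures on the line. They
  agree on continuous functions, so the measures coincide and \<open>f\<close> may be any bounded
  Borel function.\<close>

lemma strong_markov_event: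
  fixes f :: "real \<Rightarrow> real"
  assumes T: "stopping_time F T" and A: "A \<in> sets (filtration.pre_sigma (space M) F T)"
    and s: "0 \<le> s" and f: "f \<in> borel_measurable (restrict_space borel {0..})"
    and N: "\<And>x. 0 \<le> x \<Longrightarrow> \<bar>f x\<bar> \<le> N"
  defines "\<tau> \<equiv> \<lambda>\<omega>. enn2real (T \<omega>)" and "A' \<equiv> A \<inter> {\<omega>. T \<omega> < \<infinity>}"
  shows "expectation (\<lambda>\<omega>. indicator A' \<omega> * f (\<xi> (\<tau> \<omega> + s) \<omega>))
    = expectation (\<lambda>\<omega>. indicator A' \<omega> * (\<integral>y. f y \<partial>P s (\<xi> (\<tau> \<omega>) \<omega>)))"
proof -
  have Tm: "T \<in> borel_measurable M" by (rule stopping_time_measurable(2)[OF T])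
  have AM: "A \<in> sets M" using A subalgebra_pre_sigma[OF T] by (auto simp: subalgebra_def)
  have "A' = A \<inter> {\<omega> \<in> space M. T \<omega> < \<infinity>}"
    using sets.sets_into_space[OF AM] by (auto simp: A'_def)
  then have A': "A' \<in> sets M" using AM Tm by simp
  have \<tau>_nn: "0 \<le> \<tau> \<omega>" for \<omega> by (simp add: \<tau>_def)
  have \<tau>_meas: "\<tau> \<in> borel_measurable M" unfolding \<tau>_def using Tm by simp
  have X1: "(\<lambda>\<omega>. \<xi> (\<tau> \<omega> + s) \<omega>) \<in> borel_measurable M"
    using \<tau>_meas by (intro xi_at_random_time_measurable borel_measurable_add) (simp_all add: \<tau>_nn s)
  have X2: "(\<lambda>\<omega>. \<xi> (\<tau> \<omega>) \<omega>) \<in> borel_measurable M"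
    by (rule xi_at_random_time_measurable) (simp_all add: \<tau>_nn \<tau>_meas)
  \<comment> \<open>Extension by 0 turns \<open>f\<close>, which is controlled only on the
    half-line, into a bounded Borel function on the whole line, as the image measures
    require.\<close>
  define f' where "f' x = indicator {0..} x *\<^sub>R f x" for x
  have f'm: "f' \<in> borel_measurable borel"
    unfolding f'_def[abs_def] using f by (subst (asm) borel_measurable_restrict_space_iff) simp_all
  have f'_bound: "\<bar>f' x\<bar> \<le> N" for x using N[of x] N[of 0] by (auto simp: f'_def indicator_def)
  \<comment> \<open>\<open>K\<close> is the probability restricted to the event; its total mass may
    be less than 1, which is why only finite measures are compared.\<close>
  define K where "K = density M (\<lambda>\<omega>. ennreal (indicator A' \<omega>))"
  have setsK[measurable_cong]: "sets K = sets M" and spaceK: "space K = space M" by (simp_all add: K_def)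
  have K_int: "(\<integral>\<^sup>+\<omega>. g \<omega> \<partial>K) = (\<integral>\<^sup>+\<omega>. g \<omega> * indicator A' \<omega> \<partial>M)" if "g \<in> borel_measurable M" for g
    unfolding K_def using A' that
    by (subst nn_integral_density) (simp_all add: ennreal_indicator mult.commute)
  have "emeasure K (space K) = emeasure M A'"
    using A' K_int[of "\<lambda>_. 1"] by (simp add: nn_integral_indicator)
  then have finK: "finite_measure K" by (intro finite_measureI) simp
  interpret K: finite_measure K by (rule finK)
  interpret KM: pair_sigma_finite K M ..
  have finKM: "finite_measure (K \<Otimes>\<^sub>M M)"
    by (rule finite_measure_pair_measure[OF finite_measure_axioms finK])
  \<comment> \<open>In \<open>?Y\<close> the second coordinate is a fresh copy of the probability
    space: it drives the flow after \<open>T\<close> independently of the first, which supplies the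
    value at \<open>T\<close>.\<close>
  let ?X = "\<lambda>\<omega>. \<xi> (\<tau> \<omega> + s) \<omega>" and ?Y = "\<lambda>(\<omega>, \<omega>'). \<Phi> s (\<xi> (\<tau> \<omega>) \<omega>) \<omega>'"
  have X: "?X \<in> borel_measurable K" using X1 setsK measurable_cong_sets by blast
  have X2K: "(\<lambda>\<omega>. \<xi> (\<tau> \<omega>) \<omega>) \<in> borel_measurable K" using X2 setsK measurable_cong_sets by blast
  have "(\<lambda>p. (\<xi> (\<tau> (fst p)) (fst p), snd p)) \<in> K \<Otimes>\<^sub>M M \<rightarrow>\<^sub>M borel \<Otimes>\<^sub>M M"
    by (intro measurable_Pair measurable_compose[OF measurable_fst X2K] measurable_snd)
  from measurable_compose[OF this flow_measurable_pair[OF s]]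
  have Y: "?Y \<in> borel_measurable (K \<Otimes>\<^sub>M M)" by (simp add: case_prod_beta')
  have eq: "distr K borel ?X = distr (K \<Otimes>\<^sub>M M) borel ?Y"
  proof (rule measure_eqI_continuous)
    show "finite_measure (distr K borel ?X)" by (rule K.finite_measure_distr[OF X])
    show "finite_measure (distr (K \<Otimes>\<^sub>M M) borel ?Y)" by (rule finite_measure.finite_measure_distr[OF finKM Y])
    fix \<phi> :: "real \<Rightarrow> real" assume \<phi>: "continuous_on UNIV \<phi>" "\<And>x. 0 \<le> \<phi> x \<and> \<phi> x \<le> 1"
    have \<phi>m: "\<phi> \<in> borel_measurable borel" using \<phi>(1) by (rule borel_measurable_continuous_onI)
    then have e\<phi>: "(\<lambda>x. ennreal (\<phi> x)) \<in> borel_measurable borel" by simp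
    have "(\<integral>\<^sup>+x. ennreal (\<phi> x) \<partial>distr K borel ?X) = (\<integral>\<^sup>+\<omega>. ennreal (\<phi> (?X \<omega>)) \<partial>K)"
      by (rule nn_integral_distr[OF X]) (simp add: e\<phi>)
    also have "\<dots> = (\<integral>\<^sup>+\<omega>. ennreal (\<phi> (?X \<omega>)) * indicator A' \<omega> \<partial>M)"
      by (rule K_int[OF measurable_compose[OF X1 e\<phi>]])
    also have "\<dots> = (\<integral>\<^sup>+\<omega>. (\<integral>\<^sup>+\<omega>'. ennreal (\<phi> (\<Phi> s (\<xi> (\<tau> \<omega>) \<omega>) \<omega>')) \<partial>M) * indicator A' \<omega> \<partial>M)"
      unfolding \<tau>_def A'_def by (rule strong_markov_continuous[OF T A s \<phi>])
    also have "\<dots> = (\<integral>\<^sup>+\<omega>. (\<integral>\<^sup>+\<omega>'. ennreal (\<phi> (\<Phi> s (\<xi> (\<tau> \<omega>) \<omega>) \<omega>')) \<partial>M) \<partial>K)"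
      by (rule K_int[OF measurable_compose[OF X2 nn_integral_flow_measurable[OF s \<phi>m]], symmetric])
    also have "\<dots> = (\<integral>\<^sup>+p. ennreal (\<phi> (?Y p)) \<partial>(K \<Otimes>\<^sub>M M))"
      using nn_integral_fst[OF measurable_compose[OF Y e\<phi>]] by simp
    also have "\<dots> = (\<integral>\<^sup>+x. ennreal (\<phi> x) \<partial>distr (K \<Otimes>\<^sub>M M) borel ?Y)"
      by (rule nn_integral_distr[OF Y, symmetric]) (simp add: e\<phi>)
    finally show "(\<integral>\<^sup>+x. ennreal (\<phi> x) \<partial>distr K borel ?X) = (\<integral>\<^sup>+x. ennreal (\<phi> x) \<partial>distr (K \<Otimes>\<^sub>M M) borel ?Y)" .
  qed simp_all
  have intY: "integrable (K \<Otimes>\<^sub>M M) (\<lambda>p. f' (?Y p))"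
    by (rule finite_measure.integrable_const_bound[OF finKM, of _ N])
      (auto simp: f'_bound intro!: measurable_compose[OF Y f'm])
  have K_integral: "(\<integral>\<omega>. g \<omega> \<partial>K) = expectation (\<lambda>\<omega>. indicator A' \<omega> * g \<omega>)" if "g \<in> borel_measurable M" for g :: "'a \<Rightarrow> real"
    unfolding K_def using A' that by (subst integral_density) auto
  have hm: "(\<lambda>x. \<integral>y. f y \<partial>P s x) \<in> borel_measurable (restrict_space borel {0..})"
    by (rule measurable_compose[OF measurable_prob_algebraD[OF P_kernel[OF s]]
          integral_measurable_subprob_algebra[OF f]])
  have X2S: "(\<lambda>\<omega>. \<xi> (\<tau> \<omega>) \<omega>) \<in> measurable M (restrict_space borel {0..})"
    by (rule measurable_restrict_space2[OF _ X2]) (auto simp: xi_nonneg \<tau>_nn)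
  have "expectation (\<lambda>\<omega>. indicator A' \<omega> * f (?X \<omega>)) = expectation (\<lambda>\<omega>. indicator A' \<omega> * f' (?X \<omega>))"
    by (intro Bochner_Integration.integral_cong refl) (simp add: f'_def xi_nonneg \<tau>_nn s)
  also have "\<dots> = (\<integral>\<omega>. f' (?X \<omega>) \<partial>K)"
    by (rule K_integral[OF measurable_compose[OF X1 f'm], symmetric])
  also have "\<dots> = (\<integral>x. f' x \<partial>distr K borel ?X)" by (rule integral_distr[OF X f'm, symmetric])
  also have "\<dots> = (\<integral>p. f' (?Y p) \<partial>(K \<Otimes>\<^sub>M M))" unfolding eq by (rule integral_distr[OF Y f'm])
  also have "\<dots> = (\<integral>\<omega>. \<integral>\<omega>'. f' (\<Phi> s (\<xi> (\<tau> \<omega>) \<omega>) \<omega>') \<partial>M \<partial>K)"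
    using KM.integral_fst'[OF intY] by simp
  also have "\<dots> = (\<integral>\<omega>. (\<integral>y. f y \<partial>P s (\<xi> (\<tau> \<omega>) \<omega>)) \<partial>K)"
  proof (intro Bochner_Integration.integral_cong refl)
    fix \<omega> assume "\<omega> \<in> space K"
    then have 0: "0 \<le> \<xi> (\<tau> \<omega>) \<omega>" using xi_nonneg \<tau>_nn spaceK by simp
    show "expectation (\<lambda>\<omega>'. f' (\<Phi> s (\<xi> (\<tau> \<omega>) \<omega>) \<omega>')) = (\<integral>y. f y \<partial>P s (\<xi> (\<tau> \<omega>) \<omega>))"
      unfolding integral_P[OF f s 0]
      by (intro Bochner_Integration.integral_cong refl) (simp add: f'_def flow_nonneg s 0)
  qed
  also have "\<dots> = expectation (\<lambda>\<omega>. indicator A' \<omega> * (\<integral>y. f y \<partial>P s (\<xi> (\<tau> \<omega>) \<omega>)))"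
    by (rule K_integral[OF measurable_compose[OF X2S hm]])
  finally show ?thesis .
qed

text \<open>Conditional expectation is characterised by two facts: the candidate is measurable with
  respect to the stopped sigma-algebra, and both integrands have equal integrals over each of its
  events.\<close>

lemma xi_strong_markov: "strong_markov M F {0..} P \<xi>"
  unfolding strong_markov_def
proof (intro allI impI)
  fix T and s :: real and f :: "real \<Rightarrow> real"
  assume T: "stopping_time F T" and s: "0 \<le> s" and f: "f \<in> borel_measurable (restrict_space borel {0..})"
    and "bounded (f ` {0..})"
  then obtain N where N: "\<And>x. 0 \<le> x \<Longrightarrow> \<bar>f x\<bar> \<le> N" by (auto simp: bounded_iff)
  let ?FT = "filtration.pre_sigma (space M) F T"
  let ?I = "\<lambda>\<omega>. indicator {\<omega>. T \<omega> < \<infinity>} \<omega> :: real"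
  let ?X = "\<lambda>\<omega>. \<xi> (enn2real (T \<omega>) + s) \<omega>" and ?Y = "\<lambda>\<omega>. \<xi> (enn2real (T \<omega>)) \<omega>"
  let ?h = "\<lambda>x. \<integral>y. f y \<partial>P s x"
  have sub: "subalgebra M ?FT" by (rule subalgebra_pre_sigma[OF T])
  interpret finite_measure_subalgebra M ?FT
    by unfold_locales (rule sub)
  have Tm: "T \<in> borel_measurable M" by (rule stopping_time_measurable(2)[OF T])
  have hm: "?h \<in> borel_measurable (restrict_space borel {0..})"
    by (rule measurable_compose[OF measurable_prob_algebraD[OF P_kernel[OF s]]
          integral_measurable_subprob_algebra[OF f]])
  have h_bound: "\<bar>?h x\<bar> \<le> N" if x: "0 \<le> x" for x
  proof -
    have fl: "(\<lambda>\<omega>. f (\<Phi> s x \<omega>)) \<in> borel_measurable M"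
      by (rule measurable_compose[OF flow_measurable_halfline[OF s x] f])
    have b: "\<bar>f (\<Phi> s x \<omega>)\<bar> \<le> N" if "\<omega> \<in> space M" for \<omega>
      using N flow_nonneg[OF that s x] by blast
    have int: "integrable M (\<lambda>\<omega>. f (\<Phi> s x \<omega>))"
      by (rule integrable_const_bound[of _ N]) (use b fl in auto)
    have "\<bar>?h x\<bar> \<le> expectation (\<lambda>\<omega>. \<bar>f (\<Phi> s x \<omega>)\<bar>)"
      unfolding integral_P[OF f s x] by (rule integral_abs_bound)
    also have "\<dots> \<le> expectation (\<lambda>\<omega>. N)"
      by (rule integral_mono) (use int b in auto)
    finally show ?thesis by (simp add: prob_space)
  qed
  have gF: "(\<lambda>\<omega>. ?I \<omega> * ?h (?Y \<omega>)) \<in> borel_measurable ?FT"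
    by (rule xi_at_stopping_time_measurable[OF T hm])
  have "(\<lambda>\<omega>. enn2real (T \<omega>) + s) \<in> borel_measurable M" using Tm by simp
  then have "?X \<in> borel_measurable M"
    by (rule xi_at_random_time_measurable) (simp add: s)
  then have "?X \<in> measurable M (restrict_space borel {0..})"
    by (rule measurable_restrict_space2[rotated]) (auto simp: xi_nonneg s)
  from measurable_compose[OF this f] have fX: "(\<lambda>\<omega>. f (?X \<omega>)) \<in> borel_measurable M" .
  have IM: "?I \<in> borel_measurable M"
  proof -
    have "?I \<in> borel_measurable M \<longleftrightarrow> (indicator {\<omega> \<in> space M. T \<omega> < \<infinity>} :: 'a \<Rightarrow> real) \<in> borel_measurable M"
      by (rule measurable_cong) (simp add: indicator_def)
    then show ?thesis using Tm by simp
  qed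
  have int1: "integrable M (\<lambda>\<omega>. ?I \<omega> * f (?X \<omega>))"
  proof (rule integrable_const_bound[of _ "\<bar>N\<bar>"])
    show "AE \<omega> in M. norm (?I \<omega> * f (?X \<omega>)) \<le> \<bar>N\<bar>"
    proof (rule AE_I2)
      fix \<omega> assume "\<omega> \<in> space M"
      then have "\<bar>f (?X \<omega>)\<bar> \<le> N" by (intro N xi_nonneg) (simp_all add: s)
      moreover from this have "0 \<le> N" by linarith
      ultimately show "norm (?I \<omega> * f (?X \<omega>)) \<le> \<bar>N\<bar>" by (simp add: indicator_def)
    qed
  qed (rule borel_measurable_times[OF IM fX])
  have int2: "integrable M (\<lambda>\<omega>. ?I \<omega> * ?h (?Y \<omega>))"
  proof (rule integrable_const_bound[of _ "\<bar>N\<bar>"])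
    show "AE \<omega> in M. norm (?I \<omega> * ?h (?Y \<omega>)) \<le> \<bar>N\<bar>"
    proof (rule AE_I2)
      fix \<omega> assume "\<omega> \<in> space M"
      then have "\<bar>?h (?Y \<omega>)\<bar> \<le> N" by (intro h_bound xi_nonneg) simp_all
      moreover from this have "0 \<le> N" by linarith
      ultimately show "norm (?I \<omega> * ?h (?Y \<omega>)) \<le> \<bar>N\<bar>" by (simp add: indicator_def)
    qed
  qed (rule measurable_from_subalg[OF sub gF])
  show "AE \<omega> in M. real_cond_exp M ?FT (\<lambda>\<omega>. ?I \<omega> * f (?X \<omega>)) \<omega> = ?I \<omega> * ?h (?Y \<omega>)"
  proof (rule real_cond_exp_charact[OF _ int1 int2 gF])
    fix A assume A: "A \<in> sets ?FT"
    \<comment> \<open>The indicators of \<open>A\<close> and of finiteness of \<open>T\<close> merge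
      into one event, the form in which the integral identity was established.\<close>
    have split: "indicator A \<omega> * (?I \<omega> * c) = indicator (A \<inter> {\<omega>. T \<omega> < \<infinity>}) \<omega> * c" for \<omega> c
      by (simp add: indicator_def)
    show "(\<integral>\<omega>\<in>A. ?I \<omega> * f (?X \<omega>) \<partial>M) = (\<integral>\<omega>\<in>A. ?I \<omega> * ?h (?Y \<omega>) \<partial>M)"
      unfolding set_lebesgue_integral_def real_scaleR_def split
      by (rule strong_markov_event[OF T A s f N])
  qed
qed

lemma xi_diffusion:
  "diffusion_with_generator M F {0..} \<xi> (\<lambda>x. 2 * x\<^sup>2) (\<lambda>x. (2 - 2 * \<mu>) * x + 1)"
  unfolding diffusion_with_generator_def
proof (intro conjI allI impI ballI exI[of _ P])
  show "is_interval {0::real..}" by (simp add: is_interval_ci)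
  show "filtration (space M) F" by (rule filtration_natural_filtration)
  show "subalgebra M (F t)" for t by (rule subalgebra_F)
  show "\<xi> t \<in> borel_measurable (F (ennreal t))" if "0 \<le> t" for t
    using that by (rule xi_measurable_F) simp
  show "\<xi> t \<omega> \<in> {0..}" if "\<omega> \<in> space M" "0 \<le> t" for \<omega> t
    using xi_nonneg[OF that] by simp
qed (simp_all add: xi_continuous feller xi_strong_markov generator)

section \<open>Identities in law\<close>

text \<open>Reversing time swaps the roles of the endpoint and the running time: the exponent
  \<open>- 2 * (W t - W s)\<close> in the functional becomes \<open>- 2 * W (t - s)\<close>, and the
  substitution \<open>s\<close> to \<open>t - s\<close> finishes. The drift of the reversed path is
  again \<mu>.\<close>

lemma xi_time_reversal:
  assumes \<omega>: "\<omega> \<in> space M" and t: "0 \<le> t"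
  shows "xi (time_reversal B t) \<mu> t \<omega> = (LBINT s:{0..t}. exp (- 2 * W s \<omega>))"
proof -
  let ?W = "\<lambda>s. W s \<omega>" and ?R = "\<lambda>s. with_drift (time_reversal B t) \<mu> s \<omega>"
  have W0: "?W 0 = 0" by (simp add: with_drift_def B_0[OF \<omega>])
  have R: "?R u = ?W t - ?W (t - u)" for u
    by (simp add: with_drift_def time_reversal_def algebra_simps)
  have c: "continuous_on {0..t} (\<lambda>s. time_reversal B t s \<omega>)"
    unfolding time_reversal_def
    by (intro continuous_intros continuous_on_compose2[OF B_continuous_Icc[OF \<omega>, of t]]) auto
  have "xi (time_reversal B t) \<mu> t \<omega> = exp (- 2 * ?R t) * integral {0..t} (\<lambda>s. exp (2 * ?R s))"
    by (rule xi_eq_integral[where \<omega>=\<omega> and B="time_reversal B t", OF c])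
  also have "\<dots> = integral {0..t} (\<lambda>s. exp (- 2 * ?R t) * exp (2 * ?R s))" by simp
  also have "\<dots> = integral {0..t} (\<lambda>s. exp (- 2 * ?W (t - s)))"
    unfolding R mult_exp_exp by (simp add: W0 algebra_simps)
  also have "\<dots> = integral {- t..- 0} (\<lambda>s. exp (- 2 * ?W (t + s)))"
    using Henstock_Kurzweil_Integration.integral_reflect_real[of t 0 "\<lambda>s. exp (- 2 * ?W (t - s))"] by simp
  also have "\<dots> = integral {0..t} (\<lambda>s. exp (- 2 * ?W s))"
    using integral_shift_Icc_real[of "- t" 0 "\<lambda>s. exp (- 2 * ?W s)" t] by (simp add: comp_def)
  also have "\<dots> = (LBINT s:{0..t}. exp (- 2 * ?W s))"
    by (rule set_lebesgue_integral_eq_integral[symmetric])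
      (intro continuous_intros continuous_on_with_drift B_continuous_Icc \<omega>)
  finally show ?thesis .
qed

lemma distr_integral_exp:
  assumes t: "0 < t"
  shows "distr M borel (\<lambda>\<omega>. LBINT s:{0..t}. exp (- 2 * W s \<omega>)) = distr M borel (\<xi> t)"
proof -
  have "distr M borel (\<lambda>\<omega>. LBINT s:{0..t}. exp (- 2 * W s \<omega>))
      = distr M borel (flow (time_reversal B t) \<mu> t 0)"
    using t by (intro distr_cong refl) (simp add: flow_zero_eq_xi xi_time_reversal)
  also have "\<dots> = distr M borel (\<Phi> t 0)"
    using t by (intro distr_flow_eq prob_space_axioms wiener_on_time_reversal
        wiener_on_brownian_motion bm) auto
  also have "\<Phi> t 0 = \<xi> t" by (simp add: fun_eq_iff flow_zero_eq_xi)
  finally show ?thesis .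
qed

end

theorem theorem6p3:
  fixes M :: "'a measure" and B :: "real \<Rightarrow> 'a \<Rightarrow> real" and \<mu> :: real
  assumes "brownian_motion M B"
  shows
    "diffusion_with_generator M (natural_filtration M (with_drift B \<mu>)) {0..} (xi B \<mu>)
       (\<lambda>x. 2 * x\<^sup>2) (\<lambda>x. (2 - 2 * \<mu>) * x + 1)
     \<and> (\<forall>t>0.
          distr M borel (xi B \<mu> t)
            = distr M borel (\<lambda>\<omega>. LBINT s:{0..t}. exp (- 2 * with_drift B \<mu> s \<omega>)) \<and>
          distr M borel (\<lambda>\<omega>. LBINT s:{0..t}. exp (- 2 * with_drift B \<mu> s \<omega>))
            = distr M borel (\<lambda>\<omega>. LBINT s:{0..t}. exp (2 * with_drift B (- \<mu>) s \<omega>)))"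
proof (intro conjI allI impI)
  interpret drifted_brownian_motion M B \<mu>
    by unfold_locales (rule assms)
  \<comment> \<open>Only \<open>B\<close> changes sign, not the drift:
    \<open>- 2 * (- B s + \<mu> * s)\<close> equals \<open>2 * (B s - \<mu> * s)\<close>, the
    exponent of the third random variable.\<close>
  interpret neg: drifted_brownian_motion M "\<lambda>t \<omega>. - B t \<omega>" \<mu>
    by unfold_locales (rule brownian_motion_uminus[OF assms])
  show "diffusion_with_generator M (natural_filtration M (with_drift B \<mu>)) {0..} (xi B \<mu>)
       (\<lambda>x. 2 * x\<^sup>2) (\<lambda>x. (2 - 2 * \<mu>) * x + 1)"
    by (rule xi_diffusion)
  fix t :: real assume t: "0 < t"
  show 1: "distr M borel (xi B \<mu> t) = distr M borel (\<lambda>\<omega>. LBINT s:{0..t}. exp (- 2 * with_drift B \<mu> s \<omega>))"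
    by (rule distr_integral_exp[OF t, symmetric])
  have "- 2 * with_drift (\<lambda>t \<omega>. - B t \<omega>) \<mu> s \<omega> = 2 * with_drift B (- \<mu>) s \<omega>" for s \<omega>
    by (simp add: with_drift_def)
  then have 2: "distr M borel (\<lambda>\<omega>. LBINT s:{0..t}. exp (2 * with_drift B (- \<mu>) s \<omega>))
      = distr M borel (xi (\<lambda>t \<omega>. - B t \<omega>) \<mu> t)"
    using neg.distr_integral_exp[OF t] by (simp only:)
  \<comment> \<open>\<open>B\<close> and its reflection both satisfy \<open>wiener_on\<close>, so
    the functional with drift \<mu> has the same law for either; this joins the two chains of
    identities.\<close>
  have "distr M borel (flow (\<lambda>t \<omega>. - B t \<omega>) \<mu> t 0) = distr M borel (flow B \<mu> t 0)"
    using t by (intro distr_flow_eq prob_space_axioms wiener_on_brownian_motion neg.bm bm) auto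
  then have "distr M borel (xi (\<lambda>t \<omega>. - B t \<omega>) \<mu> t) = distr M borel (xi B \<mu> t)"
    unfolding flow_zero_eq_xi[abs_def] .
  then show "distr M borel (\<lambda>\<omega>. LBINT s:{0..t}. exp (- 2 * with_drift B \<mu> s \<omega>))
      = distr M borel (\<lambda>\<omega>. LBINT s:{0..t}. exp (2 * with_drift B (- \<mu>) s \<omega>))"
    using 1 2 by (simp only:)
qed

end
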